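(* Let $A$ be a ring, $(\mathcal{C},x)$ a Frobenius $A$-coring with a fixed grouplike element $x$ and Frobenius system $(\theta,z)$, and assume that there exists $a\in A$ such that $\theta(xa\otimes_Ax)=1_A$. Then the following assertions are equivalent: (1) $A$ is right FBN; (2) ${}^*\mathcal{C}$ is right FBN and $A$ is right noetherian; (3) $B=A^{\mathrm{co}\,\mathcal{C}}$ is right FBN and $A$ is right noetherian.
   Context: Rings are associative with unit. An $A$-coring is a coalgebra in the monoidal category of $A$-bimodules: an $A$-bimodule $\mathcal{C}$ with $A$-bimodule maps $\Delta:\mathcal{C}\to\mathcal{C}\otimes_A\mathcal{C}$, $\Delta(c)=c_{(1)}\otimes_Ac_{(2)}$ (summation understood), and $\varepsilon:\mathcal{C}\to A$, coassociative and counital. An element $x\in\mathcal{C}$ is grouplike if $\Delta(x)=x\otimes_Ax$ and $\varepsilon(x)=1_A$. The left dual ${}^*\mathcal{C}={}_A\mathrm{Hom}(\mathcal{C},A)$ (left $A$-linear maps) is a ring with multiplication $(f\#g)(c)=g(c_{(1)}f(c_{(2)}))$ and unit $\varepsilon$. $A^{\mathrm{co}\,\mathcal{C}}=\{a\in A\mid ax=xa\}$. $\mathcal{C}$ is Frobenius, with Frobenius system $(\theta,z)$, if $\theta:\mathcal{C}\otimes_A\mathcal{C}\to A$ is an $A$-bimodule map and $z\in\mathcal{C}$ satisfies $az=za$ for all $a\in A$, and for all $c,d\in\mathcal{C}$: $c_{(1)}\theta(c_{(2)}\otimes d)=\theta(c\otimes d_{(1)})d_{(2)}$ and $\theta(z\otimes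 c)=\theta(c\otimes z)=\varepsilon(c)$. A ring $T$ is right bounded if every essential right ideal contains a non-zero two-sided ideal; right fully bounded if $T/P$ is right bounded for every two-sided prime ideal $P$ of $T$; right FBN if it is right fully bounded and right noetherian. *)

theory Defs
  imports
    "HOL-Algebra.QuotRing"
    "HOL-Algebra.Ideal_Product"
    "HOL-Algebra.Free_Abelian_Groups"
begin

section \<open>Right FBN rings\<close>

locale right_ideal = additive_subgroup I R + ring R for I and R (structure) +
  assumes I_r_closed: "\<lbrakk>a \<in> I; r \<in> carrier R\<rbrakk> \<Longrightarrow> a \<otimes> r \<in> I"

definition essential_right_ideal :: "'a set \<Rightarrow> ('a, 'm) ring_scheme \<Rightarrow> bool" where
  "essential_right_ideal I R \<longleftrightarrow> right_ideal I R \<and>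
     (\<forall>J. right_ideal J R \<and> J \<noteq> {\<zero>\<^bsub>R\<^esub>} \<longrightarrow> I \<inter> J \<noteq> {\<zero>\<^bsub>R\<^esub>})"

definition right_noetherian :: "('a, 'm) ring_scheme \<Rightarrow> bool" where
  "right_noetherian R \<longleftrightarrow>
     (\<forall>I :: nat \<Rightarrow> 'a set. (\<forall>n. right_ideal (I n) R) \<and> (\<forall>n. I n \<subseteq> I (Suc n)) \<longrightarrow>
        (\<exists>n. \<forall>m\<ge>n. I m = I n))"

text \<open>The library's \<open>primeideal\<close> is restricted to commutative rings (and is stated elementwise).\<close>

definition prime_two_sided_ideal :: "'a set \<Rightarrow> ('a, 'm) ring_scheme \<Rightarrow> bool" where
  "prime_two_sided_ideal P R \<longleftrightarrow> ideal P R \<and> P \<noteq> carrier R \<and>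
     (\<forall>I J. ideal I R \<and> ideal J R \<and> I \<cdot>\<^bsub>R\<^esub> J \<subseteq> P \<longrightarrow> I \<subseteq> P \<or> J \<subseteq> P)"

definition right_bounded :: "('a, 'm) ring_scheme \<Rightarrow> bool" where
  "right_bounded R \<longleftrightarrow>
     (\<forall>I. essential_right_ideal I R \<longrightarrow> (\<exists>J. ideal J R \<and> J \<noteq> {\<zero>\<^bsub>R\<^esub>} \<and> J \<subseteq> I))"

definition right_fully_bounded :: "('a, 'm) ring_scheme \<Rightarrow> bool" where
  "right_fully_bounded R \<longleftrightarrow>
     (\<forall>P. prime_two_sided_ideal P R \<longrightarrow> right_bounded (R Quot P))"

definition right_FBN :: "('a, 'm) ring_scheme \<Rightarrow> bool" where
  "right_FBN R \<longleftrightarrow> right_fully_bounded R \<and> right_noetherian R"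


section \<open>Bimodules over a possibly noncommutative ring\<close>

text \<open>As in the library record \<open>module\<close>, the fields \<open>mult\<close> and \<open>one\<close> inherited
  from \<open>ring\<close> carry no meaning; only the additive group and the two actions are used.\<close>

record ('a, 'b) bimodule = "'b ring" +
  lact :: "'a \<Rightarrow> 'b \<Rightarrow> 'b" (infixr \<open>\<triangleright>\<index>\<close> 70)
  ract :: "'b \<Rightarrow> 'a \<Rightarrow> 'b" (infixl \<open>\<triangleleft>\<index>\<close> 70)

locale bimodule = R?: ring A + M?: abelian_group M
  for A :: "('a, 'm) ring_scheme" (structure) and M :: "('a, 'b) bimodule" (structure) +
  assumes lact_closed [simp, intro]:
      "\<lbrakk>a \<in> carrier A; m \<in> carrier M\<rbrakk> \<Longrightarrow> a \<triangleright>\<^bsub>M\<^esub> m \<in> carrier M"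
    and ract_closed [simp, intro]:
      "\<lbrakk>a \<in> carrier A; m \<in> carrier M\<rbrakk> \<Longrightarrow> m \<triangleleft>\<^bsub>M\<^esub> a \<in> carrier M"
    and lact_add_ring:
      "\<lbrakk>a \<in> carrier A; b \<in> carrier A; m \<in> carrier M\<rbrakk> \<Longrightarrow>
        (a \<oplus>\<^bsub>A\<^esub> b) \<triangleright>\<^bsub>M\<^esub> m = (a \<triangleright>\<^bsub>M\<^esub> m) \<oplus>\<^bsub>M\<^esub> (b \<triangleright>\<^bsub>M\<^esub> m)"
    and ract_add_ring:
      "\<lbrakk>a \<in> carrier A; b \<in> carrier A; m \<in> carrier M\<rbrakk> \<Longrightarrow>
        m \<triangleleft>\<^bsub>M\<^esub> (a \<oplus>\<^bsub>A\<^esub> b) = (m \<triangleleft>\<^bsub>M\<^esub> a) \<oplus>\<^bsub>M\<^esub> (m \<triangleleft>\<^bsub>M\<^esub> b)"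
    and lact_add:
      "\<lbrakk>a \<in> carrier A; m \<in> carrier M; n \<in> carrier M\<rbrakk> \<Longrightarrow>
        a \<triangleright>\<^bsub>M\<^esub> (m \<oplus>\<^bsub>M\<^esub> n) = (a \<triangleright>\<^bsub>M\<^esub> m) \<oplus>\<^bsub>M\<^esub> (a \<triangleright>\<^bsub>M\<^esub> n)"
    and ract_add:
      "\<lbrakk>a \<in> carrier A; m \<in> carrier M; n \<in> carrier M\<rbrakk> \<Longrightarrow>
        (m \<oplus>\<^bsub>M\<^esub> n) \<triangleleft>\<^bsub>M\<^esub> a = (m \<triangleleft>\<^bsub>M\<^esub> a) \<oplus>\<^bsub>M\<^esub> (n \<triangleleft>\<^bsub>M\<^esub> a)"
    and lact_mult:
      "\<lbrakk>a \<in> carrier A; b \<in> carrier A; m \<in> carrier M\<rbrakk> \<Longrightarrow>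
        (a \<otimes>\<^bsub>A\<^esub> b) \<triangleright>\<^bsub>M\<^esub> m = a \<triangleright>\<^bsub>M\<^esub> (b \<triangleright>\<^bsub>M\<^esub> m)"
    and ract_mult:
      "\<lbrakk>a \<in> carrier A; b \<in> carrier A; m \<in> carrier M\<rbrakk> \<Longrightarrow>
        m \<triangleleft>\<^bsub>M\<^esub> (a \<otimes>\<^bsub>A\<^esub> b) = (m \<triangleleft>\<^bsub>M\<^esub> a) \<triangleleft>\<^bsub>M\<^esub> b"
    and lact_one [simp]: "m \<in> carrier M \<Longrightarrow> \<one>\<^bsub>A\<^esub> \<triangleright>\<^bsub>M\<^esub> m = m"
    and ract_one [simp]: "m \<in> carrier M \<Longrightarrow> m \<triangleleft>\<^bsub>M\<^esub> \<one>\<^bsub>A\<^esub> = m"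
    and lact_ract:
      "\<lbrakk>a \<in> carrier A; b \<in> carrier A; m \<in> carrier M\<rbrakk> \<Longrightarrow>
        (a \<triangleright>\<^bsub>M\<^esub> m) \<triangleleft>\<^bsub>M\<^esub> b = a \<triangleright>\<^bsub>M\<^esub> (m \<triangleleft>\<^bsub>M\<^esub> b)"

definition regular_bimodule :: "('a, 'm) ring_scheme \<Rightarrow> ('a, 'a) bimodule" where
  "regular_bimodule A =
     \<lparr>carrier = carrier A, mult = mult A, one = \<one>\<^bsub>A\<^esub>, ring.zero = \<zero>\<^bsub>A\<^esub>, add = add A,
      lact = mult A, ract = mult A\<rparr>"

definition left_linear_maps ::
    "('a, 'm) ring_scheme \<Rightarrow> ('a, 'b) bimodule \<Rightarrow> ('a, 'c) bimodule \<Rightarrow> ('b \<Rightarrow> 'c) set" where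
  "left_linear_maps A M N = {f \<in> carrier M \<rightarrow> carrier N.
     (\<forall>m\<in>carrier M. \<forall>n\<in>carrier M. f (m \<oplus>\<^bsub>M\<^esub> n) = f m \<oplus>\<^bsub>N\<^esub> f n) \<and>
     (\<forall>a\<in>carrier A. \<forall>m\<in>carrier M. f (a \<triangleright>\<^bsub>M\<^esub> m) = a \<triangleright>\<^bsub>N\<^esub> f m)}"

definition bimodule_maps ::
    "('a, 'm) ring_scheme \<Rightarrow> ('a, 'b) bimodule \<Rightarrow> ('a, 'c) bimodule \<Rightarrow> ('b \<Rightarrow> 'c) set" where
  "bimodule_maps A M N = {f \<in> left_linear_maps A M N.
     \<forall>a\<in>carrier A. \<forall>m\<in>carrier M. f (m \<triangleleft>\<^bsub>M\<^esub> a) = f m \<triangleleft>\<^bsub>N\<^esub> a}"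


section \<open>Tensor products over \<open>A\<close>\<close>

definition tensor_relators ::
    "('a, 'm) ring_scheme \<Rightarrow> ('a, 'b) bimodule \<Rightarrow> ('a, 'c) bimodule \<Rightarrow> ('b \<times> 'c \<Rightarrow>\<^sub>0 int) set" where
  "tensor_relators A M N =
     {frag_of (m \<oplus>\<^bsub>M\<^esub> m', n) - frag_of (m, n) - frag_of (m', n) | m m' n.
        m \<in> carrier M \<and> m' \<in> carrier M \<and> n \<in> carrier N} \<union>
     {frag_of (m, n \<oplus>\<^bsub>N\<^esub> n') - frag_of (m, n) - frag_of (m, n') | m n n'.
        m \<in> carrier M \<and> n \<in> carrier N \<and> n' \<in> carrier N} \<union>
     {frag_of (m \<triangleleft>\<^bsub>M\<^esub> a, n) - frag_of (m, a \<triangleright>\<^bsub>N\<^esub> n) | m a n.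
        m \<in> carrier M \<and> a \<in> carrier A \<and> n \<in> carrier N}"

definition tensor_kernel ::
    "('a, 'm) ring_scheme \<Rightarrow> ('a, 'b) bimodule \<Rightarrow> ('a, 'c) bimodule \<Rightarrow> ('b \<times> 'c \<Rightarrow>\<^sub>0 int) set" where
  "tensor_kernel A M N =
     generate (free_Abelian_group (carrier M \<times> carrier N)) (tensor_relators A M N)"

type_synonym ('b, 'c) tensor = "('b \<times> 'c \<Rightarrow>\<^sub>0 int) set"

text \<open>The quotient group, rewritten additively.\<close>

definition tensor_group ::
    "('a, 'm) ring_scheme \<Rightarrow> ('a, 'b) bimodule \<Rightarrow> ('a, 'c) bimodule \<Rightarrow> ('b, 'c) tensor ring" where
  "tensor_group A M N =
     (let Q = free_Abelian_group (carrier M \<times> carrier N) Mod tensor_kernel A M N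
      in \<lparr>carrier = carrier Q, mult = undefined, one = undefined, ring.zero = one Q, add = mult Q\<rparr>)"

definition pure_tensor ::
    "('a, 'm) ring_scheme \<Rightarrow> ('a, 'b) bimodule \<Rightarrow> ('a, 'c) bimodule \<Rightarrow> 'b \<Rightarrow> 'c \<Rightarrow> ('b, 'c) tensor" where
  "pure_tensor A M N m n =
     tensor_kernel A M N #>\<^bsub>free_Abelian_group (carrier M \<times> carrier N)\<^esub> frag_of (m, n)"

text \<open>For an \<open>A\<close>-balanced biadditive \<open>\<beta>\<close> with values in the abelian group \<open>G\<close>,
  \<open>tensor_lift G \<beta>\<close> is the induced additive map with \<open>m \<otimes> n \<mapsto> \<beta> m n\<close>: all representatives of a
  class have the same value, so the image of the class is a singleton. In Sweedler notation,
  \<open>\<beta> c\<^sub>1 c\<^sub>2\<close> (summation understood) is \<open>tensor_lift G \<beta> (\<Delta> c)\<close>.\<close>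

definition tensor_lift :: "('g, 'm) ring_scheme \<Rightarrow> ('b \<Rightarrow> 'c \<Rightarrow> 'g) \<Rightarrow> ('b, 'c) tensor \<Rightarrow> 'g" where
  "tensor_lift G \<beta> X = the_elem
     ((\<lambda>p. \<Oplus>\<^bsub>G\<^esub>q\<in>Poly_Mapping.keys p. add_pow G (Poly_Mapping.lookup p q) (case_prod \<beta> q)) ` X)"

definition tensor_bimodule ::
    "('a, 'm) ring_scheme \<Rightarrow> ('a, 'b) bimodule \<Rightarrow> ('a, 'c) bimodule \<Rightarrow> ('a, ('b, 'c) tensor) bimodule" where
  "tensor_bimodule A M N =
     (let G = tensor_group A M N
      in \<lparr>carrier = carrier G, mult = undefined, one = undefined, ring.zero = \<zero>\<^bsub>G\<^esub>, add = add G,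
          lact = (\<lambda>a. tensor_lift G (\<lambda>m n. pure_tensor A M N (a \<triangleright>\<^bsub>M\<^esub> m) n)),
          ract = (\<lambda>X a. tensor_lift G (\<lambda>m n. pure_tensor A M N m (n \<triangleleft>\<^bsub>N\<^esub> a)) X)\<rparr>)"

text \<open>\<open>tensor_map A M' N' f g\<close> is \<open>f \<otimes> g\<close>, where \<open>M'\<close> and \<open>N'\<close> are the codomains of \<open>f\<close> and \<open>g\<close>.\<close>

definition tensor_map ::
    "('a, 'm) ring_scheme \<Rightarrow> ('a, 'd) bimodule \<Rightarrow> ('a, 'e) bimodule \<Rightarrow> ('b \<Rightarrow> 'd) \<Rightarrow> ('c \<Rightarrow> 'e) \<Rightarrow>
     ('b, 'c) tensor \<Rightarrow> ('d, 'e) tensor" where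
  "tensor_map A M' N' f g =
     tensor_lift (tensor_group A M' N') (\<lambda>m n. pure_tensor A M' N' (f m) (g n))"

text \<open>The canonical isomorphism from \<open>(M \<otimes> N) \<otimes> P\<close> to \<open>M \<otimes> (N \<otimes> P)\<close>.\<close>

definition tensor_assoc ::
    "('a, 'm) ring_scheme \<Rightarrow> ('a, 'b) bimodule \<Rightarrow> ('a, 'c) bimodule \<Rightarrow> ('a, 'd) bimodule \<Rightarrow>
     (('b, 'c) tensor, 'd) tensor \<Rightarrow> ('b, ('c, 'd) tensor) tensor" where
  "tensor_assoc A M N P =
     (let NP = tensor_bimodule A N P; G = tensor_group A M NP
      in tensor_lift G (\<lambda>u p.
           tensor_lift G (\<lambda>m n. pure_tensor A M NP m (pure_tensor A N P n p)) u))"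


section \<open>Corings\<close>

locale coring = bimodule A \<C>
  for A :: "('a, 'm) ring_scheme" and \<C> :: "('a, 'c) bimodule" +
  fixes \<Delta> :: "'c \<Rightarrow> ('c, 'c) tensor" and \<epsilon> :: "'c \<Rightarrow> 'a"
  assumes comult_bimodule_map: "\<Delta> \<in> bimodule_maps A \<C> (tensor_bimodule A \<C> \<C>)"
    and counit_bimodule_map: "\<epsilon> \<in> bimodule_maps A \<C> (regular_bimodule A)"
    and coassociative: "c \<in> carrier \<C> \<Longrightarrow>
      tensor_assoc A \<C> \<C> \<C> (tensor_map A (tensor_bimodule A \<C> \<C>) \<C> \<Delta> id (\<Delta> c)) =
      tensor_map A \<C> (tensor_bimodule A \<C> \<C>) id \<Delta> (\<Delta> c)"
    and left_counital: "c \<in> carrier \<C> \<Longrightarrow> tensor_lift \<C> (\<lambda>c\<^sub>1 c\<^sub>2. \<epsilon> c\<^sub>1 \<triangleright>\<^bsub>\<C>\<^esub> c\<^sub>2) (\<Delta> c) = c"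
    and right_counital: "c \<in> carrier \<C> \<Longrightarrow> tensor_lift \<C> (\<lambda>c\<^sub>1 c\<^sub>2. c\<^sub>1 \<triangleleft>\<^bsub>\<C>\<^esub> \<epsilon> c\<^sub>2) (\<Delta> c) = c"

definition grouplike ::
    "('a, 'm) ring_scheme \<Rightarrow> ('a, 'c) bimodule \<Rightarrow> ('c \<Rightarrow> ('c, 'c) tensor) \<Rightarrow> ('c \<Rightarrow> 'a) \<Rightarrow> 'c \<Rightarrow> bool" where
  "grouplike A \<C> \<Delta> \<epsilon> x \<longleftrightarrow> x \<in> carrier \<C> \<and> \<Delta> x = pure_tensor A \<C> \<C> x x \<and> \<epsilon> x = \<one>\<^bsub>A\<^esub>"

text \<open>Elements of the left dual are extensional, so that equality in the carrier is equality of maps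
  on \<open>\<C>\<close>.\<close>

definition left_dual ::
    "('a, 'm) ring_scheme \<Rightarrow> ('a, 'c) bimodule \<Rightarrow> ('c \<Rightarrow> ('c, 'c) tensor) \<Rightarrow> ('c \<Rightarrow> 'a) \<Rightarrow> ('c \<Rightarrow> 'a) ring" where
  "left_dual A \<C> \<Delta> \<epsilon> =
     \<lparr>carrier = left_linear_maps A \<C> (regular_bimodule A) \<inter> extensional (carrier \<C>),
      mult = (\<lambda>f g. \<lambda>c\<in>carrier \<C>. g (tensor_lift \<C> (\<lambda>c\<^sub>1 c\<^sub>2. c\<^sub>1 \<triangleleft>\<^bsub>\<C>\<^esub> f c\<^sub>2) (\<Delta> c))),
      one = restrict \<epsilon> (carrier \<C>),
      ring.zero = (\<lambda>c\<in>carrier \<C>. \<zero>\<^bsub>A\<^esub>),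
      add = (\<lambda>f g. \<lambda>c\<in>carrier \<C>. f c \<oplus>\<^bsub>A\<^esub> g c)\<rparr>"

definition coinvariants ::
    "('a, 'm) ring_scheme \<Rightarrow> ('a, 'c) bimodule \<Rightarrow> 'c \<Rightarrow> ('a, 'm) ring_scheme" where
  "coinvariants A \<C> x = A\<lparr>carrier := {a \<in> carrier A. a \<triangleright>\<^bsub>\<C>\<^esub> x = x \<triangleleft>\<^bsub>\<C>\<^esub> a}\<rparr>"

definition frobenius_system ::
    "('a, 'm) ring_scheme \<Rightarrow> ('a, 'c) bimodule \<Rightarrow> ('c \<Rightarrow> ('c, 'c) tensor) \<Rightarrow> ('c \<Rightarrow> 'a) \<Rightarrow>
     (('c, 'c) tensor \<Rightarrow> 'a) \<Rightarrow> 'c \<Rightarrow> bool" where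
  "frobenius_system A \<C> \<Delta> \<epsilon> \<theta> z \<longleftrightarrow>
     \<theta> \<in> bimodule_maps A (tensor_bimodule A \<C> \<C>) (regular_bimodule A) \<and>
     z \<in> carrier \<C> \<and> (\<forall>a\<in>carrier A. a \<triangleright>\<^bsub>\<C>\<^esub> z = z \<triangleleft>\<^bsub>\<C>\<^esub> a) \<and>
     (\<forall>c\<in>carrier \<C>. \<forall>d\<in>carrier \<C>.
        tensor_lift \<C> (\<lambda>c\<^sub>1 c\<^sub>2. c\<^sub>1 \<triangleleft>\<^bsub>\<C>\<^esub> \<theta> (pure_tensor A \<C> \<C> c\<^sub>2 d)) (\<Delta> c) =
        tensor_lift \<C> (\<lambda>d\<^sub>1 d\<^sub>2. \<theta> (pure_tensor A \<C> \<C> c d\<^sub>1) \<triangleright>\<^bsub>\<C>\<^esub> d\<^sub>2) (\<Delta> d)) \<and>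
     (\<forall>c\<in>carrier \<C>. \<theta> (pure_tensor A \<C> \<C> z c) = \<epsilon> c \<and> \<theta> (pure_tensor A \<C> \<C> c z) = \<epsilon> c)"

end

(*
  A right noetherian ring that is right FBN satisfies Gabriel's condition H: the annihilator of a
  noetherian module is the annihilator of a finite subset (Cauchon).  Let S be right FBN and S -> R a
  ring map making R a noetherian right S-module.  If I is a right ideal of R, essential modulo a
  prime P but without ideals larger than P, then condition H for the S-module R/I gives finitely many
  r in R such that the intersection K of the right ideals {k. r k : I} meets the image of S inside P.
  By Goldie, K contains an element c regular modulo P, and then the sum of the c^n S is direct modulo
  P, contradicting noetherianity.  Hence R is right FBN.  This applies to A -> *C, because *C and C
  are isomorphic right A-modules and C is generated by the left legs of Delta z, and to B -> A, because
  a B-submodule X of A is recovered from the right A-submodule X x A of C by means of theta(- a0, x).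
  Finally A is a right *C-module by y.f = f(x y), the map tr y = theta(x y, x) from A to B is
  B-bilinear with tr a0 = 1, and condition H for the *C-module A / {y. tr(y A) <= I} shows
  that B inherits boundedness from *C.
*)

theory Submission
  imports Defs "HOL-Algebra.Subrings"
begin

section \<open>Chain conditions and right modules\<close>

text \<open>The implications form the cycle (1), (2), (3), (1). Two of them climb a ring map, but
  none is at hand from the left dual \<open>D\<close> down to \<open>B\<close>. What replaces it is
  the form e = \<theta>(- \<open>a\<^sub>0\<close> \<otimes> x). The Frobenius identity gives (e #
  g)(c) = e(c) g(x), and the hypothesis on \<open>a\<^sub>0\<close> says e(x) = 1. So e is an
  idempotent of \<open>D\<close>, \<open>A\<close> is eD as a right \<open>D\<close>-module, and b
  \<mapsto> e b identifies \<open>B\<close> with the corner eDe. Nothing makes this corner full, so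
  Morita theory does not apply, and the descent goes through the noetherian \<open>D\<close>-module
  \<open>A\<close>. The obstacle in all three steps is that primes and right ideals of one ring have
  no evident counterpart in the other. Condition H bypasses it: the annihilator of a module becomes
  that of a finite set, hence a finite intersection of colon ideals, which is still essential. The
  contradiction is then reached next to a prime of the target ring alone. Noetherianity of
  \<open>A\<close> is carried along in (2) and (3) because it supplies the chain conditions on the
  modules involved.\<close>

definition has_acc :: "('a set \<Rightarrow> bool) \<Rightarrow> bool" where
  "has_acc Q \<longleftrightarrow> (\<forall>I :: nat \<Rightarrow> 'a set. (\<forall>n. Q (I n)) \<and> (\<forall>n. I n \<subseteq> I (Suc n)) \<longrightarrow>
     (\<exists>n. \<forall>m\<ge>n. I m = I n))"

lemma right_noetherian_iff_has_acc: "right_noetherian R \<longleftrightarrow> has_acc (\<lambda>I. right_ideal I R)"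
  by (simp add: right_noetherian_def has_acc_def)

lemma has_accD:
  assumes "has_acc Q" "\<And>n. Q (I n)" "\<And>n. I n \<subseteq> I (Suc n)"
  shows "\<exists>n. \<forall>m\<ge>n. I m = I n"
  using assms unfolding has_acc_def by simp

text \<open>With no maximal member, dependent choice builds a strictly ascending chain inside
  \<open>F\<close>. Every later choice of an extremal object goes through this form of
  noetherianity.\<close>

lemma has_acc_maximal:
  assumes acc: "has_acc Q" and X0: "X0 \<in> F" and Q: "\<And>X. X \<in> F \<Longrightarrow> Q X"
  shows "\<exists>X\<in>F. \<forall>Y\<in>F. X \<subseteq> Y \<longrightarrow> Y = X"
proof (rule ccontr)
  assume no_max: "\<not> (\<exists>X\<in>F. \<forall>Y\<in>F. X \<subseteq> Y \<longrightarrow> Y = X)"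
  have step: "\<exists>Y. Y \<in> F \<and> X \<subset> Y" if "X \<in> F" for X
    using no_max that by (auto simp: psubset_eq)
  have "\<exists>I. \<forall>n. I n \<in> F \<and> I n \<subset> I (Suc n)"
  proof (rule dependent_nat_choice)
    show "\<exists>X. X \<in> F" using X0 by (rule exI)
  qed (rule step)
  then obtain I where I: "\<forall>n. I n \<in> F \<and> I n \<subset> I (Suc n)"
    by (rule exE)
  have "\<exists>n. \<forall>m\<ge>n. I m = I n"
    by (rule has_accD [OF acc]) (use I Q in \<open>simp_all add: psubset_imp_subset\<close>)
  then obtain n where n: "\<forall>m\<ge>n. I m = I n" by (rule exE)
  have "I (Suc n) = I n" using n by (rule allE [of _ "Suc n"]) simp
  moreover have "I n \<subset> I (Suc n)" using I by simp
  ultimately show False by simp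
qed

text \<open>An injective monotone \<open>\<Phi>\<close> reflects stationary chains. It need not be
  linear or surjective, so preimages and sets such as {y. tr(yA) \<subseteq> I} are admissible; this
  is how noetherianity moves between the rings.\<close>

lemma has_acc_transfer:
  assumes acc: "has_acc Q'"
    and \<Phi>: "\<And>X. Q X \<Longrightarrow> Q' (\<Phi> X)"
    and mono: "\<And>X Y. Q X \<Longrightarrow> Q Y \<Longrightarrow> X \<subseteq> Y \<Longrightarrow> \<Phi> X \<subseteq> \<Phi> Y"
    and inj: "\<And>X Y. Q X \<Longrightarrow> Q Y \<Longrightarrow> \<Phi> X = \<Phi> Y \<Longrightarrow> X = Y"
  shows "has_acc Q"
  unfolding has_acc_def
proof (intro allI impI, elim conjE)
  fix I :: "nat \<Rightarrow> 'b set"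
  assume I: "\<forall>n. Q (I n)" "\<forall>n. I n \<subseteq> I (Suc n)"
  have "\<exists>n. \<forall>m\<ge>n. \<Phi> (I m) = \<Phi> (I n)"
  proof (rule has_accD [OF acc])
    show "Q' (\<Phi> (I n))" for n using I by (blast intro: \<Phi>)
    show "\<Phi> (I n) \<subseteq> \<Phi> (I (Suc n))" for n by (rule mono) (use I in simp_all)
  qed
  then obtain n where n: "\<forall>m\<ge>n. \<Phi> (I m) = \<Phi> (I n)" by (rule exE)
  have "I m = I n" if "n \<le> m" for m
    by (rule inj [OF _ _ n [rule_format, OF that]]) (use I in simp_all)
  then show "\<exists>n. \<forall>m\<ge>n. I m = I n" by blast
qed

text \<open>Negatives arise by acting with -1, see \<open>sub_uminus\<close>. The action is a
  separate argument because one group, such as \<open>A\<close>, is a module over several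
  rings.\<close>

definition rsubmodule ::
    "('s, 'm) ring_scheme \<Rightarrow> ('b, 'n) ring_scheme \<Rightarrow> ('b \<Rightarrow> 's \<Rightarrow> 'b) \<Rightarrow> 'b set \<Rightarrow> bool" where
  "rsubmodule S M act N \<longleftrightarrow> N \<subseteq> carrier M \<and> \<zero>\<^bsub>M\<^esub> \<in> N \<and>
     (\<forall>x\<in>N. \<forall>y\<in>N. x \<oplus>\<^bsub>M\<^esub> y \<in> N) \<and> (\<forall>x\<in>N. \<forall>s\<in>carrier S. act x s \<in> N)"

lemma rsubmoduleI:
  assumes "N \<subseteq> carrier M" "\<zero>\<^bsub>M\<^esub> \<in> N" "\<And>x y. x \<in> N \<Longrightarrow> y \<in> N \<Longrightarrow> x \<oplus>\<^bsub>M\<^esub> y \<in> N"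
    "\<And>x s. x \<in> N \<Longrightarrow> s \<in> carrier S \<Longrightarrow> act x s \<in> N"
  shows "rsubmodule S M act N"
  using assms by (simp add: rsubmodule_def)

lemma rsubmoduleD:
  assumes "rsubmodule S M act N"
  shows "N \<subseteq> carrier M" "\<zero>\<^bsub>M\<^esub> \<in> N" "x \<in> N \<Longrightarrow> y \<in> N \<Longrightarrow> x \<oplus>\<^bsub>M\<^esub> y \<in> N"
    "x \<in> N \<Longrightarrow> s \<in> carrier S \<Longrightarrow> act x s \<in> N"
  using assms by (simp_all add: rsubmodule_def)

lemma set_addI: "y \<in> N \<Longrightarrow> z \<in> K \<Longrightarrow> y \<oplus>\<^bsub>M\<^esub> z \<in> N <+>\<^bsub>M\<^esub> K"
  by (auto simp: set_add_def')

lemma set_addE: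
  assumes "x \<in> N <+>\<^bsub>M\<^esub> K"
  obtains y z where "y \<in> N" "z \<in> K" "x = y \<oplus>\<^bsub>M\<^esub> z"
proof -
  have "\<exists>y\<in>N. \<exists>z\<in>K. x = y \<oplus>\<^bsub>M\<^esub> z"
    using assms unfolding set_add_def' by simp
  with that show thesis by blast
qed

lemma rsubmodule_inter:
  "rsubmodule S M act N \<Longrightarrow> rsubmodule S M act K \<Longrightarrow> rsubmodule S M act (N \<inter> K)"
  by (auto simp: rsubmodule_def)

locale right_module = S: ring S + M: abelian_group M
  for S :: "('s, 'm) ring_scheme" and M :: "('b, 'n) ring_scheme" +
  fixes act :: "'b \<Rightarrow> 's \<Rightarrow> 'b" (infixl \<open>\<star>\<close> 70)
  assumes act_closed [simp, intro]:
      "\<lbrakk>x \<in> carrier M; s \<in> carrier S\<rbrakk> \<Longrightarrow> x \<star> s \<in> carrier M"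
    and act_add_left:
      "\<lbrakk>x \<in> carrier M; y \<in> carrier M; s \<in> carrier S\<rbrakk> \<Longrightarrow> (x \<oplus>\<^bsub>M\<^esub> y) \<star> s = x \<star> s \<oplus>\<^bsub>M\<^esub> y \<star> s"
    and act_add_right:
      "\<lbrakk>x \<in> carrier M; s \<in> carrier S; t \<in> carrier S\<rbrakk> \<Longrightarrow> x \<star> (s \<oplus>\<^bsub>S\<^esub> t) = x \<star> s \<oplus>\<^bsub>M\<^esub> x \<star> t"
    and act_mult:
      "\<lbrakk>x \<in> carrier M; s \<in> carrier S; t \<in> carrier S\<rbrakk> \<Longrightarrow> x \<star> (s \<otimes>\<^bsub>S\<^esub> t) = x \<star> s \<star> t"
    and act_one [simp]: "x \<in> carrier M \<Longrightarrow> x \<star> \<one>\<^bsub>S\<^esub> = x"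
begin

abbreviation sub :: "'b set \<Rightarrow> bool" where
  "sub \<equiv> rsubmodule S M act"

lemma act_zero_right [simp]:
  assumes "x \<in> carrier M"
  shows "x \<star> \<zero>\<^bsub>S\<^esub> = \<zero>\<^bsub>M\<^esub>"
proof -
  have "x \<star> \<zero>\<^bsub>S\<^esub> \<oplus>\<^bsub>M\<^esub> x \<star> \<zero>\<^bsub>S\<^esub> = x \<star> \<zero>\<^bsub>S\<^esub>"
    using assms by (simp flip: act_add_right)
  then show ?thesis using assms by simp
qed

lemma act_zero_left [simp]:
  assumes "s \<in> carrier S"
  shows "\<zero>\<^bsub>M\<^esub> \<star> s = \<zero>\<^bsub>M\<^esub>"
proof -
  have "\<zero>\<^bsub>M\<^esub> \<star> s \<oplus>\<^bsub>M\<^esub> \<zero>\<^bsub>M\<^esub> \<star> s = \<zero>\<^bsub>M\<^esub> \<star> s"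
    using assms by (simp flip: act_add_left)
  then show ?thesis using assms by simp
qed

lemma act_minus_one: "x \<in> carrier M \<Longrightarrow> x \<star> (\<ominus>\<^bsub>S\<^esub> \<one>\<^bsub>S\<^esub>) = \<ominus>\<^bsub>M\<^esub> x"
proof -
  assume x: "x \<in> carrier M"
  then have "x \<oplus>\<^bsub>M\<^esub> x \<star> (\<ominus>\<^bsub>S\<^esub> \<one>\<^bsub>S\<^esub>) = \<zero>\<^bsub>M\<^esub>"
    using act_add_right [of x "\<one>\<^bsub>S\<^esub>" "\<ominus>\<^bsub>S\<^esub> \<one>\<^bsub>S\<^esub>"] by (simp add: S.r_neg)
  then have "x \<star> (\<ominus>\<^bsub>S\<^esub> \<one>\<^bsub>S\<^esub>) \<oplus>\<^bsub>M\<^esub> x = \<zero>\<^bsub>M\<^esub>"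
    using x by (simp add: M.a_comm)
  from M.minus_equality [OF this] x show ?thesis by simp
qed

lemma sub_uminus: "sub N \<Longrightarrow> x \<in> N \<Longrightarrow> \<ominus>\<^bsub>M\<^esub> x \<in> N"
  using rsubmoduleD(1) [of S M act N] rsubmoduleD(4) [of S M act N x "\<ominus>\<^bsub>S\<^esub> \<one>\<^bsub>S\<^esub>"]
  by (auto simp: act_minus_one)

lemma sub_add_cancel_left:
  assumes N: "sub N" and "x \<in> N" "y \<in> carrier M" "x \<oplus>\<^bsub>M\<^esub> y \<in> N"
  shows "y \<in> N"
proof -
  have "x \<in> carrier M" using assms rsubmoduleD(1) by blast
  then have "y = \<ominus>\<^bsub>M\<^esub> x \<oplus>\<^bsub>M\<^esub> (x \<oplus>\<^bsub>M\<^esub> y)"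
    using assms by (simp add: M.r_neg1)
  then show ?thesis
    using rsubmoduleD(3) [OF N sub_uminus [OF N \<open>x \<in> N\<close>] \<open>x \<oplus>\<^bsub>M\<^esub> y \<in> N\<close>] by simp
qed

lemma sub_add_cancel_right:
  assumes N: "sub N" and "y \<in> N" "x \<in> carrier M" "x \<oplus>\<^bsub>M\<^esub> y \<in> N"
  shows "x \<in> N"
  using sub_add_cancel_left [OF N, of y x] assms rsubmoduleD(1) [OF N] by (auto simp: M.a_comm)

lemma sub_carrier: "sub (carrier M)"
  by (auto simp: rsubmodule_def)

lemma sub_zero: "sub {\<zero>\<^bsub>M\<^esub>}"
  by (auto simp: rsubmodule_def)

lemma sub_sum:
  assumes N: "sub N" and K: "sub K"
  shows "sub (N <+>\<^bsub>M\<^esub> K)" "N \<subseteq> N <+>\<^bsub>M\<^esub> K" "K \<subseteq> N <+>\<^bsub>M\<^esub> K"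
proof -
  have N_carr: "x \<in> carrier M" if "x \<in> N" for x using that rsubmoduleD(1) [OF N] by blast
  have K_carr: "x \<in> carrier M" if "x \<in> K" for x using that rsubmoduleD(1) [OF K] by blast
  show N': "N \<subseteq> N <+>\<^bsub>M\<^esub> K"
  proof
    fix x assume "x \<in> N"
    then show "x \<in> N <+>\<^bsub>M\<^esub> K"
      using set_addI [OF \<open>x \<in> N\<close> rsubmoduleD(2) [OF K], of M] N_carr by simp
  qed
  show "K \<subseteq> N <+>\<^bsub>M\<^esub> K"
  proof
    fix x assume "x \<in> K"
    then show "x \<in> N <+>\<^bsub>M\<^esub> K"
      using set_addI [OF rsubmoduleD(2) [OF N] \<open>x \<in> K\<close>, of M] K_carr by simp
  qed
  show "sub (N <+>\<^bsub>M\<^esub> K)"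
  proof (rule rsubmoduleI)
    show "N <+>\<^bsub>M\<^esub> K \<subseteq> carrier M"
      using N_carr K_carr by (auto elim!: set_addE)
    show "\<zero>\<^bsub>M\<^esub> \<in> N <+>\<^bsub>M\<^esub> K"
      using N' rsubmoduleD(2) [OF N] by blast
    fix w assume "w \<in> N <+>\<^bsub>M\<^esub> K"
    then obtain x y where x: "x \<in> N" and y: "y \<in> K" and w: "w = x \<oplus>\<^bsub>M\<^esub> y"
      by (rule set_addE)
    show "w \<star> s \<in> N <+>\<^bsub>M\<^esub> K" if s: "s \<in> carrier S" for s
      using set_addI [OF rsubmoduleD(4) [OF N x s] rsubmoduleD(4) [OF K y s], of M] x y w s
      by (simp add: act_add_left N_carr K_carr)
    fix w' assume "w' \<in> N <+>\<^bsub>M\<^esub> K"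
    then obtain x' y' where x': "x' \<in> N" and y': "y' \<in> K" and w': "w' = x' \<oplus>\<^bsub>M\<^esub> y'"
      by (rule set_addE)
    have "w \<oplus>\<^bsub>M\<^esub> w' = (x \<oplus>\<^bsub>M\<^esub> x') \<oplus>\<^bsub>M\<^esub> (y \<oplus>\<^bsub>M\<^esub> y')"
      using x y x' y' w w' by (simp add: M.a_ac N_carr K_carr)
    then show "w \<oplus>\<^bsub>M\<^esub> w' \<in> N <+>\<^bsub>M\<^esub> K"
      using set_addI [OF rsubmoduleD(3) [OF N x x'] rsubmoduleD(3) [OF K y y'], of M] by simp
  qed
qed

end

section \<open>The regular module and one-sided ideals\<close>

lemma (in ring) regular_right_module: "right_module R R (\<otimes>)"
  by unfold_locales (simp_all add: l_distr r_distr m_assoc)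

lemma (in ring) right_ideal_iff: "right_ideal I R \<longleftrightarrow> rsubmodule R R (\<otimes>) I"
proof
  assume "right_ideal I R"
  then interpret I: right_ideal I R .
  show "rsubmodule R R (\<otimes>) I"
    by (rule rsubmoduleI) (rule I.a_subset, simp_all add: I.I_r_closed)
next
  assume I: "rsubmodule R R (\<otimes>) I"
  interpret I: right_module R R "(\<otimes>)" by (rule regular_right_module)
  have "subgroup I (add_monoid R)"
  proof (rule add.subgroupI)
    show "I \<noteq> {}" using rsubmoduleD(2) [OF I] by blast
  qed (use rsubmoduleD(1,3) [OF I] I.sub_uminus [OF I] in simp_all)
  then show "right_ideal I R"
    by (intro right_ideal.intro right_ideal_axioms.intro additive_subgroup.intro ring_axioms)
      (simp_all add: rsubmoduleD(4) [OF I])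
qed

lemma (in ring) ideal_iff:
  "ideal I R \<longleftrightarrow> right_ideal I R \<and> (\<forall>x\<in>I. \<forall>r\<in>carrier R. r \<otimes> x \<in> I)"
proof
  assume "ideal I R"
  then interpret I: ideal I R .
  have "right_ideal I R"
    by (intro right_ideal.intro right_ideal_axioms.intro I.additive_subgroup_axioms ring_axioms)
      (rule I.I_r_closed)
  then show "right_ideal I R \<and> (\<forall>x\<in>I. \<forall>r\<in>carrier R. r \<otimes> x \<in> I)"
    by (simp add: I.I_l_closed)
next
  assume I: "right_ideal I R \<and> (\<forall>x\<in>I. \<forall>r\<in>carrier R. r \<otimes> x \<in> I)"
  then interpret I: right_ideal I R by blast
  show "ideal I R"
    by (intro ideal.intro ideal_axioms.intro I.additive_subgroup_axioms ring_axioms)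
      (use I I.I_r_closed in simp_all)
qed

lemma (in ring) right_noetherian_iff: "right_noetherian R \<longleftrightarrow> has_acc (rsubmodule R R (\<otimes>))"
  by (simp add: right_noetherian_iff_has_acc right_ideal_iff)

context right_module
begin

lemma colon_right_ideal:
  assumes N: "sub N" and m: "m \<in> carrier M"
  shows "rsubmodule S S (\<otimes>\<^bsub>S\<^esub>) {s \<in> carrier S. m \<star> s \<in> N}"
  using m rsubmoduleD [OF N] by (intro rsubmoduleI) (auto simp: act_add_right act_mult)

lemma sub_act_image:
  assumes K: "rsubmodule S S (\<otimes>\<^bsub>S\<^esub>) K" and m: "m \<in> carrier M"
  shows "sub ((\<star>) m ` K)"
proof (rule rsubmoduleI)
  note K' = rsubmoduleD [OF K]
  show "(\<star>) m ` K \<subseteq> carrier M" using K' m by auto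
  have "m \<star> \<zero>\<^bsub>S\<^esub> \<in> (\<star>) m ` K" using K' by blast
  then show "\<zero>\<^bsub>M\<^esub> \<in> (\<star>) m ` K" using m by simp
  fix x assume "x \<in> (\<star>) m ` K"
  then obtain k where k: "k \<in> K" "x = m \<star> k" by blast
  show "x \<star> s \<in> (\<star>) m ` K" if s: "s \<in> carrier S" for s
  proof (rule image_eqI)
    show "k \<otimes>\<^bsub>S\<^esub> s \<in> K" using K' k s by simp
    show "x \<star> s = m \<star> (k \<otimes>\<^bsub>S\<^esub> s)" using k s m K'(1) by (simp add: act_mult subsetD)
  qed
  fix y assume "y \<in> (\<star>) m ` K"
  then obtain l where l: "l \<in> K" "y = m \<star> l" by blast
  show "x \<oplus>\<^bsub>M\<^esub> y \<in> (\<star>) m ` K"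
  proof (rule image_eqI)
    show "k \<oplus>\<^bsub>S\<^esub> l \<in> K" using K' k l by simp
    show "x \<oplus>\<^bsub>M\<^esub> y = m \<star> (k \<oplus>\<^bsub>S\<^esub> l)"
      using k l m K'(1) by (simp add: act_add_right subsetD)
  qed
qed

subsection \<open>Noetherian modules\<close>

text \<open>The submodules inside \<open>X \<oplus> eS\<close> are controlled by their traces on \<open>X\<close> and by the right ideals
  of the coefficients of \<open>e\<close>.\<close>

lemma has_acc_add_cyclic:
  assumes noeth: "right_noetherian S" and X: "sub X" and e: "e \<in> carrier M"
    and acc: "has_acc (\<lambda>N. sub N \<and> N \<subseteq> X)"
  shows "has_acc (\<lambda>N. sub N \<and> N \<subseteq> X <+>\<^bsub>M\<^esub> (\<star>) e ` carrier S)"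
  unfolding has_acc_def
proof (intro allI impI, elim conjE)
  fix I :: "nat \<Rightarrow> 'b set"
  assume I: "\<forall>n. sub (I n) \<and> I n \<subseteq> X <+>\<^bsub>M\<^esub> (\<star>) e ` carrier S" and I_mono: "\<forall>n. I n \<subseteq> I (Suc n)"
  have subI: "sub (I n)" and I_le: "I n \<subseteq> X <+>\<^bsub>M\<^esub> (\<star>) e ` carrier S" for n using I by auto
  have mono: "I n \<subseteq> I m" if "n \<le> m" for n m
    using I_mono that by (metis lift_Suc_mono_le)
  define J where "J n = {s \<in> carrier S. e \<star> s \<in> I n <+>\<^bsub>M\<^esub> X}" for n
  have "\<exists>n. \<forall>m\<ge>n. I m \<inter> X = I n \<inter> X"
  proof (rule has_accD [OF acc])
    show "sub (I n \<inter> X) \<and> I n \<inter> X \<subseteq> X" for n using rsubmodule_inter [OF subI X] by simp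
    show "I n \<inter> X \<subseteq> I (Suc n) \<inter> X" for n using mono [of n "Suc n"] by auto
  qed
  then obtain n1 where n1: "\<forall>m\<ge>n1. I m \<inter> X = I n1 \<inter> X" by (rule exE)
  define J where "J n = {s \<in> carrier S. e \<star> s \<in> I n <+>\<^bsub>M\<^esub> X}" for n
  have "sub (I n \<inter> X) \<and> I n \<inter> X \<subseteq> X" "I n \<inter> X \<subseteq> I (Suc n) \<inter> X" for n
    using rsubmodule_inter [OF subI X] I_mono by auto
  then obtain n1 where "\<forall>m\<ge>n1. I m \<inter> X = I n1 \<inter> X"
    using has_accD [OF acc, of "\<lambda>n. I n \<inter> X"] by blast
  then have n1: "I m \<inter> X = I n1 \<inter> X" if "n1 \<le> m" for m using that by blast
  have accS: "has_acc (rsubmodule S S (\<otimes>\<^bsub>S\<^esub>))"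
    using noeth by (simp add: S.right_noetherian_iff)
  have subJ: "rsubmodule S S (\<otimes>\<^bsub>S\<^esub>) (J n)" for n
    unfolding J_def by (intro colon_right_ideal sub_sum subI X e)
  have J_mono: "J n \<subseteq> J (Suc n)" for n
    using mono [of n "Suc n"] unfolding J_def by (auto elim!: set_addE intro!: set_addI dest: subsetD)
  obtain n2 where n2: "\<forall>m\<ge>n2. J m = J n2"
    using has_accD [of _ J, OF accS subJ J_mono] by (rule exE)
  define n where "n = max n1 n2"
  have "I m \<subseteq> I n" if "n \<le> m" for m
  proof
    fix y assume y: "y \<in> I m"
    then obtain x s where x: "x \<in> X" and s: "s \<in> carrier S" and yxs: "y = x \<oplus>\<^bsub>M\<^esub> e \<star> s"
      using I_le [of m] by (blast elim: set_addE)
    have carr: "x \<in> carrier M" "y \<in> carrier M" "e \<star> s \<in> carrier M"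
      using x y s e rsubmoduleD(1) [OF X] rsubmoduleD(1) [OF subI] by auto
    have "e \<star> s = y \<oplus>\<^bsub>M\<^esub> \<ominus>\<^bsub>M\<^esub> x"
      using carr yxs by (simp add: M.a_comm M.r_neg1)
    then have "s \<in> J m"
      using s set_addI [OF y sub_uminus [OF X x], of M] unfolding J_def by simp
    moreover have "J m = J n"
      using n2 [rule_format, of m] n2 [rule_format, of n] that by (simp add: n_def)
    ultimately have "s \<in> J n" by simp
    then obtain y' x' where y': "y' \<in> I n" and x': "x' \<in> X" and es: "e \<star> s = y' \<oplus>\<^bsub>M\<^esub> x'"
      unfolding J_def by (blast elim: set_addE)
    have carr': "x' \<in> carrier M" "y' \<in> carrier M"
      using x' y' rsubmoduleD(1) [OF X] rsubmoduleD(1) [OF subI] by auto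
    \<comment> \<open>\<open>y\<close> and \<open>y'\<close> have the same \<open>e\<close>-part, so
      they differ by an element of \<open>X\<close>, where the traces of \<open>I m\<close> and
      \<open>I n\<close> already agree.\<close>
    have eq: "y = y' \<oplus>\<^bsub>M\<^esub> (x \<oplus>\<^bsub>M\<^esub> x')"
      using carr carr' yxs es by (simp add: M.a_ac)
    have "x \<oplus>\<^bsub>M\<^esub> x' \<in> I m"
      using sub_add_cancel_left [OF subI subsetD [OF mono [OF that] y'], of "x \<oplus>\<^bsub>M\<^esub> x'"]
        y eq carr carr' by simp
    moreover have "I m \<inter> X = I n \<inter> X"
      using n1 [rule_format, of m] n1 [rule_format, of n] that by (simp add: n_def)
    ultimately have "x \<oplus>\<^bsub>M\<^esub> x' \<in> I n"
      using rsubmoduleD(3) [OF X x x'] by blast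
    then show "y \<in> I n"
      using rsubmoduleD(3) [OF subI y'] eq by simp
  qed
  then have "I m = I n" if "n \<le> m" for m
    using that mono by blast
  then show "\<exists>n. \<forall>m\<ge>n. I m = I n" by blast
qed

text \<open>Generation is phrased through the submodules that contain \<open>E\<close>, so no linear
  combinations are written: the induction collects cyclic submodules into one \<open>X\<close>, and
  \<open>gen\<close> makes \<open>X\<close> everything.\<close>

lemma has_acc_finitely_generated:
  assumes noeth: "right_noetherian S" and E: "finite E" "E \<subseteq> carrier M"
    and gen: "\<And>N. sub N \<Longrightarrow> E \<subseteq> N \<Longrightarrow> carrier M \<subseteq> N"
  shows "has_acc sub"
proof -
  have "\<exists>X. sub X \<and> E \<subseteq> X \<and> has_acc (\<lambda>N. sub N \<and> N \<subseteq> X)"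
    using E
  proof (induction E rule: finite_induct)
    case empty
    have "sub N \<and> N \<subseteq> {\<zero>\<^bsub>M\<^esub>} \<longleftrightarrow> N = {\<zero>\<^bsub>M\<^esub>}" for N
      using sub_zero by (auto dest: rsubmoduleD(2))
    then have "has_acc (\<lambda>N. sub N \<and> N \<subseteq> {\<zero>\<^bsub>M\<^esub>})"
      by (simp add: has_acc_def)
    then show ?case using sub_zero by blast
  next
    case (insert e E)
    then obtain X where X: "sub X" "E \<subseteq> X" and acc: "has_acc (\<lambda>N. sub N \<and> N \<subseteq> X)" by auto
    have e: "e \<in> carrier M" using insert by simp
    have cyc: "sub ((\<star>) e ` carrier S)"
      using S.oneideal by (intro sub_act_image [OF _ e]) (simp add: S.right_ideal_iff S.ideal_iff)
    have "e \<in> (\<star>) e ` carrier S"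
      using e by (intro image_eqI [of _ _ "\<one>\<^bsub>S\<^esub>"]) simp_all
    then show ?case
      using sub_sum [OF X(1) cyc] has_acc_add_cyclic [OF noeth X(1) e acc] X(2) by blast
  qed
  then obtain X where X: "sub X" "E \<subseteq> X" and acc: "has_acc (\<lambda>N. sub N \<and> N \<subseteq> X)" by blast
  have "N \<subseteq> X" if "sub N" for N
    using gen [OF X] rsubmoduleD(1) [OF that] by (rule order_trans [rotated])
  then have "sub N \<and> N \<subseteq> X \<longleftrightarrow> sub N" for N by blast
  with acc show ?thesis by simp
qed

end

section \<open>Right ideals relative to a two-sided ideal\<close>

text \<open>This says that \<open>I\<close>/\<open>P\<close> is essential in
  \<open>R\<close>/\<open>P\<close>, expressed inside \<open>R\<close>. Elements, powers and
  annihilators thus stay in one ring throughout the Goldie argument.\<close>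

definition essential_over :: "('a, 'm) ring_scheme \<Rightarrow> 'a set \<Rightarrow> 'a set \<Rightarrow> bool" where
  "essential_over R P I \<longleftrightarrow> right_ideal I R \<and> P \<subseteq> I \<and>
     (\<forall>K. right_ideal K R \<and> P \<subseteq> K \<and> K \<noteq> P \<longrightarrow> \<not> I \<inter> K \<subseteq> P)"

lemma rsubmodule_vimage:
  assumes M: "abelian_group M" and N: "rsubmodule T N actN K"
    and h: "\<And>x. x \<in> carrier M \<Longrightarrow> h x \<in> carrier N" "h \<zero>\<^bsub>M\<^esub> = \<zero>\<^bsub>N\<^esub>"
      "\<And>x y. x \<in> carrier M \<Longrightarrow> y \<in> carrier M \<Longrightarrow> h (x \<oplus>\<^bsub>M\<^esub> y) = h x \<oplus>\<^bsub>N\<^esub> h y"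
    and act: "\<And>x s. x \<in> carrier M \<Longrightarrow> s \<in> carrier S \<Longrightarrow>
      actM x s \<in> carrier M \<and> j s \<in> carrier T \<and> h (actM x s) = actN (h x) (j s)"
  shows "rsubmodule S M actM {x \<in> carrier M. h x \<in> K}"
proof -
  interpret abelian_group M by fact
  show ?thesis
  proof (rule rsubmoduleI)
    fix x s assume "x \<in> {x \<in> carrier M. h x \<in> K}" "s \<in> carrier S"
    then show "actM x s \<in> {x \<in> carrier M. h x \<in> K}"
      using rsubmoduleD(4) [OF N, of "h x" "j s"] act [of x s] by simp
  qed (use rsubmoduleD(1-3) [OF N] h in simp_all)
qed

lemma rsubmodule_image:
  assumes N: "rsubmodule S M actM N"
    and h: "\<And>x. x \<in> carrier M \<Longrightarrow> h x \<in> carrier M'" "h \<zero>\<^bsub>M\<^esub> = \<zero>\<^bsub>M'\<^esub>"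
      "\<And>x y. x \<in> carrier M \<Longrightarrow> y \<in> carrier M \<Longrightarrow> h (x \<oplus>\<^bsub>M\<^esub> y) = h x \<oplus>\<^bsub>M'\<^esub> h y"
    and act: "\<And>x t. x \<in> carrier M \<Longrightarrow> t \<in> carrier T \<Longrightarrow>
      \<exists>s\<in>carrier S. h (actM x s) = actM' (h x) t"
  shows "rsubmodule T M' actM' (h ` N)"
proof (rule rsubmoduleI)
  note N' = rsubmoduleD [OF N]
  show "h ` N \<subseteq> carrier M'" using h(1) N'(1) by auto
  show "\<zero>\<^bsub>M'\<^esub> \<in> h ` N" using h(2) N'(2) by (metis image_eqI)
  fix x assume "x \<in> h ` N"
  then obtain a where a: "a \<in> N" "x = h a" by (rule imageE)
  then have ac: "a \<in> carrier M" using N'(1) by (simp add: subsetD)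
  show "actM' x t \<in> h ` N" if t: "t \<in> carrier T" for t
  proof -
    obtain s where s: "s \<in> carrier S" "h (actM a s) = actM' (h a) t"
      using act [OF ac t] by (rule bexE)
    then show ?thesis using N'(4) [OF a(1) s(1)] a by (intro image_eqI [of _ _ "actM a s"]) simp_all
  qed
  fix y assume "y \<in> h ` N"
  then obtain b where b: "b \<in> N" "y = h b" by (rule imageE)
  then have bc: "b \<in> carrier M" using N'(1) by (simp add: subsetD)
  show "x \<oplus>\<^bsub>M'\<^esub> y \<in> h ` N"
    using N'(3) [OF a(1) b(1)] h(3) [OF ac bc] a b by (intro image_eqI [of _ _ "a \<oplus>\<^bsub>M\<^esub> b"]) simp_all
qed

context ring
begin

lemma ideal_right_ideal: "ideal I R \<Longrightarrow> right_ideal I R"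
  by (simp add: ideal_iff)

lemma right_ideal_subset: "right_ideal I R \<Longrightarrow> I \<subseteq> carrier R"
  by (auto simp: right_ideal_iff dest: rsubmoduleD(1))

section \<open>Right ideals of a quotient ring\<close>

lemma Quot_correspondence:
  assumes P: "ideal P R"
  defines "h \<equiv> (\<lambda>r. P +> r)" and "Q \<equiv> R Quot P"
  shows "ring Q"
    and "right_ideal I R \<Longrightarrow> right_ideal (h ` I) Q"
    and "ideal I R \<Longrightarrow> ideal (h ` I) Q"
    and "right_ideal J Q \<Longrightarrow> right_ideal {r \<in> carrier R. h r \<in> J} R"
    and "ideal J Q \<Longrightarrow> ideal {r \<in> carrier R. h r \<in> J} R"
    and "\<And>r. r \<in> carrier R \<Longrightarrow> h r = \<zero>\<^bsub>Q\<^esub> \<longleftrightarrow> r \<in> P"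
    and "\<And>I r. right_ideal I R \<Longrightarrow> P \<subseteq> I \<Longrightarrow> r \<in> carrier R \<Longrightarrow> h r \<in> h ` I \<Longrightarrow> r \<in> I"
    and "carrier Q = h ` carrier R"
proof -
  interpret P: ideal P R by fact
  show rQ: "ring Q" unfolding Q_def by (rule P.quotient_is_ring)
  interpret Q: ring Q by fact
  interpret h: ring_hom_ring R Q h
    unfolding Q_def h_def by (rule P.rcos_ring_hom_ring)
  show surj: "carrier Q = h ` carrier R"
    unfolding Q_def h_def FactRing_def A_RCOSETS_def' by auto
  show zero: "h r = \<zero>\<^bsub>Q\<^esub> \<longleftrightarrow> r \<in> P" if "r \<in> carrier R" for r
    using that P.rcos_const_imp_mem a_rcos_zero [OF P] unfolding Q_def h_def FactRing_def by auto
  show mem: "r \<in> I" if I: "right_ideal I R" "P \<subseteq> I" and r: "r \<in> carrier R" "h r \<in> h ` I" for I r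
  proof -
    interpret I: right_ideal I R by fact
    obtain i where i: "i \<in> I" "h r = h i" using r(2) by (rule imageE)
    then have ic: "i \<in> carrier R" by simp
    have "h (r \<ominus> i) = \<zero>\<^bsub>Q\<^esub>" using i ic r(1) by (simp add: a_minus_def Q.r_neg)
    then have "r \<ominus> i \<in> I" using zero [of "r \<ominus> i"] I(2) ic r(1) by (simp add: subsetD)
    then have "(r \<ominus> i) \<oplus> i \<in> I" using i(1) by simp
    then show ?thesis using ic r(1) by (simp add: a_minus_def a_assoc l_neg)
  qed
  show img: "right_ideal (h ` I) Q" if "right_ideal I R" for I
    using that unfolding right_ideal_iff Q.right_ideal_iff
  proof (rule rsubmodule_image)
    fix x t assume "x \<in> carrier R" "t \<in> carrier Q"
    then show "\<exists>s\<in>carrier R. h (x \<otimes> s) = h x \<otimes>\<^bsub>Q\<^esub> t"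
      unfolding surj by force
  qed simp_all
  show "ideal (h ` I) Q" if I: "ideal I R" for I
    unfolding Q.ideal_iff
  proof (intro conjI ballI img ideal_right_ideal I)
    fix x q assume "x \<in> h ` I" "q \<in> carrier Q"
    then obtain i r where i: "i \<in> I" "x = h i" and r: "r \<in> carrier R" "q = h r"
      unfolding surj by (elim imageE)
    then have "q \<otimes>\<^bsub>Q\<^esub> x = h (r \<otimes> i)" using ideal.Icarr [OF I] by simp
    then show "q \<otimes>\<^bsub>Q\<^esub> x \<in> h ` I" using ideal.I_l_closed [OF I i(1) r(1)] by simp
  qed
  show pre: "right_ideal {r \<in> carrier R. h r \<in> J} R" if "right_ideal J Q" for J
    using that unfolding right_ideal_iff Q.right_ideal_iff
    by (rule rsubmodule_vimage [where j = h, OF is_abelian_group]) simp_all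
  show "ideal {r \<in> carrier R. h r \<in> J} R" if J: "ideal J Q" for J
    unfolding ideal_iff
    using ideal.I_l_closed [OF J] by (intro conjI ballI pre Q.ideal_right_ideal [OF J]) simp_all
qed

text \<open>Non-zero right ideals of \<open>R\<close>/\<open>P\<close> correspond to the right
  ideals properly above \<open>P\<close>. Carrying essentiality and boundedness along this
  correspondence removes quotient rings from all later arguments.\<close>

lemma right_bounded_Quot_iff:
  assumes P: "ideal P R"
  shows "right_bounded (R Quot P) \<longleftrightarrow>
    (\<forall>I. essential_over R P I \<longrightarrow> (\<exists>J. ideal J R \<and> P \<subseteq> J \<and> J \<noteq> P \<and> J \<subseteq> I))"
    (is "_ \<longleftrightarrow> ?rel")
proof -
  define h where "h = (\<lambda>r. P +> r)"
  define Q where "Q = R Quot P"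
  note corr = Quot_correspondence [OF P, folded h_def Q_def]
  interpret Q: ring Q by (rule corr(1))
  define pre where "pre J = {r \<in> carrier R. h r \<in> J}" for J
  note pre_right = corr(4) [folded pre_def] and pre_ideal = corr(5) [folded pre_def]
  have P_carr: "P \<subseteq> carrier R" using P by (simp add: ideal_right_ideal right_ideal_subset)
  have zeroQ: "\<zero>\<^bsub>Q\<^esub> \<in> J" if "right_ideal J Q" for J
    using that by (auto simp: Q.right_ideal_iff dest: rsubmoduleD(2))
  have P_pre: "P \<subseteq> pre J" if "right_ideal J Q" for J
  proof
    fix r assume r: "r \<in> P"
    then have "h r = \<zero>\<^bsub>Q\<^esub>" using corr(6) P_carr by blast
    then show "r \<in> pre J" using r zeroQ [OF that] P_carr by (auto simp: pre_def)
  qed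
  have pre_neq: "pre J \<noteq> P" if J: "right_ideal J Q" "J \<noteq> {\<zero>\<^bsub>Q\<^esub>}" for J
  proof -
    obtain q where q: "q \<in> J" "q \<noteq> \<zero>\<^bsub>Q\<^esub>" using J zeroQ by blast
    then obtain r where "r \<in> carrier R" "q = h r"
      using Q.right_ideal_subset [OF J(1)] unfolding corr(8) by blast
    then show ?thesis using q corr(6) [of r] by (auto simp: pre_def)
  qed
  have img_neq: "h ` I \<noteq> {\<zero>\<^bsub>Q\<^esub>}" if I: "right_ideal I R" "P \<subseteq> I" "I \<noteq> P" for I
  proof -
    obtain i where "i \<in> I" "i \<notin> P" using I by blast
    moreover have "i \<in> carrier R" using \<open>i \<in> I\<close> right_ideal_subset [OF I(1)] by (rule subsetD [rotated])
    ultimately have "h i \<in> h ` I" "h i \<noteq> \<zero>\<^bsub>Q\<^esub>" using corr(6) by simp_all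
    then show ?thesis by (metis singletonD)
  qed
  have "right_bounded Q \<longleftrightarrow> ?rel"
  proof
    assume bdd: "right_bounded Q"
    show ?rel
    proof (intro allI impI)
      fix I assume I: "essential_over R P I"
      then have Ir: "right_ideal I R" "P \<subseteq> I" by (auto simp: essential_over_def)
      have "essential_right_ideal (h ` I) Q"
        unfolding essential_right_ideal_def
      proof (intro conjI allI impI)
        show "right_ideal (h ` I) Q" by (rule corr(2) [OF Ir(1)])
        fix J assume "right_ideal J Q \<and> J \<noteq> {\<zero>\<^bsub>Q\<^esub>}"
        then have J: "right_ideal J Q" "J \<noteq> {\<zero>\<^bsub>Q\<^esub>}" by simp_all
        have "\<not> I \<inter> pre J \<subseteq> P"
          using I [unfolded essential_over_def, THEN conjunct2, THEN conjunct2, rule_format, of "pre J"]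
            pre_right [OF J(1)] P_pre [OF J(1)] pre_neq [OF J] by simp
        then obtain k where k: "k \<in> I" "k \<in> pre J" "k \<notin> P" by blast
        then have "h k \<in> h ` I \<inter> J" "h k \<noteq> \<zero>\<^bsub>Q\<^esub>" using corr(6) by (simp_all add: pre_def)
        then show "h ` I \<inter> J \<noteq> {\<zero>\<^bsub>Q\<^esub>}" by (metis singletonD)
      qed
      from bdd [unfolded right_bounded_def, rule_format, OF this]
      obtain J where J: "ideal J Q" "J \<noteq> {\<zero>\<^bsub>Q\<^esub>}" "J \<subseteq> h ` I"
        by (elim exE conjE)
      have Jr: "right_ideal J Q" by (rule Q.ideal_right_ideal [OF J(1)])
      have "pre J \<subseteq> I"
      proof
        fix r assume "r \<in> pre J"
        then show "r \<in> I" using J(3) by (intro corr(7) [OF Ir]) (auto simp: pre_def)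
      qed
      then show "\<exists>J. ideal J R \<and> P \<subseteq> J \<and> J \<noteq> P \<and> J \<subseteq> I"
        using pre_ideal [OF J(1)] P_pre [OF Jr] pre_neq [OF Jr J(2)] by blast
    qed
  next
    assume rel: ?rel
    show "right_bounded Q"
      unfolding right_bounded_def
    proof (intro allI impI)
      fix I assume "essential_right_ideal I Q"
      then have I: "right_ideal I Q"
        and ess: "\<And>J. right_ideal J Q \<Longrightarrow> J \<noteq> {\<zero>\<^bsub>Q\<^esub>} \<Longrightarrow> I \<inter> J \<noteq> {\<zero>\<^bsub>Q\<^esub>}"
        by (simp_all add: essential_right_ideal_def)
      have "essential_over R P (pre I)"
        unfolding essential_over_def
      proof (intro conjI allI impI pre_right I P_pre, elim conjE)
        fix K assume K: "right_ideal K R" "P \<subseteq> K" "K \<noteq> P"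
        have "I \<inter> h ` K \<noteq> {\<zero>\<^bsub>Q\<^esub>}"
          by (rule ess [OF corr(2) [OF K(1)] img_neq [OF K]])
        moreover have "\<zero>\<^bsub>Q\<^esub> \<in> I \<inter> h ` K"
          using zeroQ [OF I] zeroQ [OF corr(2) [OF K(1)]] by simp
        ultimately have "\<exists>q\<in>I \<inter> h ` K. q \<noteq> \<zero>\<^bsub>Q\<^esub>"
          by auto
        then obtain k where k: "k \<in> K" "h k \<in> I" "h k \<noteq> \<zero>\<^bsub>Q\<^esub>"
          by auto
        then have "k \<in> carrier R" using right_ideal_subset [OF K(1)] by blast
        then have "k \<in> pre I \<inter> K" "k \<notin> P" using k corr(6) [of k] by (simp_all add: pre_def)
        then show "\<not> pre I \<inter> K \<subseteq> P" by blast
      qed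
      from rel [rule_format, OF this]
      obtain J where J: "ideal J R" "P \<subseteq> J" "J \<noteq> P" "J \<subseteq> pre I"
        by (elim exE conjE)
      then have "h ` J \<subseteq> I" unfolding pre_def by blast
      then show "\<exists>J. ideal J Q \<and> J \<noteq> {\<zero>\<^bsub>Q\<^esub>} \<and> J \<subseteq> I"
        using corr(3) [OF J(1)] img_neq [OF ideal_right_ideal [OF J(1)] J(2,3)] by blast
    qed
  qed
  then show ?thesis by (simp add: Q_def)
qed

lemma right_fully_bounded_iff:
  "right_fully_bounded R \<longleftrightarrow> (\<forall>P I. prime_two_sided_ideal P R \<and> essential_over R P I \<longrightarrow>
     (\<exists>J. ideal J R \<and> P \<subseteq> J \<and> J \<noteq> P \<and> J \<subseteq> I))"
  unfolding right_fully_bounded_def prime_two_sided_ideal_def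
  by (auto simp: right_bounded_Quot_iff)

end

section \<open>Goldie's theorem relative to a prime ideal\<close>

context ring
begin

lemma prime_idealD:
  assumes "prime_two_sided_ideal P R"
  shows "ideal P R" "\<one> \<notin> P" "right_ideal P R" "P \<subseteq> carrier R"
    "x \<in> P \<Longrightarrow> y \<in> P \<Longrightarrow> x \<oplus> y \<in> P"
    "x \<in> P \<Longrightarrow> r \<in> carrier R \<Longrightarrow> x \<otimes> r \<in> P"
    "x \<in> P \<Longrightarrow> r \<in> carrier R \<Longrightarrow> r \<otimes> x \<in> P"
    "\<zero> \<in> P"
    "x \<in> P \<Longrightarrow> y \<in> carrier R \<Longrightarrow> x \<oplus> y \<in> P \<Longrightarrow> y \<in> P"
    "y \<in> P \<Longrightarrow> x \<in> carrier R \<Longrightarrow> x \<oplus> y \<in> P \<Longrightarrow> x \<in> P"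
proof -
  show P: "ideal P R" using assms by (simp add: prime_two_sided_ideal_def)
  interpret P: ideal P R by fact
  show "\<one> \<notin> P" using assms P.one_imp_carrier by (auto simp: prime_two_sided_ideal_def)
  show r: "right_ideal P R" by (rule ideal_right_ideal [OF P])
  show "P \<subseteq> carrier R" by (rule P.a_subset)
  show "x \<in> P \<Longrightarrow> y \<in> P \<Longrightarrow> x \<oplus> y \<in> P" by simp
  show "x \<in> P \<Longrightarrow> r \<in> carrier R \<Longrightarrow> x \<otimes> r \<in> P" by (rule P.I_r_closed)
  show "x \<in> P \<Longrightarrow> r \<in> carrier R \<Longrightarrow> r \<otimes> x \<in> P" by (rule P.I_l_closed)
  show "\<zero> \<in> P" by simp
  interpret right_module R R "(\<otimes>)" by (rule regular_right_module)
  note sub = r [unfolded right_ideal_iff]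
  show "x \<in> P \<Longrightarrow> y \<in> carrier R \<Longrightarrow> x \<oplus> y \<in> P \<Longrightarrow> y \<in> P"
    by (rule sub_add_cancel_left [OF sub])
  show "y \<in> P \<Longrightarrow> x \<in> carrier R \<Longrightarrow> x \<oplus> y \<in> P \<Longrightarrow> x \<in> P"
    by (rule sub_add_cancel_right [OF sub])
qed

lemma prime_ideal_prod:
  assumes P: "prime_two_sided_ideal P R" and I: "ideal I R" and J: "ideal J R"
    and IJ: "\<And>x y. x \<in> I \<Longrightarrow> y \<in> J \<Longrightarrow> x \<otimes> y \<in> P"
  shows "I \<subseteq> P \<or> J \<subseteq> P"
proof -
  have "x \<in> P" if "x \<in> I \<cdot> J" for x
    using that by (induction rule: ideal_prod.induct) (simp_all add: IJ prime_idealD(5) [OF P])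
  then have "I \<cdot> J \<subseteq> P" by blast
  then show ?thesis using P I J by (simp add: prime_two_sided_ideal_def)
qed

lemma idealI':
  assumes "I \<subseteq> carrier R" "\<zero> \<in> I" "\<And>x y. x \<in> I \<Longrightarrow> y \<in> I \<Longrightarrow> x \<oplus> y \<in> I"
    "\<And>x r. x \<in> I \<Longrightarrow> r \<in> carrier R \<Longrightarrow> x \<otimes> r \<in> I"
    "\<And>x r. x \<in> I \<Longrightarrow> r \<in> carrier R \<Longrightarrow> r \<otimes> x \<in> I"
  shows "ideal I R"
  unfolding ideal_iff right_ideal_iff using assms by (intro conjI rsubmoduleI ballI) simp_all

text \<open>Annihilators take the place of generated ideals: \<open>I\<close> is the left
  annihilator of \<open>R b\<close> modulo \<open>P\<close>, and \<open>J\<close> the right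
  annihilator of \<open>I\<close> modulo \<open>P\<close>. Both are two-sided, their product lies in
  \<open>P\<close>, and they contain \<open>a\<close> and \<open>b\<close>.\<close>

lemma prime_ideal_elementwise:
  assumes P: "prime_two_sided_ideal P R" and ab: "a \<in> carrier R" "b \<in> carrier R"
    and aRb: "\<And>r. r \<in> carrier R \<Longrightarrow> a \<otimes> r \<otimes> b \<in> P"
  shows "a \<in> P \<or> b \<in> P"
proof -
  note PD = prime_idealD [OF P]
  define I where "I = {s \<in> carrier R. \<forall>r\<in>carrier R. s \<otimes> r \<otimes> b \<in> P}"
  define J where "J = {t \<in> carrier R. \<forall>s\<in>I. s \<otimes> t \<in> P}"
  have Ic: "s \<in> carrier R" if "s \<in> I" for s using that by (simp add: I_def)
  have Ib: "s \<otimes> r \<otimes> b \<in> P" if "s \<in> I" "r \<in> carrier R" for s r using that by (simp add: I_def)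
  have Jc: "t \<in> carrier R" if "t \<in> J" for t using that by (simp add: J_def)
  have IJ: "s \<otimes> t \<in> P" if "s \<in> I" "t \<in> J" for s t using that by (simp add: J_def)
  have I: "ideal I R"
  proof (rule idealI')
    show "I \<subseteq> carrier R" using Ic by blast
    show "\<zero> \<in> I" using PD(8) ab by (simp add: I_def)
    fix x assume x: "x \<in> I"
    show "x \<oplus> y \<in> I" if y: "y \<in> I" for y
    proof -
      have "(x \<oplus> y) \<otimes> s \<otimes> b \<in> P" if s: "s \<in> carrier R" for s
        using PD(5) [OF Ib [OF x s] Ib [OF y s]] Ic [OF x] Ic [OF y] s ab by (simp add: l_distr)
      then show ?thesis using Ic [OF x] Ic [OF y] by (simp add: I_def)
    qed
    fix r assume r: "r \<in> carrier R"
    have "x \<otimes> r \<otimes> s \<otimes> b \<in> P" if s: "s \<in> carrier R" for s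
      using Ib [OF x, of "r \<otimes> s"] Ic [OF x] r s by (simp add: m_assoc)
    then show "x \<otimes> r \<in> I" using Ic [OF x] r by (simp add: I_def)
    have "r \<otimes> x \<otimes> s \<otimes> b \<in> P" if s: "s \<in> carrier R" for s
      using PD(7) [OF Ib [OF x s] r] Ic [OF x] ab r s by (simp add: m_assoc)
    then show "r \<otimes> x \<in> I" using Ic [OF x] r by (simp add: I_def)
  qed
  have J: "ideal J R"
  proof (rule idealI')
    show "J \<subseteq> carrier R" using Jc by blast
    show "\<zero> \<in> J" using PD(8) Ic by (simp add: J_def)
    fix x assume x: "x \<in> J"
    show "x \<oplus> y \<in> J" if y: "y \<in> J" for y
    proof -
      have "s \<otimes> (x \<oplus> y) \<in> P" if s: "s \<in> I" for s
        using PD(5) [OF IJ [OF s x] IJ [OF s y]] Ic [OF s] Jc [OF x] Jc [OF y] by (simp add: r_distr)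
      then show ?thesis using Jc [OF x] Jc [OF y] by (simp add: J_def)
    qed
    fix r assume r: "r \<in> carrier R"
    have "s \<otimes> (x \<otimes> r) \<in> P" if s: "s \<in> I" for s
      using PD(6) [OF IJ [OF s x] r] Ic [OF s] Jc [OF x] r by (simp add: m_assoc)
    then show "x \<otimes> r \<in> J" using Jc [OF x] r by (simp add: J_def)
    have "s \<otimes> (r \<otimes> x) \<in> P" if s: "s \<in> I" for s
      using IJ [OF ideal.I_r_closed [OF I s r] x] Ic [OF s] Jc [OF x] r by (simp add: m_assoc)
    then show "r \<otimes> x \<in> J" using Jc [OF x] r by (simp add: J_def)
  qed
  have "a \<in> I" using ab aRb by (simp add: I_def)
  moreover have "b \<in> J"
  proof -
    have "s \<otimes> b \<in> P" if "s \<in> I" for s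
      using Ib [OF that, of \<one>] Ic [OF that] by simp
    then show ?thesis using ab by (simp add: J_def)
  qed
  moreover have "I \<subseteq> P \<or> J \<subseteq> P"
    by (rule prime_ideal_prod [OF P I J IJ])
  ultimately show ?thesis by blast
qed

text \<open>Modulo an ideal, \<open>p \<otimes> q\<close> is nilpotent as soon as
  \<open>q \<otimes> p\<close> is, at the price of one more factor. This shifts nilpotence from the
  right ideal of \<open>u\<close> to left multiples of \<open>u\<close>.\<close>

lemma pow_mult_rotate:
  assumes "p \<in> carrier R" "q \<in> carrier R"
  shows "(p \<otimes> q) [^] Suc n = p \<otimes> (q \<otimes> p) [^] (n::nat) \<otimes> q"
proof (induction n)
  case (Suc n)
  have "(p \<otimes> q) [^] Suc (Suc n) = p \<otimes> (q \<otimes> p) [^] n \<otimes> q \<otimes> (p \<otimes> q)"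
    using Suc by simp
  also have "\<dots> = p \<otimes> ((q \<otimes> p) [^] n \<otimes> (q \<otimes> p)) \<otimes> q"
    using assms by (simp add: m_assoc)
  finally show ?case by simp
qed (use assms in simp)

lemma colon_right_ideal:
  assumes "right_ideal I R" "u \<in> carrier R"
  shows "right_ideal {r \<in> carrier R. u \<otimes> r \<in> I} R"
  using right_module.colon_right_ideal [OF regular_right_module] assms by (simp add: right_ideal_iff)

text \<open>Levitzki's theorem, by Utumi's argument: among the non-zero elements generating a nil right
  ideal, take one whose right annihilator is maximal.\<close>

lemma prime_no_nil_right_ideal:
  assumes noeth: "right_noetherian R" and P: "prime_two_sided_ideal P R"
    and U: "right_ideal U R" "\<not> U \<subseteq> P"
  shows "\<exists>u\<in>U. \<forall>n::nat. u [^] n \<notin> P"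
proof (rule ccontr)
  note PD = prime_idealD [OF P]
  assume "\<not> ?thesis"
  then have nilU: "\<exists>n::nat. u [^] n \<in> P" if "u \<in> U" for u using that by blast
  \<comment> \<open>Generators, outside \<open>P\<close>, of right ideals that are nil modulo
    \<open>P\<close>. The aim is a member \<open>u\<close> with \<open>u R u\<close> inside
    \<open>P\<close>, which primeness forbids.\<close>
  define T where "T = {u \<in> carrier R. u \<notin> P \<and> (\<forall>s\<in>carrier R. \<exists>n::nat. (u \<otimes> s) [^] n \<in> P)}"
  define ann where "ann u = {r \<in> carrier R. u \<otimes> r \<in> P}" for u
  obtain u0 where u0: "u0 \<in> U" "u0 \<notin> P" using U by blast
  have "u0 \<in> T"
    using u0 nilU right_ideal.I_r_closed [OF U(1)] right_ideal_subset [OF U(1)] by (auto simp: T_def)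
  then have "ann u0 \<in> ann ` T" by simp
  moreover have "right_ideal X R" if "X \<in> ann ` T" for X
    using that colon_right_ideal [OF PD(3)] unfolding ann_def T_def by blast
  ultimately have "\<exists>X\<in>ann ` T. \<forall>Y\<in>ann ` T. X \<subseteq> Y \<longrightarrow> Y = X"
    by (rule has_acc_maximal [OF noeth [unfolded right_noetherian_iff_has_acc]])
  then obtain u where uT: "u \<in> T" and max: "\<And>v. v \<in> T \<Longrightarrow> ann u \<subseteq> ann v \<Longrightarrow> ann v = ann u"
    by blast
  have u: "u \<in> carrier R" "u \<notin> P" using uT by (simp_all add: T_def)
  have "u \<otimes> s \<otimes> u \<in> P" if s: "s \<in> carrier R" for s
  proof -
    define w where "w = s \<otimes> u"
    have w: "w \<in> carrier R" using s u by (simp add: w_def)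
    obtain n :: nat where "(u \<otimes> s) [^] n \<in> P" using uT s by (auto simp: T_def)
    then have "w [^] Suc n \<in> P"
      unfolding w_def pow_mult_rotate [OF s u(1)] using PD(6,7) s u by simp
    then have ex: "\<exists>k::nat. w [^] k \<in> P" by blast
    \<comment> \<open>\<open>w [^] i\<close> with \<open>k = Suc i\<close> is the last power outside
      \<open>P\<close>. For positive \<open>i\<close> it has the form \<open>p \<otimes> u\<close>
      and belongs to \<open>T\<close>, so maximality gives it the same annihilator as
      \<open>u\<close>; as it kills \<open>w\<close> modulo \<open>P\<close>, so does
      \<open>u\<close>.\<close>
    define k where "k = (LEAST k::nat. w [^] k \<in> P)"
    have k: "w [^] k \<in> P" unfolding k_def using ex by (rule LeastI_ex)
    have below: "w [^] i \<notin> P" if "i < k" for i using that unfolding k_def by (rule not_less_Least)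
    have "k \<noteq> 0" using k PD(2) by (metis nat_pow_0)
    then obtain i where i: "k = Suc i" by (cases k) auto
    show ?thesis
    proof (cases i)
      case 0
      then have "w \<in> P" using k i w by simp
      then show ?thesis using PD(7) u s by (simp add: w_def m_assoc)
    next
      case (Suc j)
      define p where "p = w [^] j \<otimes> s"
      have p: "p \<in> carrier R" using w s by (simp add: p_def)
      have wp: "w [^] i = p \<otimes> u" using w s u Suc by (simp add: p_def w_def m_assoc)
      have "p \<otimes> u \<in> T"
      proof -
        have "\<exists>n::nat. (p \<otimes> u \<otimes> t) [^] n \<in> P" if t: "t \<in> carrier R" for t
        proof -
          obtain n :: nat where n: "(u \<otimes> (t \<otimes> p)) [^] n \<in> P" using uT t p by (auto simp: T_def)
          have "(p \<otimes> (u \<otimes> t)) [^] Suc n \<in> P"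
            using n PD(6,7) p u t by (subst pow_mult_rotate) (simp_all add: m_assoc)
          then show ?thesis using p u t by (metis m_assoc)
        qed
        moreover have "p \<otimes> u \<notin> P" using below [of i] i wp by simp
        ultimately show ?thesis using p u by (simp add: T_def)
      qed
      moreover have "ann u \<subseteq> ann (p \<otimes> u)"
        using PD(7) p u by (auto simp: ann_def m_assoc)
      ultimately have eq: "ann (p \<otimes> u) = ann u" by (rule max)
      have "p \<otimes> u \<otimes> w \<in> P" using k i wp by simp
      then have "w \<in> ann u" using w eq by (auto simp: ann_def)
      then show ?thesis using s u by (simp add: ann_def w_def m_assoc)
    qed
  qed
  from prime_ideal_elementwise [OF P u(1) u(1) this] u(2) show False by blast
qed

text \<open>A Fitting argument: modulo \<open>P\<close>, the right annihilators of the powers of a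
  non-nilpotent \<open>u\<close> become stationary, and a high power \<open>a\<close> then satisfies
  \<open>aR \<inter> ann a \<subseteq> P\<close>. Such an \<open>a\<close> can be added to an
  earlier choice without creating new annihilation.\<close>

lemma prime_right_ideal_stable_element:
  assumes noeth: "right_noetherian R" and P: "prime_two_sided_ideal P R"
    and U: "right_ideal U R" "\<not> U \<subseteq> P"
  shows "\<exists>a\<in>U. a \<notin> P \<and> (\<forall>r\<in>carrier R. a \<otimes> (a \<otimes> r) \<in> P \<longrightarrow> a \<otimes> r \<in> P)"
proof -
  note PD = prime_idealD [OF P]
  obtain u where u: "u \<in> U" "\<And>n::nat. u [^] n \<notin> P"
    using prime_no_nil_right_ideal [OF noeth P U] by blast
  have uc: "u \<in> carrier R" using u right_ideal_subset [OF U(1)] by blast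
  define ann where "ann n = {r \<in> carrier R. u [^] n \<otimes> r \<in> P}" for n :: nat
  have "\<exists>n. \<forall>m\<ge>n. ann m = ann n"
  proof (rule has_accD)
    show "has_acc (\<lambda>I. right_ideal I R)" using noeth by (simp add: right_noetherian_iff_has_acc)
    show "right_ideal (ann n) R" for n unfolding ann_def using uc by (intro colon_right_ideal PD) simp
    show "ann n \<subseteq> ann (Suc n)" for n
    proof
      fix r assume "r \<in> ann n"
      moreover have "u [^] Suc n \<otimes> r = u \<otimes> (u [^] n \<otimes> r)" if "r \<in> carrier R"
        using uc that nat_pow_Suc2 [OF uc, of n] by (simp only: m_assoc nat_pow_closed)
      ultimately show "r \<in> ann (Suc n)" unfolding ann_def using uc PD(7) by auto
    qed
  qed
  then obtain n where n: "\<forall>m\<ge>n. ann m = ann n" by (rule exE)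
  \<comment> \<open>The exponent is \<open>Suc n\<close> rather than \<open>n\<close>, since only a
    positive power of \<open>u\<close> is sure to stay in \<open>U\<close>.\<close>
  define a where "a = u [^] Suc n"
  have a: "a \<in> carrier R" using uc by (simp add: a_def)
  have eq: "ann (Suc n + Suc n) = ann (Suc n)"
    using n [rule_format, of "Suc n + Suc n"] n [rule_format, of "Suc n"] by simp
  have "a \<otimes> r \<in> P" if r: "r \<in> carrier R" "a \<otimes> (a \<otimes> r) \<in> P" for r
  proof -
    have "u [^] (Suc n + Suc n) = a \<otimes> a"
      unfolding a_def using uc by (rule nat_pow_mult [symmetric])
    then have "r \<in> ann (Suc n + Suc n)"
      using r a by (simp add: ann_def m_assoc)
    then show ?thesis unfolding eq by (simp add: ann_def a_def)
  qed
  moreover have "a \<in> U"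
    unfolding a_def nat_pow_Suc2 [OF uc] using u(1) uc right_ideal.I_r_closed [OF U(1)] by simp
  moreover have "a \<notin> P" unfolding a_def by (rule u(2))
  ultimately show ?thesis by blast
qed

text \<open>The element is grown: \<open>W\<close> is a largest right ideal on which left
  multiplication by some \<open>c\<close> in \<open>W \<inter> K\<close> is injective modulo
  \<open>P\<close>. If \<open>c\<close> still kills something outside \<open>P\<close>, essentiality
  puts a stable \<open>a\<close> into \<open>K \<inter> ann c\<close>, and
  \<open>c \<oplus> a\<close> works on \<open>W + aR\<close>.\<close>

lemma essential_over_regular_element:
  assumes noeth: "right_noetherian R" and P: "prime_two_sided_ideal P R"
    and K: "essential_over R P K"
  shows "\<exists>c\<in>K. \<forall>r\<in>carrier R. c \<otimes> r \<in> P \<longrightarrow> r \<in> P"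
proof -
  note PD = prime_idealD [OF P]
  have Kr: "right_ideal K R" "P \<subseteq> K" and ess: "\<And>L. right_ideal L R \<Longrightarrow> P \<subseteq> L \<Longrightarrow> L \<noteq> P \<Longrightarrow> \<not> K \<inter> L \<subseteq> P"
    using K by (auto simp: essential_over_def)
  note KD = rsubmoduleD [OF Kr(1) [unfolded right_ideal_iff]]
  interpret reg: right_module R R "(\<otimes>)" by (rule regular_right_module)
  define ann where "ann c = {r \<in> carrier R. c \<otimes> r \<in> P}" for c
  have ann_right: "right_ideal (ann c) R" if "c \<in> carrier R" for c
    unfolding ann_def using that by (intro colon_right_ideal PD)
  define F where "F = {W. right_ideal W R \<and> P \<subseteq> W \<and> (\<exists>c\<in>W \<inter> K. ann c \<inter> W \<subseteq> P)}"
  have "P \<in> F"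
    using PD(3,8) Kr(2) unfolding F_def by blast
  then have "\<exists>W\<in>F. \<forall>Y\<in>F. W \<subseteq> Y \<longrightarrow> Y = W"
    by (rule has_acc_maximal [OF noeth [unfolded right_noetherian_iff_has_acc]]) (simp add: F_def)
  then obtain W where WF: "W \<in> F" and max: "\<And>Y. Y \<in> F \<Longrightarrow> W \<subseteq> Y \<Longrightarrow> Y = W" by blast
  then obtain c where W: "right_ideal W R" "P \<subseteq> W" and c: "c \<in> W" "c \<in> K" "ann c \<inter> W \<subseteq> P"
    unfolding F_def by blast
  note WD = rsubmoduleD [OF W(1) [unfolded right_ideal_iff]]
  have cc: "c \<in> carrier R" using c WD(1) by blast
  have "ann c \<subseteq> P"
  proof (rule ccontr)
    assume nle: "\<not> ann c \<subseteq> P"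
    have "P \<subseteq> ann c" using PD(4,7) cc unfolding ann_def by blast
    then have "\<not> K \<inter> ann c \<subseteq> P"
      using nle ann_right [OF cc] by (intro ess) auto
    moreover have "right_ideal (K \<inter> ann c) R"
      using Kr(1) ann_right [OF cc] unfolding right_ideal_iff by (rule rsubmodule_inter)
    ultimately obtain a where aK: "a \<in> K" "a \<in> ann c" and aP: "a \<notin> P"
      and stable: "\<And>r. r \<in> carrier R \<Longrightarrow> a \<otimes> (a \<otimes> r) \<in> P \<Longrightarrow> a \<otimes> r \<in> P"
      using prime_right_ideal_stable_element [OF noeth P] by blast
    have a: "a \<in> carrier R" "c \<otimes> a \<in> P" using aK by (simp_all add: ann_def)
    define aR where "aR = (\<otimes>) a ` carrier R"
    define W' where "W' = W <+>\<^bsub>R\<^esub> aR"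
    have aR: "reg.sub aR"
      unfolding aR_def using reg.sub_act_image [OF reg.sub_carrier] a by simp
    have "a \<in> aR" unfolding aR_def using a by (intro image_eqI [of _ _ \<one>]) simp_all
    note W'sum = reg.sub_sum [OF W(1) [unfolded right_ideal_iff] aR, folded W'_def]
    have "W' \<in> F"
      unfolding F_def
    proof (intro CollectI conjI bexI)
      show "right_ideal W' R" using W'sum(1) by (simp add: right_ideal_iff)
      show "P \<subseteq> W'" using W(2) W'sum(2) by blast
      show "c \<oplus> a \<in> W' \<inter> K"
        using set_addI [OF c(1) \<open>a \<in> aR\<close>, of R] KD(3) [OF c(2) aK(1)] by (simp add: W'_def)
      show "ann (c \<oplus> a) \<inter> W' \<subseteq> P"
      proof
        fix v assume v: "v \<in> ann (c \<oplus> a) \<inter> W'"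
        then obtain w r where w: "w \<in> W" and r: "r \<in> carrier R" and vwr: "v = w \<oplus> a \<otimes> r"
          unfolding W'_def aR_def by (blast elim: set_addE)
        have wc: "w \<in> carrier R" using w WD(1) by blast
        define y where "y = w \<oplus> a \<otimes> r"
        have y: "y \<in> carrier R" using wc a r by (simp add: y_def)
        have "(c \<oplus> a) \<otimes> y \<in> P" using v vwr by (simp add: ann_def y_def)
        \<comment> \<open>As \<open>c \<otimes> a\<close> is in \<open>P\<close>, only
          \<open>c \<otimes> w \<oplus> a \<otimes> y\<close> remains. A further factor
          \<open>c\<close> removes the second term, and injectivity of \<open>c\<close> on
          \<open>W\<close> is used twice, for \<open>c \<otimes> w\<close> and then for
          \<open>w\<close>. Stability of \<open>a\<close> treats the rest.\<close>
        moreover have "(c \<oplus> a) \<otimes> y = c \<otimes> a \<otimes> r \<oplus> (c \<otimes> w \<oplus> a \<otimes> y)"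
          using wc a r cc y unfolding l_distr [OF cc a(1) y]
          by (simp add: y_def r_distr m_assoc a_ac)
        ultimately have 1: "c \<otimes> w \<oplus> a \<otimes> y \<in> P"
          using PD(9) [OF PD(6) [OF a(2) r]] wc a cc y by simp
        have "c \<otimes> (c \<otimes> w) \<oplus> c \<otimes> a \<otimes> y \<in> P"
          using PD(7) [OF 1 cc] wc a cc y by (simp add: r_distr m_assoc)
        then have "c \<otimes> (c \<otimes> w) \<in> P"
          using PD(10) [OF PD(6) [OF a(2) y]] wc cc by simp
        then have "c \<otimes> w \<in> P" using c(3) WD(4) [OF c(1) wc] wc cc by (auto simp: ann_def)
        then have wP: "w \<in> P" using c(3) w wc by (auto simp: ann_def)
        have "a \<otimes> y \<in> P" using PD(9) [OF \<open>c \<otimes> w \<in> P\<close> _ 1] a y by simp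
        then have "a \<otimes> w \<oplus> a \<otimes> (a \<otimes> r) \<in> P" using wc a r by (simp add: y_def r_distr)
        then have "a \<otimes> (a \<otimes> r) \<in> P" using PD(9) [OF PD(7) [OF wP a(1)]] a r by simp
        then have "a \<otimes> r \<in> P" by (rule stable [OF r])
        then show "v \<in> P" using PD(5) [OF wP] vwr by simp
      qed
    qed
    then have "W' = W" using W'sum(2) by (rule max)
    then have "a \<in> W" using W'sum(3) \<open>a \<in> aR\<close> by blast
    then show False using c(3) aK(2) aP by blast
  qed
  then show ?thesis using c(2) unfolding ann_def by blast
qed

end

section \<open>Finite annihilation over right FBN rings\<close>

context right_module
begin

text \<open>Suppose the conclusion fails, and let \<open>Q\<close> be the annihilator of \<open>M / N\<close>.  By maximality of \<open>W\<close>, some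
  finite \<open>F\<close> is such that every \<open>m\<close> kills an essential part of \<open>ann F / Q\<close>.  A right ideal \<open>V\<close> inside
  \<open>ann F\<close> with \<open>P = {a. V a \<subseteq> Q}\<close> as large as possible makes \<open>P\<close> prime, and \<open>M V + N / N\<close> is torsion
  over \<open>S / P\<close>.  Boundedness yields an ideal \<open>J\<close> outside \<open>P\<close> with \<open>M V J \<subseteq> N\<close>, that is \<open>V J \<subseteq> Q\<close>.\<close>

lemma finite_annihilator:
  assumes fbn: "right_FBN S" and acc: "has_acc sub" and N: "sub N"
  shows "\<exists>F. finite F \<and> F \<subseteq> carrier M \<and>
    (\<forall>s\<in>carrier S. (\<forall>m\<in>F. m \<star> s \<in> N) \<longrightarrow> (\<forall>m\<in>carrier M. m \<star> s \<in> N))"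
proof (rule ccontr)
  assume "\<not> ?thesis"
  then have contr: "\<not> (\<forall>s\<in>carrier S. (\<forall>m\<in>F. m \<star> s \<in> N) \<longrightarrow> (\<forall>m\<in>carrier M. m \<star> s \<in> N))"
    if "finite F" "F \<subseteq> carrier M" for F
    using that by simp
  have noeth: "has_acc (\<lambda>I. right_ideal I S)"
    and bdd: "\<And>P I. prime_two_sided_ideal P S \<Longrightarrow> essential_over S P I \<Longrightarrow>
      \<exists>J. ideal J S \<and> P \<subseteq> J \<and> J \<noteq> P \<and> J \<subseteq> I"
    using fbn by (simp_all add: right_FBN_def right_noetherian_iff_has_acc S.right_fully_bounded_iff)
  interpret reg: right_module S S "(\<otimes>\<^bsub>S\<^esub>)" by (rule S.regular_right_module)
  note ND = rsubmoduleD [OF N]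
  define Q where "Q = {s \<in> carrier S. \<forall>m\<in>carrier M. m \<star> s \<in> N}"
  define ann where "ann F = {s \<in> carrier S. \<forall>m\<in>F. m \<star> s \<in> N}" for F
  have annD: "m \<star> s \<in> N" if "s \<in> ann F" "m \<in> F" for m s F using that by (simp add: ann_def)
  have ann_right: "right_ideal (ann F) S" if F: "F \<subseteq> carrier M" for F
    unfolding S.right_ideal_iff ann_def
    by (rule rsubmoduleI) (use ND F in \<open>auto simp: act_add_right act_mult subset_iff\<close>)
  have Q_ann: "Q \<subseteq> ann F" if "F \<subseteq> carrier M" for F using that by (auto simp: Q_def ann_def)
  have QD: "m \<star> s \<in> N" if "s \<in> Q" "m \<in> carrier M" for m s using that by (simp add: Q_def)
  have Q: "ideal Q S"
  proof -
    have "Q = ann (carrier M)" by (simp add: Q_def ann_def)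
    then have "right_ideal Q S" using ann_right by simp
    moreover have "r \<otimes>\<^bsub>S\<^esub> s \<in> Q" if "s \<in> Q" "r \<in> carrier S" for r s
      using that by (simp add: Q_def act_mult)
    ultimately show ?thesis by (simp add: S.ideal_iff)
  qed
  note Qr = S.ideal_right_ideal [OF Q]
  have Qc: "Q \<subseteq> carrier S" by (auto simp: Q_def)

  \<comment> \<open>The right ideals on which finitely many elements of \<open>M\<close> already
    detect \<open>Q\<close>. A maximal one cannot grow when a further \<open>m\<close> joins
    \<open>F\<close>, which is what \<open>key\<close> exploits.\<close>
  define \<W> where "\<W> = {W. right_ideal W S \<and> Q \<subseteq> W \<and> (\<exists>F. finite F \<and> F \<subseteq> carrier M \<and> W \<inter> ann F \<subseteq> Q)}"
  have "Q \<in> \<W>" using Qr unfolding \<W>_def by blast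
  then have "\<exists>W\<in>\<W>. \<forall>Y\<in>\<W>. W \<subseteq> Y \<longrightarrow> Y = W"
    by (rule has_acc_maximal [OF noeth]) (simp add: \<W>_def)
  then obtain W where W\<W>: "W \<in> \<W>" and W_max: "\<And>Y. Y \<in> \<W> \<Longrightarrow> W \<subseteq> Y \<Longrightarrow> Y = W" by blast
  then obtain F where W: "right_ideal W S" "Q \<subseteq> W" and F: "finite F" "F \<subseteq> carrier M" "W \<inter> ann F \<subseteq> Q"
    unfolding \<W>_def by blast
  have Wc: "W \<subseteq> carrier S" using W(1) by (rule S.right_ideal_subset)
  have "\<not> ann F \<subseteq> Q"
  proof
    assume "ann F \<subseteq> Q"
    have "\<forall>m\<in>carrier M. m \<star> s \<in> N" if "s \<in> carrier S" "\<forall>m\<in>F. m \<star> s \<in> N" for s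
    proof -
      have "s \<in> ann F" using that by (simp add: ann_def)
      then show ?thesis using \<open>ann F \<subseteq> Q\<close> QD by blast
    qed
    then show False using contr [OF F(1,2)] by simp
  qed
  then have annF_neq: "ann F \<noteq> Q" by blast

  \<comment> \<open>Otherwise \<open>insert m F\<close> detects \<open>Q\<close> on
    \<open>W + V\<close>: in a sum that it annihilates, the part in \<open>W\<close> falls into
    \<open>Q\<close> because \<open>V \<subseteq> ann F\<close>, and then the part in
    \<open>V\<close> does because of \<open>m\<close>. Maximality gives
    \<open>V \<subseteq> W\<close>, hence
    \<open>V \<subseteq> W \<inter> ann F \<subseteq> Q\<close>.\<close>
  have key: "\<not> V \<inter> ann {m} \<subseteq> Q"
    if V: "right_ideal V S" "Q \<subseteq> V" "V \<noteq> Q" "V \<subseteq> ann F" and m: "m \<in> carrier M" for V m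
  proof
    assume VQ: "V \<inter> ann {m} \<subseteq> Q"
    note sums = reg.sub_sum [OF W(1) [unfolded S.right_ideal_iff] V(1) [unfolded S.right_ideal_iff]]
    have "W <+>\<^bsub>S\<^esub> V \<in> \<W>"
      unfolding \<W>_def
    proof (intro CollectI conjI exI)
      show "right_ideal (W <+>\<^bsub>S\<^esub> V) S" using sums(1) by (simp add: S.right_ideal_iff)
      show "Q \<subseteq> W <+>\<^bsub>S\<^esub> V" using W(2) sums(2) by (rule order_trans)
      show "finite (insert m F)" "insert m F \<subseteq> carrier M" using F m by simp_all
      show "(W <+>\<^bsub>S\<^esub> V) \<inter> ann (insert m F) \<subseteq> Q"
      proof
        fix t assume "t \<in> (W <+>\<^bsub>S\<^esub> V) \<inter> ann (insert m F)"
        then obtain w v where w: "w \<in> W" and v: "v \<in> V" and t: "t = w \<oplus>\<^bsub>S\<^esub> v"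
          and tF: "t \<in> ann F" "t \<in> ann {m}"
          by (auto simp: ann_def elim!: set_addE)
        have carr: "w \<in> carrier S" "v \<in> carrier S"
          using w v Wc S.right_ideal_subset [OF V(1)] by auto
        have "v \<in> ann F" using v V(4) by blast
        then have "w \<in> ann F"
          using carr(1) tF(1) unfolding t
          by (rule reg.sub_add_cancel_right [OF ann_right [OF F(2), unfolded S.right_ideal_iff]])
        then have wQ: "w \<in> Q" using w F(3) by blast
        have m': "{m} \<subseteq> carrier M" using m by simp
        have "w \<in> ann {m}" using wQ Q_ann [OF m'] by blast
        then have "v \<in> ann {m}"
          using carr(2) tF(2) unfolding t
          by (rule reg.sub_add_cancel_left [OF ann_right [OF m', unfolded S.right_ideal_iff]])
        then have "v \<in> Q" using v VQ by blast
        then show "t \<in> Q" using wQ rsubmoduleD(3) [OF Qr [unfolded S.right_ideal_iff]] t by simp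
      qed
    qed
    then have "V \<subseteq> W" using W_max [OF _ sums(2)] sums(3) by simp
    then show False using V(2-4) F(3) by blast
  qed

  define \<V> where "\<V> = {V. right_ideal V S \<and> Q \<subseteq> V \<and> V \<noteq> Q \<and> V \<subseteq> ann F}"
  \<comment> \<open>The right annihilator of \<open>V\<close> modulo \<open>Q\<close>, two-sided
    because \<open>V\<close> is a right ideal. A maximal one is prime, as with associated
    primes.\<close>
  define cann where "cann V = {a \<in> carrier S. \<forall>v\<in>V. v \<otimes>\<^bsub>S\<^esub> a \<in> Q}" for V
  have cann_ideal: "ideal (cann V) S" if V: "right_ideal V S" for V
  proof (rule S.idealI')
    have Vc: "V \<subseteq> carrier S" using V by (rule S.right_ideal_subset)
    interpret Q: ideal Q S by (rule Q)
    show "cann V \<subseteq> carrier S" by (auto simp: cann_def)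
    show "\<zero>\<^bsub>S\<^esub> \<in> cann V" using Vc by (auto simp: cann_def)
    fix x assume x: "x \<in> cann V"
    show "x \<oplus>\<^bsub>S\<^esub> y \<in> cann V" if "y \<in> cann V" for y
      using x that subsetD [OF Vc] by (simp add: cann_def S.r_distr)
    fix r assume r: "r \<in> carrier S"
    have xv: "v \<otimes>\<^bsub>S\<^esub> x \<in> Q" if "v \<in> V" for v using x that by (simp add: cann_def)
    have xc: "x \<in> carrier S" using x by (simp add: cann_def)
    have "v \<otimes>\<^bsub>S\<^esub> (x \<otimes>\<^bsub>S\<^esub> r) \<in> Q" if "v \<in> V" for v
      using Q.I_r_closed [OF xv [OF that] r] Vc that xc r by (simp add: S.m_assoc subset_iff)
    then show "x \<otimes>\<^bsub>S\<^esub> r \<in> cann V" using xc r by (simp add: cann_def)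
    have "v \<otimes>\<^bsub>S\<^esub> (r \<otimes>\<^bsub>S\<^esub> x) \<in> Q" if "v \<in> V" for v
      using xv [OF right_ideal.I_r_closed [OF V that r]] Vc that xc r by (simp add: S.m_assoc subset_iff)
    then show "r \<otimes>\<^bsub>S\<^esub> x \<in> cann V" using xc r by (simp add: cann_def)
  qed
  have "ann F \<in> \<V>" using ann_right [OF F(2)] Q_ann [OF F(2)] annF_neq by (simp add: \<V>_def)
  then have "cann (ann F) \<in> cann ` \<V>" by simp
  then have "\<exists>X\<in>cann ` \<V>. \<forall>Y\<in>cann ` \<V>. X \<subseteq> Y \<longrightarrow> Y = X"
    by (rule has_acc_maximal [OF noeth]) (auto simp: \<V>_def intro: S.ideal_right_ideal cann_ideal)
  then obtain V where V\<V>: "V \<in> \<V>" and V_max: "\<And>V'. V' \<in> \<V> \<Longrightarrow> cann V \<subseteq> cann V' \<Longrightarrow> cann V' = cann V"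
    by blast
  then have V: "right_ideal V S" "Q \<subseteq> V" "V \<noteq> Q" "V \<subseteq> ann F" by (simp_all add: \<V>_def)
  have Vc: "V \<subseteq> carrier S" using V(1) by (rule S.right_ideal_subset)
  define P where "P = cann V"
  have PV: "v \<otimes>\<^bsub>S\<^esub> a \<in> Q" if "v \<in> V" "a \<in> P" for v a using that by (simp add: P_def cann_def)
  have P: "ideal P S" unfolding P_def by (rule cann_ideal [OF V(1)])
  have Pc: "P \<subseteq> carrier S" by (auto simp: P_def cann_def)

  have submod: "(\<otimes>\<^bsub>S\<^esub>) v ` K <+>\<^bsub>S\<^esub> Q \<in> \<V>"
    if v: "v \<in> V" and K: "right_ideal K S" and nle: "\<not> (\<otimes>\<^bsub>S\<^esub>) v ` K \<subseteq> Q" for v K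
  proof -
    have vc: "v \<in> carrier S" using v Vc by blast
    have vK: "reg.sub ((\<otimes>\<^bsub>S\<^esub>) v ` K)"
      using reg.sub_act_image [OF K [unfolded S.right_ideal_iff] vc] .
    note sums = reg.sub_sum [OF vK Qr [unfolded S.right_ideal_iff]]
    have "(\<otimes>\<^bsub>S\<^esub>) v ` K \<subseteq> V"
      using right_ideal.I_r_closed [OF V(1) v] S.right_ideal_subset [OF K] by auto
    then have "(\<otimes>\<^bsub>S\<^esub>) v ` K <+>\<^bsub>S\<^esub> Q \<subseteq> V"
      using V(2) rsubmoduleD(3) [OF V(1) [unfolded S.right_ideal_iff]] by (auto elim!: set_addE)
    then show ?thesis
      using sums nle V(4) unfolding \<V>_def S.right_ideal_iff by blast
  qed

  have prime: "prime_two_sided_ideal P S"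
    unfolding prime_two_sided_ideal_def
  proof (intro conjI allI impI P)
    show "P \<noteq> carrier S"
    proof
      assume "P = carrier S"
      then have "v \<in> Q" if "v \<in> V" for v
        using PV [OF that, of "\<one>\<^bsub>S\<^esub>"] subsetD [OF Vc that] by simp
      then have "V \<subseteq> Q" by blast
      then show False using V(2,3) by blast
    qed
    fix I J assume IJ: "ideal I S \<and> ideal J S \<and> I \<cdot>\<^bsub>S\<^esub> J \<subseteq> P"
    then have I: "ideal I S" and J: "ideal J S" by simp_all
    have Ic: "I \<subseteq> carrier S" and Jc: "J \<subseteq> carrier S"
      using I J by (simp_all add: S.ideal_right_ideal S.right_ideal_subset)
    have "J \<subseteq> P" if "\<not> I \<subseteq> P"
    proof -
      obtain i where i: "i \<in> I" "i \<notin> P" using \<open>\<not> I \<subseteq> P\<close> by blast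
      then obtain v where v: "v \<in> V" "v \<otimes>\<^bsub>S\<^esub> i \<notin> Q"
        using Ic by (auto simp: P_def cann_def)
      have nle: "\<not> (\<otimes>\<^bsub>S\<^esub>) v ` I \<subseteq> Q" using v i by blast
      \<comment> \<open>\<open>V'\<close> lies inside \<open>V\<close>, so its annihilator contains
        \<open>P\<close> and equals it by maximality. Since \<open>v I J\<close> is contained in
        \<open>Q\<close>, \<open>J\<close> annihilates \<open>V'\<close>.\<close>
      define V' where "V' = (\<otimes>\<^bsub>S\<^esub>) v ` I <+>\<^bsub>S\<^esub> Q"
      have V': "V' \<in> \<V>" unfolding V'_def by (rule submod [OF v(1) S.ideal_right_ideal [OF I] nle])
      have V'_ann: "a \<in> cann V'" if a: "a \<in> carrier S" "\<And>i. i \<in> I \<Longrightarrow> v \<otimes>\<^bsub>S\<^esub> i \<otimes>\<^bsub>S\<^esub> a \<in> Q" for a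
      proof -
        have "w \<otimes>\<^bsub>S\<^esub> a \<in> Q" if w: "w \<in> V'" for w
        proof -
          obtain i q where iq: "i \<in> I" "q \<in> Q" "w = v \<otimes>\<^bsub>S\<^esub> i \<oplus>\<^bsub>S\<^esub> q"
            using w unfolding V'_def by (auto elim!: set_addE)
          then have "w \<otimes>\<^bsub>S\<^esub> a = v \<otimes>\<^bsub>S\<^esub> i \<otimes>\<^bsub>S\<^esub> a \<oplus>\<^bsub>S\<^esub> q \<otimes>\<^bsub>S\<^esub> a"
            using a(1) v(1) Vc Ic Qc by (simp add: S.l_distr subset_iff)
          then show ?thesis
            using a(2) [OF iq(1)] ideal.I_r_closed [OF Q iq(2) a(1)]
              rsubmoduleD(3) [OF Qr [unfolded S.right_ideal_iff]] by simp
        qed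
        then show ?thesis using a(1) by (simp add: cann_def)
      qed
      have "cann V \<subseteq> cann V'"
      proof
        fix a assume a: "a \<in> cann V"
        then show "a \<in> cann V'"
          using right_ideal.I_r_closed [OF V(1) v(1)] Ic by (intro V'_ann) (auto simp: cann_def subset_iff)
      qed
      then have "cann V' = P" unfolding P_def by (rule V_max [OF V'])
      moreover have "J \<subseteq> cann V'"
      proof
        fix b assume b: "b \<in> J"
        have "v \<otimes>\<^bsub>S\<^esub> i \<otimes>\<^bsub>S\<^esub> b \<in> Q" if "i \<in> I" for i
        proof -
          have "i \<otimes>\<^bsub>S\<^esub> b \<in> P" using IJ ideal_prod.prod [OF that b] by blast
          then show ?thesis using PV [OF v(1)] v(1) that b Vc Ic Jc by (simp add: S.m_assoc subset_iff)
        qed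
        then show "b \<in> cann V'" using b Jc by (intro V'_ann) auto
      qed
      ultimately show ?thesis by simp
    qed
    then show "I \<subseteq> P \<or> J \<subseteq> P" by blast
  qed
  note PD = S.prime_idealD [OF prime]

  \<comment> \<open>For \<open>K\<close> larger than \<open>P\<close>, either \<open>v K\<close>
    lies in \<open>Q\<close> and any \<open>k\<close> outside \<open>P\<close> serves, or
    \<open>v K + Q\<close> belongs to \<open>\<V>\<close> and \<open>key\<close> finds an element of
    it outside \<open>Q\<close> that sends \<open>m\<close> into \<open>N\<close>.\<close>
  have ess: "essential_over S P {a \<in> carrier S. m \<star> v \<star> a \<in> N}"
    if m: "m \<in> carrier M" and v: "v \<in> V" for m v
    unfolding essential_over_def
  proof (intro conjI allI impI)
    have vc: "v \<in> carrier S" using v Vc by blast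
    show "right_ideal {a \<in> carrier S. m \<star> v \<star> a \<in> N} S"
      unfolding S.right_ideal_iff using m vc by (intro colon_right_ideal N) simp
    show "P \<subseteq> {a \<in> carrier S. m \<star> v \<star> a \<in> N}"
      using QD [OF PV [OF v] m] Pc m vc by (auto simp: act_mult subset_iff)
    fix K assume "right_ideal K S \<and> P \<subseteq> K \<and> K \<noteq> P"
    then have K: "right_ideal K S" "P \<subseteq> K" "K \<noteq> P" by simp_all
    have Kc: "K \<subseteq> carrier S" using K(1) by (rule S.right_ideal_subset)
    have "\<exists>k\<in>K. k \<notin> P \<and> m \<star> v \<star> k \<in> N"
    proof (cases "(\<otimes>\<^bsub>S\<^esub>) v ` K \<subseteq> Q")
      case True
      obtain k where k: "k \<in> K" "k \<notin> P" using K by blast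
      moreover have "m \<star> (v \<otimes>\<^bsub>S\<^esub> k) \<in> N" using True k m by (intro QD) auto
      ultimately show ?thesis using m vc Kc by (auto simp: act_mult subset_iff)
    next
      case False
      have "(\<otimes>\<^bsub>S\<^esub>) v ` K <+>\<^bsub>S\<^esub> Q \<in> \<V>" by (rule submod [OF v K(1) False])
      then have "\<not> ((\<otimes>\<^bsub>S\<^esub>) v ` K <+>\<^bsub>S\<^esub> Q) \<inter> ann {m} \<subseteq> Q"
        using m by (intro key) (simp_all add: \<V>_def)
      then obtain k q where k: "k \<in> K" and q: "q \<in> Q"
        and t: "v \<otimes>\<^bsub>S\<^esub> k \<oplus>\<^bsub>S\<^esub> q \<in> ann {m}" "v \<otimes>\<^bsub>S\<^esub> k \<oplus>\<^bsub>S\<^esub> q \<notin> Q"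
        by (auto elim!: set_addE)
      have kc: "k \<in> carrier S" and qc: "q \<in> carrier S" using k Kc q Qc by auto
      have "m \<star> (v \<otimes>\<^bsub>S\<^esub> k) \<oplus>\<^bsub>M\<^esub> m \<star> q \<in> N"
        using annD [OF t(1), of m] kc qc vc m by (simp add: act_add_right)
      then have "m \<star> (v \<otimes>\<^bsub>S\<^esub> k) \<in> N"
        by (rule sub_add_cancel_right [OF N QD [OF q m], rotated]) (use kc vc m in simp)
      moreover have "k \<notin> P"
      proof
        assume "k \<in> P"
        then show False
          using PV [OF v] q t(2) rsubmoduleD(3) [OF Qr [unfolded S.right_ideal_iff]] by blast
      qed
      ultimately show ?thesis using k kc m vc by (auto simp: act_mult)
    qed
    then show "\<not> {a \<in> carrier S. m \<star> v \<star> a \<in> N} \<inter> K \<subseteq> P" using Kc by blast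
  qed

  \<comment> \<open>Boundedness gives each \<open>m \<star> v\<close> its own ideal, while one ideal
    for all is wanted. A maximal \<open>X\<close> with a common \<open>J\<close> absorbs them:
    enlarging it replaces \<open>J\<close> by \<open>J \<inter> L\<close>, which stays outside
    \<open>P\<close> by primeness.\<close>
  define \<X> where "\<X> = {X. sub X \<and> (\<exists>J. ideal J S \<and> \<not> J \<subseteq> P \<and> (\<forall>y\<in>X. \<forall>a\<in>J. y \<star> a \<in> N))}"
  have "N \<in> \<X>"
  proof -
    have "\<not> carrier S \<subseteq> P" using PD(2) by blast
    then show ?thesis using S.oneideal N ND(4) unfolding \<X>_def by blast
  qed
  then have "\<exists>X\<in>\<X>. \<forall>Y\<in>\<X>. X \<subseteq> Y \<longrightarrow> Y = X"
    by (rule has_acc_maximal [OF acc]) (simp add: \<X>_def)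
  then obtain X where X\<X>: "X \<in> \<X>" and X_max: "\<And>Y. Y \<in> \<X> \<Longrightarrow> X \<subseteq> Y \<Longrightarrow> Y = X" by blast
  then obtain J where X: "sub X" and J: "ideal J S" "\<not> J \<subseteq> P" and XJ: "\<And>y a. y \<in> X \<Longrightarrow> a \<in> J \<Longrightarrow> y \<star> a \<in> N"
    unfolding \<X>_def by blast
  have Jc: "J \<subseteq> carrier S" using J(1) by (simp add: S.ideal_right_ideal S.right_ideal_subset)
  have "m \<star> v \<in> X" if m: "m \<in> carrier M" and v: "v \<in> V" for m v
  proof -
    have mv: "m \<star> v \<in> carrier M" using m v Vc by auto
    from bdd [OF prime ess [OF m v]]
    obtain L where L: "ideal L S" "P \<subseteq> L" "L \<noteq> P" "L \<subseteq> {a \<in> carrier S. m \<star> v \<star> a \<in> N}"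
      by (elim exE conjE)
    have JL: "ideal (J \<inter> L) S" by (rule S.i_intersect [OF J(1) L(1)])
    have JL_nle: "\<not> J \<inter> L \<subseteq> P"
    proof
      assume "J \<inter> L \<subseteq> P"
      then have "J \<cdot>\<^bsub>S\<^esub> L \<subseteq> P" using S.ideal_prod_inter [OF J(1) L(1)] by blast
      then show False using prime J L unfolding prime_two_sided_ideal_def by blast
    qed
    have mvS: "sub ((\<star>) (m \<star> v) ` carrier S)" by (rule sub_act_image [OF reg.sub_carrier mv])
    note sums = sub_sum [OF X mvS]
    have "X <+>\<^bsub>M\<^esub> (\<star>) (m \<star> v) ` carrier S \<in> \<X>"
      unfolding \<X>_def
    proof (intro CollectI conjI exI [of _ "J \<inter> L"] sums JL JL_nle ballI)
      fix y a assume y: "y \<in> X <+>\<^bsub>M\<^esub> (\<star>) (m \<star> v) ` carrier S" and a: "a \<in> J \<inter> L"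
      obtain w s where w: "w \<in> X" "s \<in> carrier S" and yw: "y = w \<oplus>\<^bsub>M\<^esub> m \<star> v \<star> s"
        using y by (auto elim!: set_addE)
      have ac: "a \<in> carrier S" using a Jc by blast
      have wc: "w \<in> carrier M" using w rsubmoduleD(1) [OF X] by blast
      have "s \<otimes>\<^bsub>S\<^esub> a \<in> L" using ideal.I_l_closed [OF L(1)] a w by blast
      then have "m \<star> v \<star> (s \<otimes>\<^bsub>S\<^esub> a) \<in> N" using L(4) by blast
      then have "m \<star> v \<star> s \<star> a \<in> N" using mv w ac by (simp add: act_mult)
      moreover have "w \<star> a \<in> N" using XJ w a by blast
      moreover have "y \<star> a = w \<star> a \<oplus>\<^bsub>M\<^esub> m \<star> v \<star> s \<star> a"
        using yw wc mv w ac by (simp add: act_add_left)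
      ultimately show "y \<star> a \<in> N" using ND(3) by simp
    qed
    then have "(\<star>) (m \<star> v) ` carrier S \<subseteq> X" using X_max [OF _ sums(2)] sums(3) by simp
    moreover have "m \<star> v \<in> (\<star>) (m \<star> v) ` carrier S"
      using mv by (intro image_eqI [of _ _ "\<one>\<^bsub>S\<^esub>"]) simp_all
    ultimately show ?thesis by blast
  qed
  then have "v \<otimes>\<^bsub>S\<^esub> a \<in> Q" if "v \<in> V" "a \<in> J" for v a
    using that XJ Vc Jc by (auto simp: Q_def act_mult subset_iff)
  then have "J \<subseteq> P" using Jc by (auto simp: P_def cann_def)
  with J(2) show False by simp
qed

end

section \<open>Finite extensions of right FBN rings\<close>

context ring
begin

text \<open>The set is the annihilator of the right module \<open>R\<close>/\<open>I\<close>. If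
  \<open>I\<close> contains no ideal properly above \<open>P\<close>, but contains \<open>P\<close>,
  it must be \<open>P\<close>; this turns annihilation of \<open>R\<close>/\<open>I\<close> into
  membership in \<open>P\<close>.\<close>

lemma right_ideal_core:
  assumes I: "right_ideal I R"
  shows "ideal {r \<in> carrier R. \<forall>t\<in>carrier R. t \<otimes> r \<in> I} R" (is "ideal ?Q R")
    and "{r \<in> carrier R. \<forall>t\<in>carrier R. t \<otimes> r \<in> I} \<subseteq> I"
proof -
  note ID = rsubmoduleD [OF I [unfolded right_ideal_iff]]
  show "ideal ?Q R"
  proof (rule idealI')
    show "?Q \<subseteq> carrier R" by blast
    show "\<zero> \<in> ?Q" using ID(2) by simp
    fix x assume "x \<in> ?Q"
    then have xc: "x \<in> carrier R" and xI: "\<And>t. t \<in> carrier R \<Longrightarrow> t \<otimes> x \<in> I" by simp_all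
    show "x \<oplus> y \<in> ?Q" if "y \<in> ?Q" for y
      using that xc xI ID(3) by (simp add: r_distr)
    fix r assume r: "r \<in> carrier R"
    have "t \<otimes> (x \<otimes> r) \<in> I" if t: "t \<in> carrier R" for t
      using ID(4) [OF xI [OF t] r] t xc r by (simp add: m_assoc)
    then show "x \<otimes> r \<in> ?Q" using xc r by simp
    have "t \<otimes> (r \<otimes> x) \<in> I" if t: "t \<in> carrier R" for t
      using xI [of "t \<otimes> r"] t xc r by (simp add: m_assoc)
    then show "r \<otimes> x \<in> ?Q" using xc r by simp
  qed
  show "?Q \<subseteq> I"
  proof
    fix r assume "r \<in> ?Q"
    then have "r \<in> carrier R" "\<forall>t\<in>carrier R. t \<otimes> r \<in> I" by simp_all
    then show "r \<in> I" using one_closed l_one by metis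
  qed
qed

section \<open>Intersections and colon ideals of essential right ideals\<close>

lemma essential_over_inter:
  assumes "essential_over R P I" "essential_over R P J"
  shows "essential_over R P (I \<inter> J)"
  unfolding essential_over_def
proof (intro conjI allI impI)
  have I: "right_ideal I R" "P \<subseteq> I" and J: "right_ideal J R" "P \<subseteq> J"
    using assms by (simp_all add: essential_over_def)
  show "right_ideal (I \<inter> J) R" using I J unfolding right_ideal_iff by (intro rsubmodule_inter)
  show "P \<subseteq> I \<inter> J" using I J by simp
  fix K assume K: "right_ideal K R \<and> P \<subseteq> K \<and> K \<noteq> P"
  then have "\<not> I \<inter> K \<subseteq> P" using assms(1) by (simp add: essential_over_def)
  moreover have "right_ideal (I \<inter> K) R" using I K unfolding right_ideal_iff by (intro rsubmodule_inter) simp_all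
  moreover have "P \<subseteq> I \<inter> K" "I \<inter> K \<noteq> P" using K I calculation(1) by auto
  ultimately have "\<not> J \<inter> (I \<inter> K) \<subseteq> P" using assms(2) by (simp add: essential_over_def)
  then show "\<not> I \<inter> J \<inter> K \<subseteq> P" by blast
qed

text \<open>If \<open>r\<close> sends \<open>K\<close> into \<open>P\<close>, all of
  \<open>K\<close> lies in the colon ideal. Otherwise \<open>I\<close> meets \<open>rK + P\<close>
  outside \<open>P\<close>, and a witness there comes from a \<open>k\<close> outside
  \<open>P\<close>.\<close>

lemma essential_over_colon:
  assumes P: "ideal P R" and I: "essential_over R P I" and r: "r \<in> carrier R"
  shows "essential_over R P {k \<in> carrier R. r \<otimes> k \<in> I}"
  unfolding essential_over_def
proof (intro conjI allI impI)
  interpret P: ideal P R by fact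
  interpret reg: right_module R R "(\<otimes>)" by (rule regular_right_module)
  have Ir: "right_ideal I R" "P \<subseteq> I" using I by (simp_all add: essential_over_def)
  note Psub = ideal_right_ideal [OF P, unfolded right_ideal_iff]
  show "right_ideal {k \<in> carrier R. r \<otimes> k \<in> I} R" by (rule colon_right_ideal [OF Ir(1) r])
  show "P \<subseteq> {k \<in> carrier R. r \<otimes> k \<in> I}"
  proof
    fix p assume p: "p \<in> P"
    then show "p \<in> {k \<in> carrier R. r \<otimes> k \<in> I}" using P.I_l_closed [OF p r] Ir(2) by auto
  qed
  fix K assume "right_ideal K R \<and> P \<subseteq> K \<and> K \<noteq> P"
  then have K: "right_ideal K R" "P \<subseteq> K" "K \<noteq> P" by simp_all
  have Kc: "K \<subseteq> carrier R" by (rule right_ideal_subset [OF K(1)])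
  have "\<exists>k\<in>K. k \<notin> P \<and> r \<otimes> k \<in> I"
  proof (cases "(\<otimes>) r ` K \<subseteq> P")
    case True
    then show ?thesis using K Ir(2) by blast
  next
    case False
    note sums = reg.sub_sum [OF reg.sub_act_image [OF K(1) [unfolded right_ideal_iff] r] Psub]
    have "\<not> I \<inter> ((\<otimes>) r ` K <+>\<^bsub>R\<^esub> P) \<subseteq> P"
      using I sums False unfolding essential_over_def right_ideal_iff by blast
    then obtain k p where k: "k \<in> K" and p: "p \<in> P" and t: "r \<otimes> k \<oplus> p \<in> I" "r \<otimes> k \<oplus> p \<notin> P"
      by (auto elim!: set_addE)
    have kc: "r \<otimes> k \<in> carrier R" using k Kc r by auto
    have "p \<in> I" using p Ir(2) by blast
    then have "r \<otimes> k \<in> I"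
      using kc t(1) by (rule reg.sub_add_cancel_right [OF Ir(1) [unfolded right_ideal_iff]])
    moreover have "k \<notin> P"
    proof
      assume "k \<in> P"
      then show False using P.I_l_closed [OF _ r] p t(2) by simp
    qed
    ultimately show ?thesis using k by blast
  qed
  then show "\<not> {k \<in> carrier R. r \<otimes> k \<in> I} \<inter> K \<subseteq> P" using Kc by blast
qed

lemma essential_over_carrier:
  assumes P: "ideal P R"
  shows "essential_over R P (carrier R)"
  unfolding essential_over_def
proof (intro conjI allI impI)
  show "right_ideal (carrier R) R" by (rule ideal_right_ideal [OF oneideal])
  show "P \<subseteq> carrier R" by (rule right_ideal_subset [OF ideal_right_ideal [OF P]])
  fix K assume K: "right_ideal K R \<and> P \<subseteq> K \<and> K \<noteq> P"
  then show "\<not> carrier R \<inter> K \<subseteq> P" using right_ideal_subset [of K] by blast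
qed

lemma essential_over_finite_colon:
  assumes P: "ideal P R" and I: "essential_over R P I" and F: "finite F" "F \<subseteq> carrier R"
  shows "essential_over R P {k \<in> carrier R. \<forall>r\<in>F. r \<otimes> k \<in> I}"
  using F
proof (induction F rule: finite_induct)
  case empty
  then show ?case using essential_over_carrier [OF P] by simp
next
  case (insert r F)
  have "{k \<in> carrier R. \<forall>r\<in>insert r F. r \<otimes> k \<in> I} =
    {k \<in> carrier R. r \<otimes> k \<in> I} \<inter> {k \<in> carrier R. \<forall>r\<in>F. r \<otimes> k \<in> I}" by blast
  then show ?case
    using insert essential_over_inter [OF essential_over_colon [OF P I]] by simp
qed

text \<open>If \<open>c\<close> is regular modulo \<open>P\<close> and \<open>cR + P\<close> meets the image of \<open>S\<close> inside \<open>P\<close>, then the sum of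
  the \<open>c\<^sup>n S\<close> is direct modulo \<open>P\<close>, so \<open>R\<close> is not noetherian over \<open>S\<close>.\<close>

lemma no_regular_element_avoiding_subring:
  assumes S: "ring S" and j: "j \<in> ring_hom S R"
    and acc: "has_acc (rsubmodule S R (\<lambda>r s. r \<otimes> j s))"
    and P: "prime_two_sided_ideal P R" and K: "right_ideal K R" "P \<subseteq> K"
    and jK: "\<And>s. s \<in> carrier S \<Longrightarrow> j s \<in> K \<Longrightarrow> j s \<in> P"
    and c: "c \<in> K" "\<And>r. r \<in> carrier R \<Longrightarrow> c \<otimes> r \<in> P \<Longrightarrow> r \<in> P"
  shows False
proof -
  interpret S: ring S by fact
  interpret j: ring_hom_ring S R j
    by (intro ring_hom_ringI2 S ring_axioms j)
  interpret RS: right_module S R "\<lambda>r s. r \<otimes> j s"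
    by unfold_locales (simp_all add: l_distr r_distr m_assoc)
  interpret reg: right_module R R "(\<otimes>)" by (rule regular_right_module)
  note PD = prime_idealD [OF P]
  have cc: "c \<in> carrier R" using c(1) right_ideal_subset [OF K(1)] by blast
  define jP where "jP = j ` carrier S <+>\<^bsub>R\<^esub> P"
  have subj: "RS.sub (j ` carrier S)"
  proof (rule rsubmodule_image)
    show "rsubmodule S S (\<otimes>\<^bsub>S\<^esub>) (carrier S)"
      using S.oneideal by (simp add: S.ideal_iff S.right_ideal_iff)
    fix x t assume "x \<in> carrier S" "t \<in> carrier S"
    then show "\<exists>s\<in>carrier S. j (x \<otimes>\<^bsub>S\<^esub> s) = j x \<otimes> j t" by (intro bexI [of _ t]) simp_all
  qed simp_all
  have subP: "RS.sub P"
    using PD(4-6,8) by (intro rsubmoduleI) simp_all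
  note sum_jP = RS.sub_sum [OF subj subP, folded jP_def]
  \<comment> \<open>Horner form of \<open>P\<close> plus the sum of \<open>c [^] i\<close> times the
    image of \<open>S\<close> over \<open>i < n\<close>. Starting from \<open>P\<close> keeps
    \<open>P\<close> inside each \<open>Y n\<close>, so that \<open>c\<close> may be cancelled
    modulo \<open>P\<close>. The chain is strict because \<open>c [^] n\<close> first appears in
    \<open>Y (Suc n)\<close>.\<close>
  define Y where "Y = rec_nat P (\<lambda>_ Z. jP <+>\<^bsub>R\<^esub> (\<otimes>) c ` Z)"
  have Y0: "Y 0 = P" and YS: "Y (Suc n) = jP <+>\<^bsub>R\<^esub> (\<otimes>) c ` Y n" for n
    by (simp_all add: Y_def)
  have sub_c: "RS.sub ((\<otimes>) c ` Z)" if "RS.sub Z" for Z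
    using that
  proof (rule rsubmodule_image)
    fix x t assume "x \<in> carrier R" "t \<in> carrier S"
    then show "\<exists>s\<in>carrier S. c \<otimes> (x \<otimes> j s) = c \<otimes> x \<otimes> j t"
      using cc by (intro bexI [of _ t]) (simp_all add: m_assoc)
  qed (use cc in \<open>simp_all add: r_distr\<close>)
  have subY: "RS.sub (Y n)" for n
    by (induction n) (simp_all add: Y0 YS subP RS.sub_sum(1) sum_jP(1) sub_c)
  have Yc: "Y n \<subseteq> carrier R" for n by (rule rsubmoduleD(1) [OF subY])
  have P_Y: "P \<subseteq> Y n" for n
  proof (cases n)
    case (Suc m)
    have "P \<subseteq> jP" by (rule sum_jP(3))
    also have "jP \<subseteq> Y n" unfolding Suc YS by (rule RS.sub_sum(2) [OF sum_jP(1) sub_c [OF subY]])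
    finally show ?thesis .
  qed (simp add: Y0)
  have mono: "Y n \<subseteq> Y (Suc n)" for n
  proof (induction n)
    case 0
    show ?case unfolding Y0 by (rule P_Y)
  next
    case (Suc n)
    show ?case
      unfolding YS [of "Suc n"]
    proof
      fix t assume "t \<in> Y (Suc n)"
      then obtain a y where a: "a \<in> jP" and y: "y \<in> Y n" and t: "t = a \<oplus> c \<otimes> y"
        unfolding YS by (auto elim!: set_addE)
      show "t \<in> jP <+>\<^bsub>R\<^esub> (\<otimes>) c ` Y (Suc n)"
        unfolding t using a y Suc by (intro set_addI) auto
    qed
  qed
  have pow_in: "c [^] n \<in> Y (Suc n)" for n :: nat
  proof (induction n)
    case 0
    have "\<one> \<in> j ` carrier S" by (intro image_eqI [of _ _ "\<one>\<^bsub>S\<^esub>"]) simp_all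
    then have "\<one> \<in> Y (Suc 0)"
      unfolding YS using sum_jP(2) RS.sub_sum(2) [OF sum_jP(1) sub_c [OF subY]] by blast
    then show ?case by simp
  next
    case (Suc n)
    then have "c \<otimes> c [^] n \<in> (\<otimes>) c ` Y (Suc n)" by blast
    then have "c \<otimes> c [^] n \<in> Y (Suc (Suc n))"
      unfolding YS [of "Suc n"] using RS.sub_sum(3) [OF sum_jP(1) sub_c [OF subY]] by blast
    then show ?case by (simp only: nat_pow_Suc2 [OF cc])
  qed
  have pow_notin: "c [^] n \<notin> Y n" for n :: nat
  proof (induction n)
    case 0
    then show ?case using PD(2) by (simp add: Y0)
  next
    case (Suc n)
    show ?case
    proof
      assume "c [^] Suc n \<in> Y (Suc n)"
      then obtain a y where a: "a \<in> jP" and y: "y \<in> Y n" and t: "c [^] Suc n = a \<oplus> c \<otimes> y"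
        unfolding YS by (auto elim!: set_addE)
      then obtain s p where s: "s \<in> carrier S" and p: "p \<in> P" and a_eq: "a = j s \<oplus> p"
        unfolding jP_def by (auto elim!: set_addE)
      have carr: "y \<in> carrier R" "p \<in> carrier R" "a \<in> carrier R" "j s \<in> carrier R"
        using y p Yc PD(4) a rsubmoduleD(1) [OF sum_jP(1)] s by auto
      \<comment> \<open>The equation for \<open>c [^] Suc n\<close> is solved for its part
        \<open>a\<close>, which becomes \<open>c \<otimes> d\<close> and so lies in
        \<open>K\<close>. Its component \<open>j s\<close> is then in \<open>K\<close>, hence in
        \<open>P\<close>, and regularity of \<open>c\<close> brings \<open>d\<close> into
        \<open>P\<close>.\<close>
      define d where "d = c [^] n \<ominus> y"
      have d: "d \<in> carrier R" using carr cc by (simp add: d_def)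
      have cd: "c \<otimes> d = a"
      proof -
        have "c \<otimes> d = c \<otimes> c [^] n \<ominus> c \<otimes> y"
          unfolding d_def a_minus_def using carr cc by (simp add: r_distr r_minus)
        also have "c \<otimes> c [^] n = a \<oplus> c \<otimes> y"
          using t nat_pow_Suc2 [OF cc] by simp
        finally show ?thesis using carr cc by (simp add: a_minus_def a_assoc r_neg)
      qed
      have "j s \<oplus> p \<in> K"
        unfolding a_eq [symmetric] cd [symmetric] by (rule right_ideal.I_r_closed [OF K(1) c(1) d])
      then have "j s \<in> K"
        by (rule reg.sub_add_cancel_right [OF K(1) [unfolded right_ideal_iff] subsetD [OF K(2) p] carr(4)])
      then have "c \<otimes> d \<in> P" unfolding cd a_eq using jK [OF s] PD(5) p by simp
      then have "d \<in> Y n" using c(2) [OF d] P_Y by blast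
      then have "d \<oplus> y \<in> Y n" using rsubmoduleD(3) [OF subY] y by blast
      moreover have "d \<oplus> y = c [^] n" using carr cc by (simp add: d_def a_minus_def a_assoc l_neg)
      ultimately show False using Suc by simp
    qed
  qed
  obtain n where "\<forall>m\<ge>n. Y m = Y n"
    using has_accD [where I = Y, OF acc subY mono] by (rule exE)
  then have "Y (Suc n) = Y n" by (rule allE [of _ "Suc n"]) simp
  then show False using pow_in [of n] pow_notin [of n] by simp
qed

theorem right_FBN_finite_extension:
  assumes S: "ring S" and fbn: "right_FBN S" and j: "j \<in> ring_hom S R"
    and acc: "has_acc (rsubmodule S R (\<lambda>r s. r \<otimes> j s))"
  shows "right_FBN R"
proof -
  interpret S: ring S by fact
  interpret j: ring_hom_ring S R j
    by (intro ring_hom_ringI2 S ring_axioms j)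
  interpret RS: right_module S R "\<lambda>r s. r \<otimes> j s"
    by unfold_locales (simp_all add: l_distr r_distr m_assoc)
  have sub: "RS.sub I" if "right_ideal I R" for I
    using rsubmoduleD [OF that [unfolded right_ideal_iff]] by (intro rsubmoduleI) simp_all
  have noeth: "right_noetherian R"
    unfolding right_noetherian_iff_has_acc
    by (rule has_acc_transfer [OF acc, where \<Phi> = id]) (simp_all add: sub)
  have "\<exists>J. ideal J R \<and> P \<subseteq> J \<and> J \<noteq> P \<and> J \<subseteq> I"
    if P: "prime_two_sided_ideal P R" and I: "essential_over R P I" for P I
  proof (rule ccontr)
    assume contr: "\<not> ?thesis"
    note PD = prime_idealD [OF P]
    have Ir: "right_ideal I R" "P \<subseteq> I" using I by (simp_all add: essential_over_def)
    note ID = rsubmoduleD [OF Ir(1) [unfolded right_ideal_iff]]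
    define Q where "Q = {r \<in> carrier R. \<forall>t\<in>carrier R. t \<otimes> r \<in> I}"
    note Q = right_ideal_core [OF Ir(1), folded Q_def]
    have "P \<subseteq> Q" using PD(4,7) Ir(2) by (auto simp: Q_def)
    with Q have QP: "Q = P" using contr by blast
    obtain F where F: "finite F" "F \<subseteq> carrier R"
      and ann: "\<forall>s\<in>carrier S. (\<forall>m\<in>F. m \<otimes> j s \<in> I) \<longrightarrow> (\<forall>m\<in>carrier R. m \<otimes> j s \<in> I)"
      using RS.finite_annihilator [OF fbn acc sub [OF Ir(1)]] by (elim exE conjE)
    define K where "K = {k \<in> carrier R. \<forall>r\<in>F. r \<otimes> k \<in> I}"
    have K: "essential_over R P K" unfolding K_def by (rule essential_over_finite_colon [OF PD(1) I F])
    then have Kr: "right_ideal K R" "P \<subseteq> K" by (simp_all add: essential_over_def)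
    \<comment> \<open>Such an \<open>s\<close> sends the finite set \<open>F\<close>, hence all of
      \<open>R\<close>, into \<open>I\<close>; thus \<open>j s\<close> is in the core of
      \<open>I\<close>, which is \<open>P\<close>.\<close>
    have "j s \<in> P" if "s \<in> carrier S" "j s \<in> K" for s
      unfolding QP [symmetric] Q_def using that ann by (simp add: K_def)
    moreover obtain c where "c \<in> K" "\<forall>r\<in>carrier R. c \<otimes> r \<in> P \<longrightarrow> r \<in> P"
      using essential_over_regular_element [OF noeth P K] by (rule bexE)
    ultimately show False
      using no_regular_element_avoiding_subring [OF S j acc P Kr, of c] by blast
  qed
  then show ?thesis
    unfolding right_FBN_def right_fully_bounded_iff using noeth by blast
qed

end

section \<open>Subrings with a surjective trace\<close>

text \<open>The section b \<mapsto> \<open>b \<otimes> a\<^sub>0\<close> of \<open>tr\<close>, see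
  \<open>tr_B\<close>, makes \<open>B\<close> a direct summand of \<open>A\<close> as a left
  \<open>B\<close>-module. Keeping coring data out isolates the descent from \<open>A\<close> to
  \<open>B\<close>.\<close>

locale trace_subring = A: ring A for A :: "('a, 'm) ring_scheme" +
  fixes B :: "'a set" and tr :: "'a \<Rightarrow> 'a" and a\<^sub>0 :: 'a
  assumes B: "subring B A"
    and tr_closed: "y \<in> carrier A \<Longrightarrow> tr y \<in> B"
    and tr_add: "y \<in> carrier A \<Longrightarrow> y' \<in> carrier A \<Longrightarrow> tr (y \<oplus>\<^bsub>A\<^esub> y') = tr y \<oplus>\<^bsub>A\<^esub> tr y'"
    and tr_right: "y \<in> carrier A \<Longrightarrow> b \<in> B \<Longrightarrow> tr (y \<otimes>\<^bsub>A\<^esub> b) = tr y \<otimes>\<^bsub>A\<^esub> b"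
    and tr_left: "y \<in> carrier A \<Longrightarrow> b \<in> B \<Longrightarrow> tr (b \<otimes>\<^bsub>A\<^esub> y) = b \<otimes>\<^bsub>A\<^esub> tr y"
    and a\<^sub>0: "a\<^sub>0 \<in> carrier A" and tr_one: "tr a\<^sub>0 = \<one>\<^bsub>A\<^esub>"
begin

abbreviation BR where "BR \<equiv> A\<lparr>carrier := B\<rparr>"

lemma B_carrier: "b \<in> B \<Longrightarrow> b \<in> carrier A"
  using subringE(1) [OF B] by blast

lemma ring_BR: "ring BR"
  by (rule A.subring_is_ring [OF B])

lemma tr_B: "b \<in> B \<Longrightarrow> tr (b \<otimes>\<^bsub>A\<^esub> a\<^sub>0) = b"
  by (simp add: tr_left a\<^sub>0 tr_one B_carrier)

text \<open>For a right ideal \<open>I\<close> of \<open>B\<close>, the largest right ideal of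
  \<open>A\<close> that \<open>tr\<close> maps into \<open>I\<close>.\<close>

definition trace_core :: "'a set \<Rightarrow> 'a set" where
  "trace_core I = {y \<in> carrier A. \<forall>a\<in>carrier A. tr (y \<otimes>\<^bsub>A\<^esub> a) \<in> I}"

lemma tr_zero: "tr \<zero>\<^bsub>A\<^esub> = \<zero>\<^bsub>A\<^esub>"
proof -
  have "tr (\<zero>\<^bsub>A\<^esub> \<otimes>\<^bsub>A\<^esub> a\<^sub>0) = \<zero>\<^bsub>A\<^esub>"
    using tr_left [OF a\<^sub>0 subringE(2) [OF B]] B_carrier [OF tr_closed [OF a\<^sub>0]] by simp
  then show ?thesis using a\<^sub>0 by simp
qed

lemma trace_core_right_ideal:
  assumes "right_ideal I BR"
  shows "right_ideal (trace_core I) A"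
proof -
  interpret BR: ring BR by (rule ring_BR)
  note ID = rsubmoduleD [OF assms [unfolded BR.right_ideal_iff]]
  show ?thesis
    unfolding A.right_ideal_iff trace_core_def
  proof (rule rsubmoduleI)
    fix x assume x: "x \<in> {y \<in> carrier A. \<forall>a\<in>carrier A. tr (y \<otimes>\<^bsub>A\<^esub> a) \<in> I}"
    show "x \<oplus>\<^bsub>A\<^esub> y \<in> {y \<in> carrier A. \<forall>a\<in>carrier A. tr (y \<otimes>\<^bsub>A\<^esub> a) \<in> I}"
      if "y \<in> {y \<in> carrier A. \<forall>a\<in>carrier A. tr (y \<otimes>\<^bsub>A\<^esub> a) \<in> I}" for y
      using x that ID(3) by (simp add: A.l_distr tr_add)
    show "x \<otimes>\<^bsub>A\<^esub> s \<in> {y \<in> carrier A. \<forall>a\<in>carrier A. tr (y \<otimes>\<^bsub>A\<^esub> a) \<in> I}" if "s \<in> carrier A" for s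
      using x that by (simp add: A.m_assoc)
  qed (use ID(2) tr_zero in auto)
qed

text \<open>For \<open>b\<close> in \<open>B\<close>, left linearity gives
  \<open>tr (b \<otimes> a) = b \<otimes> tr a\<close>, and \<open>a = a\<^sub>0\<close> returns
  \<open>b\<close> itself. Right ideals of \<open>B\<close> can therefore be recovered from their
  images in \<open>A\<close>.\<close>

lemma trace_core_Int:
  assumes "right_ideal I BR"
  shows "trace_core I \<inter> B = I"
proof -
  interpret BR: ring BR by (rule ring_BR)
  note ID = rsubmoduleD [OF assms [unfolded BR.right_ideal_iff]]
  have "b \<in> I" if "b \<in> trace_core I" "b \<in> B" for b
    using that a\<^sub>0 tr_B [of b] by (auto simp: trace_core_def)
  moreover have "b \<in> trace_core I" "b \<in> B" if b: "b \<in> I" for b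
  proof -
    show bB: "b \<in> B" using b ID(1) by auto
    have "tr (b \<otimes>\<^bsub>A\<^esub> a) \<in> I" if "a \<in> carrier A" for a
      using ID(4) [OF b, of "tr a"] tr_left [OF that bB] tr_closed [OF that] by simp
    then show "b \<in> trace_core I" using B_carrier [OF bB] by (simp add: trace_core_def)
  qed
  ultimately show ?thesis by blast
qed

lemma right_noetherian_BR:
  assumes "right_noetherian A"
  shows "right_noetherian BR"
  unfolding right_noetherian_iff_has_acc
proof (rule has_acc_transfer)
  show "has_acc (\<lambda>I. right_ideal I A)" using assms by (simp add: right_noetherian_iff_has_acc)
  show "right_ideal I BR \<Longrightarrow> right_ideal (trace_core I) A" for I by (rule trace_core_right_ideal)
  show "X \<subseteq> Y \<Longrightarrow> trace_core X \<subseteq> trace_core Y" for X Y by (auto simp: trace_core_def)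
  fix X Y assume "right_ideal X BR" "right_ideal Y BR" "trace_core X = trace_core Y"
  then show "X = Y" by (metis trace_core_Int)
qed

text \<open>\<open>mult\<close> makes \<open>trace_core I\<close> an \<open>S\<close>-submodule.
  \<open>corner\<close> realises, for each \<open>b\<close> in \<open>B\<close>, the map y \<mapsto>
  \<open>tr (y \<otimes> a\<^sub>0) \<otimes> b\<close> by an element of \<open>S\<close>, so that
  condition H over \<open>S\<close> can be tested with elements of \<open>B\<close>. The
  contradiction with essentiality is direct here and involves no regular elements.\<close>

lemma right_FBN_BR:
  assumes module: "right_module S A act" and acc: "has_acc (rsubmodule S A act)"
    and fbn: "right_FBN S" and noeth: "right_noetherian A"
    and mult: "\<And>f a. f \<in> carrier S \<Longrightarrow> a \<in> carrier A \<Longrightarrow>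
      \<exists>a'\<in>carrier A. \<forall>y\<in>carrier A. tr (act y f \<otimes>\<^bsub>A\<^esub> a) = tr (y \<otimes>\<^bsub>A\<^esub> a')"
    and corner: "\<And>b. b \<in> B \<Longrightarrow> \<exists>f\<in>carrier S. \<forall>y\<in>carrier A. act y f = tr (y \<otimes>\<^bsub>A\<^esub> a\<^sub>0) \<otimes>\<^bsub>A\<^esub> b"
  shows "right_FBN BR"
proof -
  interpret right_module S A act by fact
  interpret BR: ring BR by (rule ring_BR)
  have "\<exists>J. ideal J BR \<and> P \<subseteq> J \<and> J \<noteq> P \<and> J \<subseteq> I"
    if P: "prime_two_sided_ideal P BR" and I: "essential_over BR P I" for P I
  proof (rule ccontr)
    assume contr: "\<not> ?thesis"
    note PD = BR.prime_idealD [OF P]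
    have Ir: "right_ideal I BR" "P \<subseteq> I" using I by (simp_all add: essential_over_def)
    note ID = rsubmoduleD [OF Ir(1) [unfolded BR.right_ideal_iff]]
    define Q where "Q = {r \<in> carrier BR. \<forall>t\<in>carrier BR. t \<otimes>\<^bsub>BR\<^esub> r \<in> I}"
    note Q = BR.right_ideal_core [OF Ir(1), folded Q_def]
    have "P \<subseteq> Q"
    proof
      fix p assume "p \<in> P"
      then show "p \<in> Q" using PD(4) PD(7) [of p] Ir(2) by (auto simp: Q_def)
    qed
    with Q have QP: "Q = P" using contr by blast
    have core: "sub (trace_core I)"
    proof (rule rsubmoduleI)
      note CD = rsubmoduleD [OF trace_core_right_ideal [OF Ir(1), unfolded A.right_ideal_iff]]
      show "trace_core I \<subseteq> carrier A" "\<zero>\<^bsub>A\<^esub> \<in> trace_core I" by (fact CD)+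
      fix y assume y: "y \<in> trace_core I"
      show "y \<oplus>\<^bsub>A\<^esub> y' \<in> trace_core I" if "y' \<in> trace_core I" for y' using CD(3) [OF y that] .
      fix f assume f: "f \<in> carrier S"
      have yc: "y \<in> carrier A" using y by (simp add: trace_core_def)
      have "tr (act y f \<otimes>\<^bsub>A\<^esub> a) \<in> I" if a: "a \<in> carrier A" for a
      proof -
        obtain a' where "a' \<in> carrier A" "\<forall>y\<in>carrier A. tr (act y f \<otimes>\<^bsub>A\<^esub> a) = tr (y \<otimes>\<^bsub>A\<^esub> a')"
          using mult [OF f a] by (rule bexE)
        then show ?thesis using y yc by (simp add: trace_core_def)
      qed
      then show "act y f \<in> trace_core I" using yc f by (simp add: trace_core_def)
    qed
    obtain F where F: "finite F" "F \<subseteq> carrier A"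
      and ann: "\<forall>s\<in>carrier S. (\<forall>m\<in>F. act m s \<in> trace_core I) \<longrightarrow> (\<forall>m\<in>carrier A. act m s \<in> trace_core I)"
      using finite_annihilator [OF fbn acc core] by (elim exE conjE)
    \<comment> \<open>For \<open>b\<close> in \<open>E\<close>, the element \<open>f\<close> given
      by \<open>corner\<close> sends \<open>F\<close>, hence all of \<open>A\<close>, into
      \<open>trace_core I\<close>. Its value at \<open>b'\<close> in \<open>B\<close> is
      \<open>b' \<otimes> b\<close>, so \<open>b\<close> is in the core of \<open>I\<close>. Thus
      \<open>E\<close> lies in the proper ideal \<open>P\<close> and cannot be essential.\<close>
    define G where "G = (\<lambda>y. tr (y \<otimes>\<^bsub>A\<^esub> a\<^sub>0)) ` F"
    have G: "finite G" "G \<subseteq> carrier BR"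
      using F a\<^sub>0 tr_closed by (auto simp: G_def)
    define E where "E = {k \<in> carrier BR. \<forall>r\<in>G. r \<otimes>\<^bsub>BR\<^esub> k \<in> I}"
    have E: "essential_over BR P E" unfolding E_def by (rule BR.essential_over_finite_colon [OF PD(1) I G])
    have "E \<subseteq> P"
    proof
      fix b assume "b \<in> E"
      then have b: "b \<in> B" and bI: "\<And>y. y \<in> F \<Longrightarrow> tr (y \<otimes>\<^bsub>A\<^esub> a\<^sub>0) \<otimes>\<^bsub>A\<^esub> b \<in> I"
        by (simp_all add: E_def G_def)
      obtain f where f: "f \<in> carrier S" and act_f: "\<forall>y\<in>carrier A. act y f = tr (y \<otimes>\<^bsub>A\<^esub> a\<^sub>0) \<otimes>\<^bsub>A\<^esub> b"
        using corner [OF b] by (rule bexE)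
      have "act y f \<in> trace_core I" if y: "y \<in> F" for y
      proof -
        have "tr (y \<otimes>\<^bsub>A\<^esub> a\<^sub>0) \<otimes>\<^bsub>A\<^esub> b \<in> trace_core I"
          using trace_core_Int [OF Ir(1)] bI [OF y] by blast
        then show ?thesis using act_f y F(2) by auto
      qed
      then have all: "act y f \<in> trace_core I" if "y \<in> carrier A" for y using ann f that by blast
      have "b' \<otimes>\<^bsub>A\<^esub> b \<in> I" if b': "b' \<in> B" for b'
      proof -
        have "b' \<otimes>\<^bsub>A\<^esub> b \<in> trace_core I"
          using all [OF B_carrier [OF b']] act_f B_carrier [OF b'] tr_B [OF b'] by simp
        moreover have "b' \<otimes>\<^bsub>A\<^esub> b \<in> B" using subringE(6) [OF B b' b] .
        ultimately show ?thesis using trace_core_Int [OF Ir(1)] by blast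
      qed
      then have "b \<in> Q" using b by (simp add: Q_def)
      then show "b \<in> P" using QP by simp
    qed
    moreover have "\<not> E \<inter> carrier BR \<subseteq> P"
    proof -
      have "right_ideal (carrier BR) BR" by (rule BR.ideal_right_ideal [OF BR.oneideal])
      moreover have "carrier BR \<noteq> P" using PD(2) BR.one_closed by blast
      ultimately show ?thesis using E PD(4) unfolding essential_over_def by blast
    qed
    ultimately show False by blast
  qed
  then show ?thesis
    unfolding right_FBN_def BR.right_fully_bounded_iff using right_noetherian_BR [OF noeth] by blast
qed

end

section \<open>Maps out of tensor products\<close>

abbreviation additive_maps ::
    "('b, 'm) ring_scheme \<Rightarrow> ('c, 'n) ring_scheme \<Rightarrow> ('b \<Rightarrow> 'c) set" where
  "additive_maps G H \<equiv> hom (add_monoid G) (add_monoid H)"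

lemma additiveI:
  assumes "\<And>x. x \<in> carrier G \<Longrightarrow> h x \<in> carrier H"
    "\<And>x y. x \<in> carrier G \<Longrightarrow> y \<in> carrier G \<Longrightarrow> h (x \<oplus>\<^bsub>G\<^esub> y) = h x \<oplus>\<^bsub>H\<^esub> h y"
  shows "h \<in> additive_maps G H"
  using assms by (simp add: hom_def)

lemma additiveD:
  assumes "h \<in> additive_maps G H"
  shows "x \<in> carrier G \<Longrightarrow> h x \<in> carrier H"
    "x \<in> carrier G \<Longrightarrow> y \<in> carrier G \<Longrightarrow> h (x \<oplus>\<^bsub>G\<^esub> y) = h x \<oplus>\<^bsub>H\<^esub> h y"
  using assms by (auto simp: hom_def)

lemma additive_comp: "f \<in> additive_maps G H \<Longrightarrow> h \<in> additive_maps H L \<Longrightarrow> (\<lambda>x. h (f x)) \<in> additive_maps G L"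
  by (rule additiveI) (simp_all add: additiveD)

text \<open>The value at \<open>p\<close> of the extension of \<open>b\<close> to the free abelian
  group; \<open>tensor_lift\<close> takes its common value over a coset.\<close>

definition lift_rep :: "('g, 'm) ring_scheme \<Rightarrow> ('q \<Rightarrow> 'g) \<Rightarrow> ('q \<Rightarrow>\<^sub>0 int) \<Rightarrow> 'g" where
  "lift_rep G b p = (\<Oplus>\<^bsub>G\<^esub>q\<in>Poly_Mapping.keys p. add_pow G (Poly_Mapping.lookup p q) (b q))"

lemma lift_rep_cong:
  assumes "abelian_group G" "Poly_Mapping.keys p \<subseteq> S"
    and "\<And>q. q \<in> S \<Longrightarrow> b q \<in> carrier G" "\<And>q. q \<in> S \<Longrightarrow> b q = b' q"
  shows "lift_rep G b p = lift_rep G b' p"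
proof -
  interpret G: abelian_group G by fact
  show ?thesis
    unfolding lift_rep_def
  proof (rule G.finsum_cong')
    show "(\<lambda>q. add_pow G (Poly_Mapping.lookup p q) (b' q)) \<in> Poly_Mapping.keys p \<rightarrow> carrier G"
      using assms(2-4) by (auto intro!: G.add.int_pow_closed)
  qed (use assms(2,4) in auto)
qed

lemma hom_free_Abelian_group_eq_lift_rep:
  assumes G: "abelian_group G" and h: "h \<in> hom (free_Abelian_group S) (add_monoid G)"
    and p: "Poly_Mapping.keys p \<subseteq> S"
  shows "h p = lift_rep G (\<lambda>q. h (frag_of q)) p"
proof -
  interpret G: abelian_group G by fact
  interpret h: group_hom "free_Abelian_group S" "add_monoid G" h
    using h G.a_group by (simp add: group_hom_def group_hom_axioms_def)
  have sum: "h (\<Sum>i\<in>J. frag_cmul (k i) (frag_of i)) = (\<Oplus>\<^bsub>G\<^esub>i\<in>J. add_pow G (k i) (h (frag_of i)))"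
    if "finite J" "J \<subseteq> S" for J k
    using that
  proof (induction J rule: finite_induct)
    case empty
    then show ?case using h.hom_one by simp
  next
    case (insert i J)
    have i: "frag_of i \<in> carrier (free_Abelian_group S)" using insert by simp
    have cmul: "frag_cmul (k j) (frag_of j) \<in> carrier (free_Abelian_group S)" if "j \<in> S" for j
      using that keys_cmul [of "k j" "frag_of j"] by auto
    have rest: "(\<Sum>i\<in>J. frag_cmul (k i) (frag_of i)) \<in> carrier (free_Abelian_group S)"
      using insert cmul by (intro sum_closed_free_Abelian_group) auto
    have "h (frag_cmul (k i) (frag_of i)) = h (frag_of i [^]\<^bsub>free_Abelian_group S\<^esub> k i)"
      using i by simp
    also have "\<dots> = add_pow G (k i) (h (frag_of i))"
      unfolding add_pow_def by (rule h.hom_int_pow [OF i])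
    finally have hi: "h (frag_cmul (k i) (frag_of i)) = add_pow G (k i) (h (frag_of i))" .
    have hc: "h (frag_of j) \<in> carrier G" if "j \<in> S" for j
      using h.hom_closed [of "frag_of j"] that by simp
    have "h (\<Sum>i\<in>insert i J. frag_cmul (k i) (frag_of i)) =
        h (frag_cmul (k i) (frag_of i)) \<oplus>\<^bsub>G\<^esub> h (\<Sum>i\<in>J. frag_cmul (k i) (frag_of i))"
      using h.hom_mult [OF cmul rest, of i] insert by simp
    also have "\<dots> = (\<Oplus>\<^bsub>G\<^esub>i\<in>insert i J. add_pow G (k i) (h (frag_of i)))"
    proof -
      have "add_pow G (k j) (h (frag_of j)) \<in> carrier G" if "j \<in> S" for j
        by (rule G.add.int_pow_closed [OF hc [OF that]])
      then show ?thesis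
        using insert hi by (subst G.finsum_insert) auto
    qed
    finally show ?case .
  qed
  have "h p = h (\<Sum>i\<in>Poly_Mapping.keys p. frag_cmul (Poly_Mapping.lookup p i) (frag_of i))"
    by (subst frag_expansion) (simp add: frag_extend_def)
  also have "\<dots> = lift_rep G (\<lambda>q. h (frag_of q)) p"
    unfolding lift_rep_def by (rule sum [OF finite_keys p])
  finally show ?thesis .
qed

lemma tensor_lift_eq: "tensor_lift G \<beta> X = the_elem (lift_rep G (case_prod \<beta>) ` X)"
  unfolding tensor_lift_def lift_rep_def by simp

text \<open>These closure properties are what places the relators in the free group. Stated this
  way, the tensor square of \<open>\<C>\<close> with its two actions can itself be a factor of a
  triple tensor product.\<close>

locale tensor_factors =
  fixes A :: "('a, 'm) ring_scheme" and M :: "('a, 'b) bimodule" and N :: "('a, 'c) bimodule"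
  assumes M_add: "\<lbrakk>m \<in> carrier M; m' \<in> carrier M\<rbrakk> \<Longrightarrow> m \<oplus>\<^bsub>M\<^esub> m' \<in> carrier M"
    and M_ract: "\<lbrakk>m \<in> carrier M; a \<in> carrier A\<rbrakk> \<Longrightarrow> m \<triangleleft>\<^bsub>M\<^esub> a \<in> carrier M"
    and N_add: "\<lbrakk>n \<in> carrier N; n' \<in> carrier N\<rbrakk> \<Longrightarrow> n \<oplus>\<^bsub>N\<^esub> n' \<in> carrier N"
    and N_lact: "\<lbrakk>n \<in> carrier N; a \<in> carrier A\<rbrakk> \<Longrightarrow> a \<triangleright>\<^bsub>N\<^esub> n \<in> carrier N"
begin

definition balanced :: "('g, 'k) ring_scheme \<Rightarrow> ('b \<Rightarrow> 'c \<Rightarrow> 'g) \<Rightarrow> bool" where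
  "balanced G \<beta> \<longleftrightarrow> (\<forall>m\<in>carrier M. \<forall>n\<in>carrier N. \<beta> m n \<in> carrier G) \<and>
     (\<forall>m\<in>carrier M. \<forall>m'\<in>carrier M. \<forall>n\<in>carrier N. \<beta> (m \<oplus>\<^bsub>M\<^esub> m') n = \<beta> m n \<oplus>\<^bsub>G\<^esub> \<beta> m' n) \<and>
     (\<forall>m\<in>carrier M. \<forall>n\<in>carrier N. \<forall>n'\<in>carrier N. \<beta> m (n \<oplus>\<^bsub>N\<^esub> n') = \<beta> m n \<oplus>\<^bsub>G\<^esub> \<beta> m n') \<and>
     (\<forall>m\<in>carrier M. \<forall>a\<in>carrier A. \<forall>n\<in>carrier N. \<beta> (m \<triangleleft>\<^bsub>M\<^esub> a) n = \<beta> m (a \<triangleright>\<^bsub>N\<^esub> n))"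

lemma balancedI:
  assumes "\<And>m n. \<lbrakk>m \<in> carrier M; n \<in> carrier N\<rbrakk> \<Longrightarrow> \<beta> m n \<in> carrier G"
    "\<And>m m' n. \<lbrakk>m \<in> carrier M; m' \<in> carrier M; n \<in> carrier N\<rbrakk> \<Longrightarrow> \<beta> (m \<oplus>\<^bsub>M\<^esub> m') n = \<beta> m n \<oplus>\<^bsub>G\<^esub> \<beta> m' n"
    "\<And>m n n'. \<lbrakk>m \<in> carrier M; n \<in> carrier N; n' \<in> carrier N\<rbrakk> \<Longrightarrow> \<beta> m (n \<oplus>\<^bsub>N\<^esub> n') = \<beta> m n \<oplus>\<^bsub>G\<^esub> \<beta> m n'"
    "\<And>m a n. \<lbrakk>m \<in> carrier M; a \<in> carrier A; n \<in> carrier N\<rbrakk> \<Longrightarrow> \<beta> (m \<triangleleft>\<^bsub>M\<^esub> a) n = \<beta> m (a \<triangleright>\<^bsub>N\<^esub> n)"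
  shows "balanced G \<beta>"
  using assms by (simp add: balanced_def)

lemma balancedD:
  assumes "balanced G \<beta>"
  shows "\<lbrakk>m \<in> carrier M; n \<in> carrier N\<rbrakk> \<Longrightarrow> \<beta> m n \<in> carrier G"
    "\<lbrakk>m \<in> carrier M; m' \<in> carrier M; n \<in> carrier N\<rbrakk> \<Longrightarrow> \<beta> (m \<oplus>\<^bsub>M\<^esub> m') n = \<beta> m n \<oplus>\<^bsub>G\<^esub> \<beta> m' n"
    "\<lbrakk>m \<in> carrier M; n \<in> carrier N; n' \<in> carrier N\<rbrakk> \<Longrightarrow> \<beta> m (n \<oplus>\<^bsub>N\<^esub> n') = \<beta> m n \<oplus>\<^bsub>G\<^esub> \<beta> m n'"
    "\<lbrakk>m \<in> carrier M; a \<in> carrier A; n \<in> carrier N\<rbrakk> \<Longrightarrow> \<beta> (m \<triangleleft>\<^bsub>M\<^esub> a) n = \<beta> m (a \<triangleright>\<^bsub>N\<^esub> n)"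
  using assms by (simp_all add: balanced_def)

abbreviation "FG \<equiv> free_Abelian_group (carrier M \<times> carrier N)"
abbreviation "ker \<equiv> tensor_kernel A M N"
abbreviation "T \<equiv> tensor_group A M N"

lemma FG_mem:
  "\<lbrakk>p \<in> carrier FG; q \<in> carrier FG\<rbrakk> \<Longrightarrow> p - q \<in> carrier FG"
  "\<lbrakk>p \<in> carrier FG; q \<in> carrier FG\<rbrakk> \<Longrightarrow> p + q \<in> carrier FG"
  using keys_diff [of p q] keys_add [of p q] by auto

lemma frag_of_FG: "\<lbrakk>m \<in> carrier M; n \<in> carrier N\<rbrakk> \<Longrightarrow> frag_of (m, n) \<in> carrier FG"
  by simp

lemma relators_subset: "tensor_relators A M N \<subseteq> carrier FG"
  unfolding tensor_relators_def
  by (intro Un_least) (auto simp del: carrier_free_Abelian_group_iff intro!: FG_mem frag_of_FG M_add M_ract N_add N_lact)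

lemma ker_subgroup: "subgroup ker FG"
  unfolding tensor_kernel_def by (rule group.generate_is_subgroup [OF group_free_Abelian_group relators_subset])

lemma ker_normal: "ker \<lhd> FG"
proof -
  interpret FG: comm_group FG by (rule abelian_free_Abelian_group)
  show ?thesis using ker_subgroup by (simp add: FG.normal_iff_subgroup)
qed

lemma add_monoid_T: "add_monoid T = FG Mod ker"
  by (simp add: tensor_group_def FactGroup_def)

lemma abelian_group_T: "abelian_group T"
proof (rule abelian_group.intro)
  interpret FG: comm_group FG by (rule abelian_free_Abelian_group)
  have c: "comm_group (add_monoid T)"
    unfolding add_monoid_T by (rule FG.abelian_FactGroup [OF ker_subgroup])
  then show "abelian_monoid T" by (simp add: abelian_monoid_def comm_group_def)
  from c show "abelian_group_axioms T" by (simp add: abelian_group_axioms_def)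
qed

lemma coset_hom: "(\<lambda>p. ker #>\<^bsub>FG\<^esub> p) \<in> hom FG (add_monoid T)"
  unfolding add_monoid_T by (rule normal.r_coset_hom_Mod [OF ker_normal])

lemma T_cases:
  assumes "X \<in> carrier T"
  shows "\<exists>p\<in>carrier FG. X = ker #>\<^bsub>FG\<^esub> p"
proof -
  have "X \<in> carrier (add_monoid T)" using assms by simp
  then show ?thesis unfolding add_monoid_T by (auto simp: FactGroup_def RCOSETS_def)
qed

lemma pure_closed: "\<lbrakk>m \<in> carrier M; n \<in> carrier N\<rbrakk> \<Longrightarrow> pure_tensor A M N m n \<in> carrier T"
  unfolding pure_tensor_def using coset_hom frag_of_FG by (auto simp: hom_def simp del: carrier_free_Abelian_group_iff)

text \<open>The generators of the free group become the pure tensors, so additive maps are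
  determined there. Most identities between tensor expressions below are checked in this
  way.\<close>

lemma additive_ext:
  assumes G: "abelian_group G" and h: "h \<in> additive_maps T G" and k: "k \<in> additive_maps T G"
    and eq: "\<And>m n. \<lbrakk>m \<in> carrier M; n \<in> carrier N\<rbrakk> \<Longrightarrow> h (pure_tensor A M N m n) = k (pure_tensor A M N m n)"
    and X: "X \<in> carrier T"
  shows "h X = k X"
proof -
  obtain p where p: "p \<in> carrier FG" "X = ker #>\<^bsub>FG\<^esub> p" using T_cases [OF X] by (rule bexE)
  have hom: "(\<lambda>p. g (ker #>\<^bsub>FG\<^esub> p)) \<in> hom FG (add_monoid G)" if "g \<in> additive_maps T G" for g
    using hom_compose [OF coset_hom that] by (simp add: comp_def)
  have keys: "Poly_Mapping.keys p \<subseteq> carrier M \<times> carrier N" using p by simp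
  have "h X = lift_rep G (\<lambda>q. h (ker #>\<^bsub>FG\<^esub> frag_of q)) p"
    unfolding p(2) by (rule hom_free_Abelian_group_eq_lift_rep [OF G hom [OF h] keys])
  also have "\<dots> = lift_rep G (\<lambda>q. k (ker #>\<^bsub>FG\<^esub> frag_of q)) p"
  proof (rule lift_rep_cong [OF G keys])
    fix q assume "q \<in> carrier M \<times> carrier N"
    then obtain m n where q: "q = (m, n)" "m \<in> carrier M" "n \<in> carrier N" by blast
    show "h (ker #>\<^bsub>FG\<^esub> frag_of q) \<in> carrier G"
      using additiveD(1) [OF h pure_closed [OF q(2,3)]] by (simp add: q pure_tensor_def)
    show "h (ker #>\<^bsub>FG\<^esub> frag_of q) = k (ker #>\<^bsub>FG\<^esub> frag_of q)"
      using eq [OF q(2,3)] by (simp add: q pure_tensor_def)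
  qed
  also have "\<dots> = k X"
    unfolding p(2) by (rule hom_free_Abelian_group_eq_lift_rep [OF G hom [OF k] keys, symmetric])
  finally show ?thesis .
qed

text \<open>The universal property. Balancedness says that the extension \<open>h\<close> of
  \<open>\<beta>\<close> to the free group kills the relators; so it is constant on cosets, and
  \<open>the_elem\<close> in \<open>tensor_lift\<close> returns its value.\<close>

lemma tensor_lift_coset:
  assumes G: "abelian_group G" and \<beta>: "balanced G \<beta>"
  obtains h where "h \<in> hom FG (add_monoid G)"
    "\<And>m n. \<lbrakk>m \<in> carrier M; n \<in> carrier N\<rbrakk> \<Longrightarrow> h (frag_of (m, n)) = \<beta> m n"
    "\<And>p. p \<in> carrier FG \<Longrightarrow> tensor_lift G \<beta> (ker #>\<^bsub>FG\<^esub> p) = h p"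
    "\<And>p. p \<in> carrier FG \<Longrightarrow> h p = lift_rep G (case_prod \<beta>) p"
proof -
  interpret G: abelian_group G by fact
  interpret FG: comm_group FG by (rule abelian_free_Abelian_group)
  note \<beta>D = balancedD [OF \<beta>]
  have img: "case_prod \<beta> ` (carrier M \<times> carrier N) \<subseteq> carrier (add_monoid G)" using \<beta>D(1) by auto
  obtain h where h: "h \<in> hom FG (add_monoid G)"
    and hq: "\<And>q. q \<in> carrier M \<times> carrier N \<Longrightarrow> h (frag_of q) = case_prod \<beta> q"
    using comm_group.free_Abelian_group_universal [OF G.a_comm_group img] by metis
  have h\<beta>: "h (frag_of (m, n)) = \<beta> m n" if "m \<in> carrier M" "n \<in> carrier N" for m n
    using hq [of "(m, n)"] that by simp
  interpret h: group_hom FG "add_monoid G" h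
    using h G.a_group by (simp add: group_hom_def group_hom_axioms_def)
  have h_add: "h (p + q) = h p \<oplus>\<^bsub>G\<^esub> h q" if "p \<in> carrier FG" "q \<in> carrier FG" for p q
    using h.hom_mult [OF that] by simp
  have h_closed: "h p \<in> carrier G" if "p \<in> carrier FG" for p using h.hom_closed [OF that] by simp
  have h_diff: "h (p - q) = h p \<ominus>\<^bsub>G\<^esub> h q" if p: "p \<in> carrier FG" and q: "q \<in> carrier FG" for p q
  proof -
    have "h (p - q) \<oplus>\<^bsub>G\<^esub> h q = h p" using h_add [OF FG_mem(1) [OF p q] q] by simp
    then have "h p \<ominus>\<^bsub>G\<^esub> h q = h (p - q) \<oplus>\<^bsub>G\<^esub> h q \<ominus>\<^bsub>G\<^esub> h q" by simp
    also have "\<dots> = h (p - q)"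
      using h_closed [OF FG_mem(1) [OF p q]] h_closed [OF q] by (simp add: G.minus_eq G.a_assoc G.r_neg)
    finally show ?thesis by simp
  qed
  have rel3: "h (p - q) = \<zero>\<^bsub>G\<^esub>" if "p \<in> carrier FG" "q \<in> carrier FG" "h p = h q" for p q
    using that h_diff [OF that(1,2)] h_closed by (simp add: G.minus_eq G.r_neg)
  have rel2: "h (p - q - r) = \<zero>\<^bsub>G\<^esub>"
    if "p \<in> carrier FG" "q \<in> carrier FG" "r \<in> carrier FG" "h p = h q \<oplus>\<^bsub>G\<^esub> h r" for p q r
    using rel3 [of p "q + r"] h_add [OF that(2,3)] FG_mem(2) [OF that(2,3)] that(1,4)
    by (simp only: diff_diff_eq)
  have "tensor_relators A M N \<subseteq> kernel FG (add_monoid G) h"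
  proof
    fix t assume t: "t \<in> tensor_relators A M N"
    have "h t = \<zero>\<^bsub>G\<^esub>"
      using t unfolding tensor_relators_def
    proof (elim UnE CollectE exE conjE)
      fix m m' n assume eq: "t = frag_of (m \<oplus>\<^bsub>M\<^esub> m', n) - frag_of (m, n) - frag_of (m', n)"
        and mem: "m \<in> carrier M" "m' \<in> carrier M" "n \<in> carrier N"
      show "h t = \<zero>\<^bsub>G\<^esub>"
        unfolding eq by (intro rel2 frag_of_FG mem M_add) (simp add: h\<beta> mem M_add \<beta>D)
    next
      fix m n n' assume eq: "t = frag_of (m, n \<oplus>\<^bsub>N\<^esub> n') - frag_of (m, n) - frag_of (m, n')"
        and mem: "m \<in> carrier M" "n \<in> carrier N" "n' \<in> carrier N"
      show "h t = \<zero>\<^bsub>G\<^esub>"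
        unfolding eq by (intro rel2 frag_of_FG mem N_add) (simp add: h\<beta> mem N_add \<beta>D)
    next
      fix m a n assume eq: "t = frag_of (m \<triangleleft>\<^bsub>M\<^esub> a, n) - frag_of (m, a \<triangleright>\<^bsub>N\<^esub> n)"
        and mem: "m \<in> carrier M" "a \<in> carrier A" "n \<in> carrier N"
      show "h t = \<zero>\<^bsub>G\<^esub>"
        unfolding eq by (intro rel3 frag_of_FG mem M_ract N_lact) (simp add: h\<beta> mem M_ract N_lact \<beta>D)
    qed
    moreover have "t \<in> carrier FG" using t relators_subset by blast
    ultimately show "t \<in> kernel FG (add_monoid G) h" by (simp add: kernel_def)
  qed
  then have "ker \<subseteq> kernel FG (add_monoid G) h"
    unfolding tensor_kernel_def by (rule FG.generate_subgroup_incl [OF _ h.subgroup_kernel])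
  then have ker0: "t \<in> carrier FG" "h t = \<zero>\<^bsub>G\<^esub>" if "t \<in> ker" for t using that by (auto simp: kernel_def)
  have rep: "h p = lift_rep G (case_prod \<beta>) p" if p: "p \<in> carrier FG" for p
  proof -
    have keys: "Poly_Mapping.keys p \<subseteq> carrier M \<times> carrier N" using p by simp
    have "h p = lift_rep G (\<lambda>q. h (frag_of q)) p"
      by (rule hom_free_Abelian_group_eq_lift_rep [OF G h keys])
    also have "\<dots> = lift_rep G (case_prod \<beta>) p"
    proof (rule lift_rep_cong [OF G keys])
      fix q assume q: "q \<in> carrier M \<times> carrier N"
      then show "h (frag_of q) = case_prod \<beta> q" by (rule hq)
      show "h (frag_of q) \<in> carrier G" unfolding hq [OF q] using q \<beta>D(1) by auto
    qed
    finally show ?thesis .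
  qed
  have "tensor_lift G \<beta> (ker #>\<^bsub>FG\<^esub> p) = h p" if p: "p \<in> carrier FG" for p
  proof -
    have "lift_rep G (case_prod \<beta>) q = h p" if q: "q \<in> ker #>\<^bsub>FG\<^esub> p" for q
    proof -
      obtain t where t: "t \<in> ker" "q = t + p" using q by (auto simp: r_coset_def)
      have "lift_rep G (case_prod \<beta>) q = h q"
        unfolding t(2) by (rule rep [OF FG_mem(2) [OF ker0(1) [OF t(1)] p], symmetric])
      also have "\<dots> = h p" unfolding t(2) h_add [OF ker0(1) [OF t(1)] p] ker0(2) [OF t(1)]
        using h_closed [OF p] by simp
      finally show ?thesis .
    qed
    moreover have "p \<in> ker #>\<^bsub>FG\<^esub> p" by (rule FG.rcos_self [OF p ker_subgroup])
    ultimately have "lift_rep G (case_prod \<beta>) ` (ker #>\<^bsub>FG\<^esub> p) = {h p}" by (auto simp: image_iff)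
    then show ?thesis by (simp add: tensor_lift_eq)
  qed
  with h h\<beta> rep show thesis by (intro that)
qed

lemma tensor_lift_additive:
  assumes G: "abelian_group G" and \<beta>: "balanced G \<beta>"
  shows "tensor_lift G \<beta> \<in> additive_maps T G"
proof (rule tensor_lift_coset [OF assms])
  fix h assume h: "h \<in> hom FG (add_monoid G)"
    and eq: "\<And>p. p \<in> carrier FG \<Longrightarrow> tensor_lift G \<beta> (ker #>\<^bsub>FG\<^esub> p) = h p"
  have h': "h p \<in> carrier G" "h (p + q) = h p \<oplus>\<^bsub>G\<^esub> h q" if "p \<in> carrier FG" "q \<in> carrier FG" for p q
    using h that by (auto simp: hom_def)
  show ?thesis
  proof (rule additiveI)
    fix X assume "X \<in> carrier T"
    then obtain p where p: "p \<in> carrier FG" "X = ker #>\<^bsub>FG\<^esub> p" using T_cases by blast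
    then show "tensor_lift G \<beta> X \<in> carrier G" using eq h' by simp
    fix Y assume "Y \<in> carrier T"
    then obtain q where q: "q \<in> carrier FG" "Y = ker #>\<^bsub>FG\<^esub> q" using T_cases by blast
    have "X \<oplus>\<^bsub>T\<^esub> Y = ker #>\<^bsub>FG\<^esub> (p + q)"
      using hom_mult [OF coset_hom p(1) q(1)] p q by simp
    then show "tensor_lift G \<beta> (X \<oplus>\<^bsub>T\<^esub> Y) = tensor_lift G \<beta> X \<oplus>\<^bsub>G\<^esub> tensor_lift G \<beta> Y"
      using p q eq h'(2) [OF p(1) q(1)] FG_mem(2) [OF p(1) q(1)] by simp
  qed
qed

lemma tensor_lift_pure:
  assumes G: "abelian_group G" and \<beta>: "balanced G \<beta>" and "m \<in> carrier M" "n \<in> carrier N"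
  shows "tensor_lift G \<beta> (pure_tensor A M N m n) = \<beta> m n"
  by (rule tensor_lift_coset [OF G \<beta>]) (use assms frag_of_FG in \<open>simp add: pure_tensor_def\<close>)

text \<open>The order of quantifiers is the point: one \<open>p\<close> computes all balanced lifts
  into \<open>G\<close>, so the finitely many left legs of a tensor do not vary with the map. It is
  applied to \<open>\<Delta> z\<close>.\<close>

lemma tensor_lift_representative:
  assumes G: "abelian_group G" and X: "X \<in> carrier T"
  shows "\<exists>p. Poly_Mapping.keys p \<subseteq> carrier M \<times> carrier N \<and>
    (\<forall>\<beta>. balanced G \<beta> \<longrightarrow> tensor_lift G \<beta> X = lift_rep G (case_prod \<beta>) p)"
proof -
  obtain p where p: "p \<in> carrier FG" "X = ker #>\<^bsub>FG\<^esub> p" using T_cases [OF X] by (rule bexE)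
  have "tensor_lift G \<beta> X = lift_rep G (case_prod \<beta>) p" if "balanced G \<beta>" for \<beta>
    by (rule tensor_lift_coset [OF G that]) (use p in simp)
  with p(1) show ?thesis by auto
qed

lemma tensor_lift_cong:
  assumes G: "abelian_group G" and \<beta>: "balanced G \<beta>"
    and eq: "\<And>m n. \<lbrakk>m \<in> carrier M; n \<in> carrier N\<rbrakk> \<Longrightarrow> \<beta> m n = \<beta>' m n" and X: "X \<in> carrier T"
  shows "tensor_lift G \<beta> X = tensor_lift G \<beta>' X"
proof -
  have \<beta>': "balanced G \<beta>'"
    by (rule balancedI) (simp_all add: eq [symmetric] balancedD [OF \<beta>] M_add N_add M_ract N_lact)
  show ?thesis
    by (rule additive_ext [OF G tensor_lift_additive [OF G \<beta>] tensor_lift_additive [OF G \<beta>'] _ X])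
      (simp add: tensor_lift_pure [OF G \<beta>] tensor_lift_pure [OF G \<beta>'] eq)
qed

lemma balanced_comp: "balanced G \<beta> \<Longrightarrow> h \<in> additive_maps G H \<Longrightarrow> balanced H (\<lambda>m n. h (\<beta> m n))"
  by (rule balancedI) (simp_all add: balancedD additiveD)

lemma additive_tensor_lift:
  assumes G: "abelian_group G" and H: "abelian_group H" and \<beta>: "balanced G \<beta>"
    and h: "h \<in> additive_maps G H" and X: "X \<in> carrier T"
  shows "h (tensor_lift G \<beta> X) = tensor_lift H (\<lambda>m n. h (\<beta> m n)) X"
  by (rule additive_ext [OF H additive_comp [OF tensor_lift_additive [OF G \<beta>] h]
        tensor_lift_additive [OF H balanced_comp [OF \<beta> h]] _ X])
    (simp add: tensor_lift_pure [OF G \<beta>] tensor_lift_pure [OF H balanced_comp [OF \<beta> h]])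

lemma pure_balanced: "balanced T (pure_tensor A M N)"
proof -
  interpret FG: comm_group FG by (rule abelian_free_Abelian_group)
  have coset_eq: "ker #>\<^bsub>FG\<^esub> p = ker #>\<^bsub>FG\<^esub> q"
    if "p - q \<in> ker" "p \<in> carrier FG" "q \<in> carrier FG" for p q
  proof (rule FG.repr_independence [symmetric, OF _ _ ker_subgroup])
    show "p \<in> ker #>\<^bsub>FG\<^esub> q" using that by (auto simp: r_coset_def intro!: bexI [of _ "p - q"])
  qed (use that in simp)
  have coset_add: "(ker #>\<^bsub>FG\<^esub> p) \<oplus>\<^bsub>T\<^esub> (ker #>\<^bsub>FG\<^esub> q) = ker #>\<^bsub>FG\<^esub> (p + q)"
    if "p \<in> carrier FG" "q \<in> carrier FG" for p q
    using hom_mult [OF coset_hom that] by simp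
  have rel: "t \<in> tensor_relators A M N \<Longrightarrow> t \<in> ker" for t
    unfolding tensor_kernel_def by (rule generate.incl)
  show ?thesis
  proof (rule balancedI)
    fix m n assume m: "m \<in> carrier M" and n: "n \<in> carrier N"
    show "pure_tensor A M N m n \<in> carrier T" by (rule pure_closed [OF m n])
    show "pure_tensor A M N (m \<oplus>\<^bsub>M\<^esub> m') n = pure_tensor A M N m n \<oplus>\<^bsub>T\<^esub> pure_tensor A M N m' n"
      if m': "m' \<in> carrier M" for m'
      unfolding pure_tensor_def coset_add [OF frag_of_FG [OF m n] frag_of_FG [OF m' n]]
    proof (rule coset_eq)
      have "frag_of (m \<oplus>\<^bsub>M\<^esub> m', n) - frag_of (m, n) - frag_of (m', n) \<in> ker"
        using m m' n by (intro rel) (auto simp: tensor_relators_def)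
      then show "frag_of (m \<oplus>\<^bsub>M\<^esub> m', n) - (frag_of (m, n) + frag_of (m', n)) \<in> ker"
        by (simp add: diff_diff_eq)
    qed (intro frag_of_FG FG_mem M_add m m' n)+
    show "pure_tensor A M N m (n \<oplus>\<^bsub>N\<^esub> n') = pure_tensor A M N m n \<oplus>\<^bsub>T\<^esub> pure_tensor A M N m n'"
      if n': "n' \<in> carrier N" for n'
      unfolding pure_tensor_def coset_add [OF frag_of_FG [OF m n] frag_of_FG [OF m n']]
    proof (rule coset_eq)
      have "frag_of (m, n \<oplus>\<^bsub>N\<^esub> n') - frag_of (m, n) - frag_of (m, n') \<in> ker"
        using m n n' by (intro rel) (auto simp: tensor_relators_def)
      then show "frag_of (m, n \<oplus>\<^bsub>N\<^esub> n') - (frag_of (m, n) + frag_of (m, n')) \<in> ker"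
        by (simp add: diff_diff_eq)
    qed (intro frag_of_FG FG_mem N_add m n n')+
    show "pure_tensor A M N (m \<triangleleft>\<^bsub>M\<^esub> a) n = pure_tensor A M N m (a \<triangleright>\<^bsub>N\<^esub> n)" if a: "a \<in> carrier A" for a
      unfolding pure_tensor_def
    proof (rule coset_eq)
      show "frag_of (m \<triangleleft>\<^bsub>M\<^esub> a, n) - frag_of (m, a \<triangleright>\<^bsub>N\<^esub> n) \<in> ker"
        using m a n by (intro rel) (auto simp: tensor_relators_def)
    qed (intro frag_of_FG M_ract N_lact m a n)+
  qed
qed

lemma tensor_bimodule_simps:
  "carrier (tensor_bimodule A M N) = carrier T"
  "X \<oplus>\<^bsub>tensor_bimodule A M N\<^esub> Y = X \<oplus>\<^bsub>T\<^esub> Y"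
  "a \<triangleright>\<^bsub>tensor_bimodule A M N\<^esub> X = tensor_lift T (\<lambda>m n. pure_tensor A M N (a \<triangleright>\<^bsub>M\<^esub> m) n) X"
  "X \<triangleleft>\<^bsub>tensor_bimodule A M N\<^esub> a = tensor_lift T (\<lambda>m n. pure_tensor A M N m (n \<triangleleft>\<^bsub>N\<^esub> a)) X"
  by (simp_all add: tensor_bimodule_def Let_def)

end

section \<open>The right action of the left dual on a coring\<close>

context coring
begin

lemma ring_A: "ring A" and abelian_C: "abelian_group \<C>"
  using bimodule_axioms by (simp_all add: bimodule_def)

lemma abelian_A: "abelian_group A"
  using ring_A by (simp add: ring_def)

sublocale CC: tensor_factors A \<C> \<C>
  by unfold_locales simp_all

abbreviation "TT \<equiv> tensor_group A \<C> \<C>"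
abbreviation "TB \<equiv> tensor_bimodule A \<C> \<C>"
abbreviation pt :: "'c \<Rightarrow> 'c \<Rightarrow> ('c, 'c) tensor" where "pt \<equiv> pure_tensor A \<C> \<C>"

lemmas pt_balanced = CC.balancedD [OF CC.pure_balanced]

lemma lact_balanced: "a \<in> carrier A \<Longrightarrow> CC.balanced TT (\<lambda>m n. pt (a \<triangleright>\<^bsub>\<C>\<^esub> m) n)"
  by (rule CC.balancedI) (simp_all add: pt_balanced lact_add flip: lact_ract)

lemma ract_balanced: "a \<in> carrier A \<Longrightarrow> CC.balanced TT (\<lambda>m n. pt m (n \<triangleleft>\<^bsub>\<C>\<^esub> a))"
  by (rule CC.balancedI) (simp_all add: pt_balanced ract_add lact_ract)

lemma TB_lact_additive: "a \<in> carrier A \<Longrightarrow> (\<lambda>X. a \<triangleright>\<^bsub>TB\<^esub> X) \<in> additive_maps TT TT"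
  unfolding CC.tensor_bimodule_simps
  using CC.tensor_lift_additive [OF CC.abelian_group_T lact_balanced] by simp

lemma TB_ract_additive: "a \<in> carrier A \<Longrightarrow> (\<lambda>X. X \<triangleleft>\<^bsub>TB\<^esub> a) \<in> additive_maps TT TT"
  unfolding CC.tensor_bimodule_simps
  using CC.tensor_lift_additive [OF CC.abelian_group_T ract_balanced] by simp

lemma TB_lact_pure:
  "\<lbrakk>a \<in> carrier A; m \<in> carrier \<C>; n \<in> carrier \<C>\<rbrakk> \<Longrightarrow> a \<triangleright>\<^bsub>TB\<^esub> pt m n = pt (a \<triangleright>\<^bsub>\<C>\<^esub> m) n"
  unfolding CC.tensor_bimodule_simps
  by (rule CC.tensor_lift_pure [OF CC.abelian_group_T lact_balanced])

lemma TB_ract_pure: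
  "\<lbrakk>a \<in> carrier A; m \<in> carrier \<C>; n \<in> carrier \<C>\<rbrakk> \<Longrightarrow> pt m n \<triangleleft>\<^bsub>TB\<^esub> a = pt m (n \<triangleleft>\<^bsub>\<C>\<^esub> a)"
  unfolding CC.tensor_bimodule_simps
  by (rule CC.tensor_lift_pure [OF CC.abelian_group_T ract_balanced])

lemma TB_add_closed: "\<lbrakk>X \<in> carrier TT; Y \<in> carrier TT\<rbrakk> \<Longrightarrow> X \<oplus>\<^bsub>TT\<^esub> Y \<in> carrier TT"
  using abelian_group.axioms(1) [OF CC.abelian_group_T] by (rule abelian_monoid.a_closed)

text \<open>\<open>TC\<close> and \<open>CT\<close> are the two bracketings of the triple tensor
  product, with the square on the left and on the right; coassociativity compares them.\<close>

sublocale TC: tensor_factors A TB \<C>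
  by unfold_locales
    (simp_all add: CC.tensor_bimodule_simps(1,2) TB_add_closed additiveD(1) [OF TB_ract_additive])

sublocale CT: tensor_factors A \<C> TB
  by unfold_locales
    (simp_all add: CC.tensor_bimodule_simps(1,2) TB_add_closed additiveD(1) [OF TB_lact_additive])

lemma \<Delta>_simps:
  "c \<in> carrier \<C> \<Longrightarrow> \<Delta> c \<in> carrier TT"
  "\<lbrakk>c \<in> carrier \<C>; d \<in> carrier \<C>\<rbrakk> \<Longrightarrow> \<Delta> (c \<oplus>\<^bsub>\<C>\<^esub> d) = \<Delta> c \<oplus>\<^bsub>TT\<^esub> \<Delta> d"
  "\<lbrakk>c \<in> carrier \<C>; a \<in> carrier A\<rbrakk> \<Longrightarrow> \<Delta> (a \<triangleright>\<^bsub>\<C>\<^esub> c) = a \<triangleright>\<^bsub>TB\<^esub> \<Delta> c"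
  "\<lbrakk>c \<in> carrier \<C>; a \<in> carrier A\<rbrakk> \<Longrightarrow> \<Delta> (c \<triangleleft>\<^bsub>\<C>\<^esub> a) = \<Delta> c \<triangleleft>\<^bsub>TB\<^esub> a"
  using comult_bimodule_map
  by (auto simp: bimodule_maps_def left_linear_maps_def CC.tensor_bimodule_simps(1,2))

text \<open>Left linear forms without extensionality, so that \<open>\<epsilon>\<close> and v
  \<mapsto> \<open>\<theta>' v d\<close> are members as they stand; \<open>restrict_D\<close> moves
  them into the left dual.\<close>

abbreviation LM :: "('c \<Rightarrow> 'a) set" where
  "LM \<equiv> left_linear_maps A \<C> (regular_bimodule A)"

lemma LM_simps:
  assumes "f \<in> LM"
  shows "c \<in> carrier \<C> \<Longrightarrow> f c \<in> carrier A"
    "\<lbrakk>c \<in> carrier \<C>; d \<in> carrier \<C>\<rbrakk> \<Longrightarrow> f (c \<oplus>\<^bsub>\<C>\<^esub> d) = f c \<oplus>\<^bsub>A\<^esub> f d"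
    "\<lbrakk>c \<in> carrier \<C>; a \<in> carrier A\<rbrakk> \<Longrightarrow> f (a \<triangleright>\<^bsub>\<C>\<^esub> c) = a \<otimes>\<^bsub>A\<^esub> f c"
  using assms by (auto simp: left_linear_maps_def regular_bimodule_def)

lemma LMI:
  assumes "\<And>c. c \<in> carrier \<C> \<Longrightarrow> f c \<in> carrier A"
    "\<And>c d. \<lbrakk>c \<in> carrier \<C>; d \<in> carrier \<C>\<rbrakk> \<Longrightarrow> f (c \<oplus>\<^bsub>\<C>\<^esub> d) = f c \<oplus>\<^bsub>A\<^esub> f d"
    "\<And>c a. \<lbrakk>c \<in> carrier \<C>; a \<in> carrier A\<rbrakk> \<Longrightarrow> f (a \<triangleright>\<^bsub>\<C>\<^esub> c) = a \<otimes>\<^bsub>A\<^esub> f c"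
  shows "f \<in> LM"
  using assms by (simp add: left_linear_maps_def regular_bimodule_def)

lemma LM_additive: "f \<in> LM \<Longrightarrow> f \<in> additive_maps \<C> A"
  by (rule additiveI) (simp_all add: LM_simps)

lemma \<epsilon>_LM: "\<epsilon> \<in> LM"
  and \<epsilon>_ract: "\<lbrakk>c \<in> carrier \<C>; a \<in> carrier A\<rbrakk> \<Longrightarrow> \<epsilon> (c \<triangleleft>\<^bsub>\<C>\<^esub> a) = \<epsilon> c \<otimes>\<^bsub>A\<^esub> a"
  using counit_bimodule_map by (auto simp: bimodule_maps_def regular_bimodule_def)

lemmas \<epsilon>_simps = LM_simps [OF \<epsilon>_LM] \<epsilon>_ract

lemma LM_ract: "f \<in> LM \<Longrightarrow> a \<in> carrier A \<Longrightarrow> (\<lambda>c. f (c \<triangleleft>\<^bsub>\<C>\<^esub> a)) \<in> LM"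
  by (rule LMI) (simp_all add: LM_simps ract_add lact_ract)

definition LF :: "('c \<Rightarrow> 'a) \<Rightarrow> ('c, 'c) tensor \<Rightarrow> 'c" where
  "LF f = tensor_lift \<C> (\<lambda>u v. u \<triangleleft>\<^bsub>\<C>\<^esub> f v)"

text \<open>The right action \<open>c\<^sub>1 f(c\<^sub>2)\<close> of the left dual on
  \<open>\<C>\<close>. The product of the dual is \<open>g(c \<bullet> f)\<close>, so its
  associativity is the module law \<open>act_act\<close>.\<close>

definition act :: "'c \<Rightarrow> ('c \<Rightarrow> 'a) \<Rightarrow> 'c" (infixl \<open>\<bullet>\<close> 70) where
  "c \<bullet> f = LF f (\<Delta> c)"

lemma LF_balanced: "f \<in> LM \<Longrightarrow> CC.balanced \<C> (\<lambda>u v. u \<triangleleft>\<^bsub>\<C>\<^esub> f v)"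
  by (rule CC.balancedI) (simp_all add: LM_simps ract_add ract_add_ring ract_mult)

lemma LF_additive: "f \<in> LM \<Longrightarrow> LF f \<in> additive_maps TT \<C>"
  unfolding LF_def by (rule CC.tensor_lift_additive [OF abelian_C LF_balanced])

lemma LF_pure: "\<lbrakk>f \<in> LM; m \<in> carrier \<C>; n \<in> carrier \<C>\<rbrakk> \<Longrightarrow> LF f (pt m n) = m \<triangleleft>\<^bsub>\<C>\<^esub> f n"
  unfolding LF_def by (rule CC.tensor_lift_pure [OF abelian_C LF_balanced])

lemma lact_additive: "a \<in> carrier A \<Longrightarrow> (\<lambda>c. a \<triangleright>\<^bsub>\<C>\<^esub> c) \<in> additive_maps \<C> \<C>"
  by (rule additiveI) (simp_all add: lact_add)

lemma LF_lact:
  assumes f: "f \<in> LM" and a: "a \<in> carrier A" and X: "X \<in> carrier TT"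
  shows "LF f (a \<triangleright>\<^bsub>TB\<^esub> X) = a \<triangleright>\<^bsub>\<C>\<^esub> LF f X"
  by (rule CC.additive_ext [OF abelian_C additive_comp [OF TB_lact_additive [OF a] LF_additive [OF f]]
        additive_comp [OF LF_additive [OF f] lact_additive [OF a]] _ X])
    (simp add: TB_lact_pure LF_pure f a LM_simps(1) lact_ract)

lemma LF_ract:
  assumes f: "f \<in> LM" and a: "a \<in> carrier A" and X: "X \<in> carrier TT"
  shows "LF f (X \<triangleleft>\<^bsub>TB\<^esub> a) = LF (\<lambda>v. f (v \<triangleleft>\<^bsub>\<C>\<^esub> a)) X"
  by (rule CC.additive_ext [OF abelian_C additive_comp [OF TB_ract_additive [OF a] LF_additive [OF f]]
        LF_additive [OF LM_ract [OF f a]] _ X])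
    (simp add: TB_ract_pure LF_pure f a LM_ract)

lemma act_closed [simp]: "f \<in> LM \<Longrightarrow> c \<in> carrier \<C> \<Longrightarrow> c \<bullet> f \<in> carrier \<C>"
  unfolding act_def by (rule additiveD(1) [OF LF_additive]) (simp_all add: \<Delta>_simps)

lemma act_add:
  "\<lbrakk>f \<in> LM; c \<in> carrier \<C>; d \<in> carrier \<C>\<rbrakk> \<Longrightarrow> (c \<oplus>\<^bsub>\<C>\<^esub> d) \<bullet> f = c \<bullet> f \<oplus>\<^bsub>\<C>\<^esub> d \<bullet> f"
  unfolding act_def by (simp add: \<Delta>_simps additiveD(2) [OF LF_additive])

lemma act_lact:
  "\<lbrakk>f \<in> LM; c \<in> carrier \<C>; a \<in> carrier A\<rbrakk> \<Longrightarrow> (a \<triangleright>\<^bsub>\<C>\<^esub> c) \<bullet> f = a \<triangleright>\<^bsub>\<C>\<^esub> (c \<bullet> f)"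
  unfolding act_def by (simp add: \<Delta>_simps LF_lact)

lemma act_ract:
  "\<lbrakk>f \<in> LM; c \<in> carrier \<C>; a \<in> carrier A\<rbrakk> \<Longrightarrow> (c \<triangleleft>\<^bsub>\<C>\<^esub> a) \<bullet> f = c \<bullet> (\<lambda>v. f (v \<triangleleft>\<^bsub>\<C>\<^esub> a))"
  unfolding act_def by (simp add: \<Delta>_simps LF_ract)

lemma LF_cong:
  assumes "f \<in> LM" "\<And>v. v \<in> carrier \<C> \<Longrightarrow> f v = g v" "X \<in> carrier TT"
  shows "LF f X = LF g X"
  unfolding LF_def by (rule CC.tensor_lift_cong [OF abelian_C LF_balanced]) (simp_all add: assms)

lemma act_cong:
  assumes "f \<in> LM" "\<And>v. v \<in> carrier \<C> \<Longrightarrow> f v = g v" "c \<in> carrier \<C>"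
  shows "c \<bullet> f = c \<bullet> g"
  unfolding act_def by (rule LF_cong) (simp_all add: assms \<Delta>_simps)

lemma act_\<epsilon>: "c \<in> carrier \<C> \<Longrightarrow> c \<bullet> \<epsilon> = c"
  unfolding act_def LF_def by (rule right_counital)

text \<open>\<open>\<epsilon>(c\<^sub>1 f(c\<^sub>2)) = \<epsilon>(c\<^sub>1) f(c\<^sub>2) =
  f(\<epsilon>(c\<^sub>1) c\<^sub>2)\<close>, and the left counit law ends the computation. Hence
  \<open>\<epsilon>\<close> is a right unit of the dual.\<close>

lemma \<epsilon>_act:
  assumes f: "f \<in> LM" and c: "c \<in> carrier \<C>"
  shows "\<epsilon> (c \<bullet> f) = f c"
proof -
  have bal: "CC.balanced \<C> (\<lambda>u v. \<epsilon> u \<triangleright>\<^bsub>\<C>\<^esub> v)"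
    by (rule CC.balancedI) (simp_all add: \<epsilon>_simps lact_add lact_add_ring lact_mult)
  note \<Delta>c = \<Delta>_simps(1) [OF c]
  note \<epsilon>_add = LM_additive [OF \<epsilon>_LM] and f_add = LM_additive [OF f]
  have "\<epsilon> (c \<bullet> f) = tensor_lift A (\<lambda>u v. \<epsilon> (u \<triangleleft>\<^bsub>\<C>\<^esub> f v)) (\<Delta> c)"
    unfolding act_def LF_def
    by (rule CC.additive_tensor_lift [OF abelian_C abelian_A LF_balanced [OF f] \<epsilon>_add \<Delta>c])
  also have "\<dots> = tensor_lift A (\<lambda>u v. f (\<epsilon> u \<triangleright>\<^bsub>\<C>\<^esub> v)) (\<Delta> c)"
    by (rule CC.tensor_lift_cong [OF abelian_A CC.balanced_comp [OF LF_balanced [OF f] \<epsilon>_add] _ \<Delta>c])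
      (simp add: LM_simps [OF f] \<epsilon>_simps)
  also have "\<dots> = f (tensor_lift \<C> (\<lambda>u v. \<epsilon> u \<triangleright>\<^bsub>\<C>\<^esub> v) (\<Delta> c))"
    by (rule CC.additive_tensor_lift [OF abelian_C abelian_A bal f_add \<Delta>c, symmetric])
  also have "\<dots> = f c" using left_counital [OF c] by simp
  finally show ?thesis .
qed

lemma act_LM: "f \<in> LM \<Longrightarrow> g \<in> LM \<Longrightarrow> (\<lambda>c. g (c \<bullet> f)) \<in> LM"
  by (rule LMI) (simp_all add: LM_simps act_add act_lact)

text \<open>Both sides are the image of the iterated coproduct of \<open>c\<close> under
  \<open>u \<otimes> v \<otimes> w \<mapsto> u g(v f(w))\<close>.\<close>

lemma act_act:
  assumes f: "f \<in> LM" and g: "g \<in> LM" and c: "c \<in> carrier \<C>"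
  shows "(c \<bullet> f) \<bullet> g = c \<bullet> (\<lambda>v. g (v \<bullet> f))"
proof -
  note f_simps = LM_simps [OF f] and g_simps = LM_simps [OF g]
  note \<Delta>c = \<Delta>_simps(1) [OF c]
  note TBs = CC.tensor_bimodule_simps(1,2)
  define gf where "gf w = (\<lambda>v. g (v \<triangleleft>\<^bsub>\<C>\<^esub> f w))" for w
  have gf: "gf w \<in> LM" if "w \<in> carrier \<C>" for w
    unfolding gf_def using that by (intro LM_ract g f_simps)
  \<comment> \<open>The evaluation on the left bracketing. For fixed \<open>w\<close> it is
    \<open>LF\<close> of the left linear form \<open>gf w\<close>, which gives additivity in the
    tensor \<open>X\<close>.\<close>
  define \<Gamma> where "\<Gamma> = (\<lambda>X w. LF (gf w) X)"
  have \<Gamma>_pure: "\<Gamma> (pt u v) w = u \<triangleleft>\<^bsub>\<C>\<^esub> g (v \<triangleleft>\<^bsub>\<C>\<^esub> f w)"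
    if "u \<in> carrier \<C>" "v \<in> carrier \<C>" "w \<in> carrier \<C>" for u v w
    using LF_pure [OF gf [OF that(3)] that(1,2)] by (simp add: \<Gamma>_def gf_def)
  have \<Gamma>_add: "(\<lambda>X. \<Gamma> X w) \<in> additive_maps TT \<C>" if "w \<in> carrier \<C>" for w
    unfolding \<Gamma>_def using LF_additive [OF gf [OF that]] by simp
  have bal_\<Gamma>: "TC.balanced \<C> \<Gamma>"
  proof (rule TC.balancedI; simp only: TBs)
    fix X w assume X: "X \<in> carrier TT" and w: "w \<in> carrier \<C>"
    show "\<Gamma> X w \<in> carrier \<C>" by (rule additiveD(1) [OF \<Gamma>_add [OF w] X])
    show "\<Gamma> (X \<oplus>\<^bsub>TT\<^esub> Y) w = \<Gamma> X w \<oplus>\<^bsub>\<C>\<^esub> \<Gamma> Y w" if "Y \<in> carrier TT" for Y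
      by (rule additiveD(2) [OF \<Gamma>_add [OF w] X that])
    show "\<Gamma> X (w \<oplus>\<^bsub>\<C>\<^esub> w') = \<Gamma> X w \<oplus>\<^bsub>\<C>\<^esub> \<Gamma> X w'" if w': "w' \<in> carrier \<C>" for w'
    proof (rule CC.additive_ext [OF abelian_C \<Gamma>_add _ _ X])
      show "(\<lambda>X. \<Gamma> X w \<oplus>\<^bsub>\<C>\<^esub> \<Gamma> X w') \<in> additive_maps TT \<C>"
        using additiveD [OF \<Gamma>_add [OF w]] additiveD [OF \<Gamma>_add [OF w']]
        by (intro additiveI) (simp_all add: M.a_ac)
    qed (use w w' in \<open>simp_all add: \<Gamma>_pure f_simps g_simps ract_add_ring\<close>)
    show "\<Gamma> (X \<triangleleft>\<^bsub>TB\<^esub> a) w = \<Gamma> X (a \<triangleright>\<^bsub>\<C>\<^esub> w)" if a: "a \<in> carrier A" for a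
      by (rule CC.additive_ext [OF abelian_C additive_comp [OF TB_ract_additive [OF a] \<Gamma>_add [OF w]]
            \<Gamma>_add _ X])
        (use w a in \<open>simp_all add: TB_ract_pure \<Gamma>_pure f_simps ract_mult\<close>)
  qed

  have h_add: "(\<lambda>y. y \<bullet> g) \<in> additive_maps \<C> \<C>"
    by (rule additiveI) (simp_all add: g act_add)
  have "(c \<bullet> f) \<bullet> g = tensor_lift \<C> (\<lambda>u w. (u \<triangleleft>\<^bsub>\<C>\<^esub> f w) \<bullet> g) (\<Delta> c)"
    unfolding act_def [of c f] LF_def [of f]
    by (rule CC.additive_tensor_lift [OF abelian_C abelian_C LF_balanced [OF f] h_add \<Delta>c])
  also have "\<dots> = tensor_lift \<C> (\<lambda>u w. \<Gamma> (\<Delta> u) w) (\<Delta> c)"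
  proof (rule CC.tensor_lift_cong [OF abelian_C CC.balanced_comp [OF LF_balanced [OF f] h_add] _ \<Delta>c])
    fix u w assume "u \<in> carrier \<C>" "w \<in> carrier \<C>"
    then show "(u \<triangleleft>\<^bsub>\<C>\<^esub> f w) \<bullet> g = \<Gamma> (\<Delta> u) w"
      by (simp add: act_ract g f_simps) (simp add: act_def \<Gamma>_def gf_def)
  qed
  finally have 1: "(c \<bullet> f) \<bullet> g = tensor_lift \<C> (\<lambda>u w. \<Gamma> (\<Delta> u) w) (\<Delta> c)" .

  have bal_\<Delta>id: "CC.balanced TC.T (\<lambda>u w. pure_tensor A TB \<C> (\<Delta> u) (id w))"
    using TC.balancedD [OF TC.pure_balanced, unfolded TBs]
    by (intro CC.balancedI) (simp_all add: \<Delta>_simps)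
  have 2: "tensor_lift \<C> \<Gamma> (tensor_map A TB \<C> \<Delta> id (\<Delta> c)) = tensor_lift \<C> (\<lambda>u w. \<Gamma> (\<Delta> u) w) (\<Delta> c)"
  proof -
    have lift_add: "tensor_lift \<C> \<Gamma> \<in> additive_maps TC.T \<C>"
      by (rule TC.tensor_lift_additive [OF abelian_C bal_\<Gamma>])
    have "tensor_lift \<C> \<Gamma> (tensor_map A TB \<C> \<Delta> id (\<Delta> c)) =
        tensor_lift \<C> (\<lambda>u w. tensor_lift \<C> \<Gamma> (pure_tensor A TB \<C> (\<Delta> u) (id w))) (\<Delta> c)"
      unfolding tensor_map_def
      by (rule CC.additive_tensor_lift [OF TC.abelian_group_T abelian_C bal_\<Delta>id lift_add \<Delta>c])
    also have "\<dots> = tensor_lift \<C> (\<lambda>u w. \<Gamma> (\<Delta> u) w) (\<Delta> c)"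
      by (rule CC.tensor_lift_cong [OF abelian_C CC.balanced_comp [OF bal_\<Delta>id lift_add] _ \<Delta>c])
        (simp add: TC.tensor_lift_pure [OF abelian_C bal_\<Gamma>] TBs \<Delta>_simps)
    finally show ?thesis .
  qed

  \<comment> \<open>The same evaluation on the right bracketing: \<open>LF f\<close> contracts the
    last two factors, then \<open>g\<close> is applied.\<close>
  define \<Gamma>' where "\<Gamma>' = (\<lambda>u Y. u \<triangleleft>\<^bsub>\<C>\<^esub> g (LF f Y))"
  have LFc: "LF f Y \<in> carrier \<C>" if "Y \<in> carrier TT" for Y by (rule additiveD(1) [OF LF_additive [OF f] that])
  have bal_\<Gamma>': "CT.balanced \<C> \<Gamma>'"
    by (rule CT.balancedI; simp only: TBs)
      (simp_all add: \<Gamma>'_def LFc g_simps additiveD(2) [OF LF_additive [OF f]] LF_lact f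
        ract_add ract_add_ring ract_mult)

  \<comment> \<open>For fixed \<open>w\<close>, the inner lift in \<open>tensor_assoc\<close>. It
    lets \<open>\<Gamma>'\<close> after the associator be compared with \<open>\<Gamma>\<close> on
    iterated pure tensors.\<close>
  define \<alpha> where "\<alpha> w = tensor_lift CT.T (\<lambda>u v. pure_tensor A \<C> TB u (pt v w))" for w
  note ctD = CT.balancedD [OF CT.pure_balanced, unfolded TBs]
  have bal_\<alpha>1: "CC.balanced CT.T (\<lambda>u v. pure_tensor A \<C> TB u (pt v w))" if w: "w \<in> carrier \<C>" for w
    by (rule CC.balancedI) (simp_all add: w ctD pt_balanced(1,2) TB_lact_pure)
  have \<alpha>_add: "\<alpha> w \<in> additive_maps TT CT.T" if "w \<in> carrier \<C>" for w
    unfolding \<alpha>_def by (rule CC.tensor_lift_additive [OF CT.abelian_group_T bal_\<alpha>1 [OF that]])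
  have \<alpha>_pure: "\<alpha> w (pt u v) = pure_tensor A \<C> TB u (pt v w)"
    if "u \<in> carrier \<C>" "v \<in> carrier \<C>" "w \<in> carrier \<C>" for u v w
    unfolding \<alpha>_def by (rule CC.tensor_lift_pure [OF CT.abelian_group_T bal_\<alpha>1 [OF that(3)] that(1,2)])
  interpret CTg: abelian_group CT.T by (rule CT.abelian_group_T)
  have bal_\<alpha>: "TC.balanced CT.T (\<lambda>X w. \<alpha> w X)"
  proof (rule TC.balancedI; simp only: TBs)
    fix X w assume X: "X \<in> carrier TT" and w: "w \<in> carrier \<C>"
    show "\<alpha> w X \<in> carrier CT.T" by (rule additiveD(1) [OF \<alpha>_add [OF w] X])
    show "\<alpha> w (X \<oplus>\<^bsub>TT\<^esub> Y) = \<alpha> w X \<oplus>\<^bsub>CT.T\<^esub> \<alpha> w Y" if "Y \<in> carrier TT" for Y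
      by (rule additiveD(2) [OF \<alpha>_add [OF w] X that])
    show "\<alpha> (w \<oplus>\<^bsub>\<C>\<^esub> w') X = \<alpha> w X \<oplus>\<^bsub>CT.T\<^esub> \<alpha> w' X" if w': "w' \<in> carrier \<C>" for w'
    proof (rule CC.additive_ext [OF CT.abelian_group_T \<alpha>_add _ _ X])
      show "(\<lambda>X. \<alpha> w X \<oplus>\<^bsub>CT.T\<^esub> \<alpha> w' X) \<in> additive_maps TT CT.T"
        using additiveD [OF \<alpha>_add [OF w]] additiveD [OF \<alpha>_add [OF w']]
        by (intro additiveI) (simp_all add: CTg.a_ac)
    qed (use w w' in \<open>simp_all add: \<alpha>_pure pt_balanced(1,3) ctD\<close>)
    show "\<alpha> w (X \<triangleleft>\<^bsub>TB\<^esub> a) = \<alpha> (a \<triangleright>\<^bsub>\<C>\<^esub> w) X" if a: "a \<in> carrier A" for a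
      by (rule CC.additive_ext [OF CT.abelian_group_T additive_comp [OF TB_ract_additive [OF a] \<alpha>_add [OF w]]
            \<alpha>_add _ X])
        (use w a in \<open>simp_all add: TB_ract_pure \<alpha>_pure pt_balanced\<close>)
  qed
  have assoc: "tensor_assoc A \<C> \<C> \<C> = tensor_lift CT.T (\<lambda>X w. \<alpha> w X)"
    by (simp add: tensor_assoc_def Let_def \<alpha>_def)
  have 3: "tensor_lift \<C> \<Gamma>' (tensor_assoc A \<C> \<C> \<C> Z) = tensor_lift \<C> \<Gamma> Z" if Z: "Z \<in> carrier TC.T" for Z
    unfolding assoc
  proof (rule TC.additive_ext [OF abelian_C additive_comp [OF TC.tensor_lift_additive [OF CT.abelian_group_T bal_\<alpha>]
          CT.tensor_lift_additive [OF abelian_C bal_\<Gamma>']] TC.tensor_lift_additive [OF abelian_C bal_\<Gamma>] _ Z];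
      simp only: TBs)
    fix X w assume X: "X \<in> carrier TT" and w: "w \<in> carrier \<C>"
    have X': "X \<in> carrier TB" using X by (simp add: TBs)
    have "tensor_lift \<C> \<Gamma>' (\<alpha> w X) = \<Gamma> X w"
    proof (rule CC.additive_ext [OF abelian_C additive_comp [OF \<alpha>_add [OF w]
            CT.tensor_lift_additive [OF abelian_C bal_\<Gamma>']] \<Gamma>_add [OF w] _ X])
      fix u v assume uv: "u \<in> carrier \<C>" "v \<in> carrier \<C>"
      have "pt v w \<in> carrier TB" using uv w by (simp add: TBs pt_balanced)
      then show "tensor_lift \<C> \<Gamma>' (\<alpha> w (pt u v)) = \<Gamma> (pt u v) w"
        using uv w CT.tensor_lift_pure [OF abelian_C bal_\<Gamma>' uv(1), of "pt v w"]
        by (simp add: \<alpha>_pure \<Gamma>_pure) (simp add: \<Gamma>'_def LF_pure f)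
    qed
    then show "tensor_lift \<C> \<Gamma>' (tensor_lift CT.T (\<lambda>X w. \<alpha> w X) (pure_tensor A TB \<C> X w)) =
        tensor_lift \<C> \<Gamma> (pure_tensor A TB \<C> X w)"
      by (simp only: TC.tensor_lift_pure [OF CT.abelian_group_T bal_\<alpha> X' w]
          TC.tensor_lift_pure [OF abelian_C bal_\<Gamma> X' w])
  qed

  have bal_id\<Delta>: "CC.balanced CT.T (\<lambda>u w. pure_tensor A \<C> TB (id u) (\<Delta> w))"
    by (intro CC.balancedI) (simp_all add: \<Delta>_simps ctD)
  have lift_add: "tensor_lift \<C> \<Gamma>' \<in> additive_maps CT.T \<C>"
    by (rule CT.tensor_lift_additive [OF abelian_C bal_\<Gamma>'])
  have "tensor_lift \<C> \<Gamma>' (tensor_map A \<C> TB id \<Delta> (\<Delta> c)) =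
      tensor_lift \<C> (\<lambda>u w. tensor_lift \<C> \<Gamma>' (pure_tensor A \<C> TB (id u) (\<Delta> w))) (\<Delta> c)"
    unfolding tensor_map_def
    by (rule CC.additive_tensor_lift [OF CT.abelian_group_T abelian_C bal_id\<Delta> lift_add \<Delta>c])
  also have "\<dots> = tensor_lift \<C> (\<lambda>u w. u \<triangleleft>\<^bsub>\<C>\<^esub> g (w \<bullet> f)) (\<Delta> c)"
    by (rule CC.tensor_lift_cong [OF abelian_C CC.balanced_comp [OF bal_id\<Delta> lift_add] _ \<Delta>c])
      (simp add: CT.tensor_lift_pure [OF abelian_C bal_\<Gamma>'] TBs \<Delta>_simps, simp add: \<Gamma>'_def act_def)
  also have "\<dots> = c \<bullet> (\<lambda>v. g (v \<bullet> f))" by (simp add: act_def LF_def)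
  finally have 4: "tensor_lift \<C> \<Gamma>' (tensor_map A \<C> TB id \<Delta> (\<Delta> c)) = c \<bullet> (\<lambda>v. g (v \<bullet> f))" .

  have Zc: "tensor_map A TB \<C> \<Delta> id (\<Delta> c) \<in> carrier TC.T"
    unfolding tensor_map_def
    by (rule additiveD(1) [OF CC.tensor_lift_additive [OF TC.abelian_group_T bal_\<Delta>id] \<Delta>c])
  show ?thesis
    using 1 2 3 [OF Zc] 4 coassociative [OF c] by simp
qed

end

section \<open>The left dual ring\<close>

lemma (in right_module) sub_lift_rep:
  assumes N: "sub N" and b: "\<And>q. q \<in> Poly_Mapping.keys p \<Longrightarrow> b q \<in> N"
  shows "lift_rep M b p \<in> N"
proof -
  have N_carr: "y \<in> carrier M" if "y \<in> N" for y using that rsubmoduleD(1) [OF N] by blast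
  have subg: "subgroup N (add_monoid M)"
  proof (rule M.add.subgroupI)
    show "N \<noteq> {}" using rsubmoduleD(2) [OF N] by blast
  qed (use rsubmoduleD(1,3) [OF N] sub_uminus [OF N] in simp_all)
  have pow: "add_pow M (k::int) y \<in> N" if "y \<in> N" for k y
    unfolding add_pow_def by (rule group.subgroup_int_pow_closed [OF M.a_group subg that])
  have "(\<Oplus>\<^bsub>M\<^esub>q\<in>J. add_pow M (Poly_Mapping.lookup p q) (b q)) \<in> N"
    if "finite J" "J \<subseteq> Poly_Mapping.keys p" for J
    using that
  proof (induction J rule: finite_induct)
    case empty
    then show ?case using rsubmoduleD(2) [OF N] by simp
  next
    case (insert q J)
    have terms: "add_pow M (Poly_Mapping.lookup p r) (b r) \<in> N" if "r \<in> insert q J" for r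
      using that insert.prems b by (intro pow) blast
    have "(\<Oplus>\<^bsub>M\<^esub>r\<in>insert q J. add_pow M (Poly_Mapping.lookup p r) (b r)) =
        add_pow M (Poly_Mapping.lookup p q) (b q) \<oplus>\<^bsub>M\<^esub> (\<Oplus>\<^bsub>M\<^esub>r\<in>J. add_pow M (Poly_Mapping.lookup p r) (b r))"
      using insert.hyps N_carr [OF terms] by (intro M.finsum_insert) auto
    then show ?case using rsubmoduleD(3) [OF N terms [of q]] insert by simp
  qed
  then show ?thesis unfolding lift_rep_def by simp
qed

context coring
begin

abbreviation "D \<equiv> left_dual A \<C> \<Delta> \<epsilon>"

lemma D_simps:
  "f \<in> carrier D \<longleftrightarrow> f \<in> LM \<and> f \<in> extensional (carrier \<C>)"
  "f \<otimes>\<^bsub>D\<^esub> g = (\<lambda>c\<in>carrier \<C>. g (c \<bullet> f))"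
  "\<one>\<^bsub>D\<^esub> = restrict \<epsilon> (carrier \<C>)"
  "\<zero>\<^bsub>D\<^esub> = (\<lambda>c\<in>carrier \<C>. \<zero>\<^bsub>A\<^esub>)"
  "f \<oplus>\<^bsub>D\<^esub> g = (\<lambda>c\<in>carrier \<C>. f c \<oplus>\<^bsub>A\<^esub> g c)"
  by (auto simp: left_dual_def act_def LF_def)

lemma D_mult_apply: "c \<in> carrier \<C> \<Longrightarrow> (f \<otimes>\<^bsub>D\<^esub> g) c = g (c \<bullet> f)"
  by (simp add: D_simps(2))

lemma restrict_D:
  assumes "f \<in> LM"
  shows "restrict f (carrier \<C>) \<in> carrier D"
proof -
  have "restrict f (carrier \<C>) \<in> LM" by (rule LMI) (simp_all add: LM_simps assms)
  then show ?thesis by (simp add: D_simps(1))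
qed

lemma D_eqI:
  assumes "f \<in> carrier D" "g \<in> carrier D" "\<And>c. c \<in> carrier \<C> \<Longrightarrow> f c = g c"
  shows "f = g"
  using assms by (auto simp: D_simps(1) intro: extensionalityI)

lemma D_mult_closed: "\<lbrakk>f \<in> carrier D; g \<in> carrier D\<rbrakk> \<Longrightarrow> f \<otimes>\<^bsub>D\<^esub> g \<in> carrier D"
  unfolding D_simps(2) by (rule restrict_D [OF act_LM]) (simp_all add: D_simps(1))

lemma D_add_closed: "\<lbrakk>f \<in> carrier D; g \<in> carrier D\<rbrakk> \<Longrightarrow> f \<oplus>\<^bsub>D\<^esub> g \<in> carrier D"
  unfolding D_simps(5)
  by (rule restrict_D, rule LMI) (simp_all add: D_simps(1) LM_simps R.a_ac R.r_distr)

lemma D_zero_closed: "\<zero>\<^bsub>D\<^esub> \<in> carrier D"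
  unfolding D_simps(4) by (rule restrict_D, rule LMI) simp_all

lemma D_uminus_closed: "f \<in> carrier D \<Longrightarrow> (\<lambda>c\<in>carrier \<C>. \<ominus>\<^bsub>A\<^esub> f c) \<in> carrier D"
  by (rule restrict_D, rule LMI) (simp_all add: D_simps(1) LM_simps R.minus_add R.r_minus R.a_comm)

lemma act_D_mult:
  assumes f: "f \<in> carrier D" and g: "g \<in> carrier D" and c: "c \<in> carrier \<C>"
  shows "c \<bullet> (f \<otimes>\<^bsub>D\<^esub> g) = (c \<bullet> f) \<bullet> g"
proof -
  have LM: "f \<in> LM" "g \<in> LM" using f g by (simp_all add: D_simps(1))
  have "c \<bullet> (\<lambda>v. g (v \<bullet> f)) = c \<bullet> (f \<otimes>\<^bsub>D\<^esub> g)"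
    by (rule act_cong [OF act_LM [OF LM] _ c]) (simp add: D_simps(2))
  then show ?thesis using act_act [OF LM c] by simp
qed

lemma act_D_add:
  assumes f: "f \<in> carrier D" and g: "g \<in> carrier D" and c: "c \<in> carrier \<C>"
  shows "c \<bullet> (f \<oplus>\<^bsub>D\<^esub> g) = c \<bullet> f \<oplus>\<^bsub>\<C>\<^esub> c \<bullet> g"
proof -
  have LM: "f \<in> LM" "g \<in> LM" "f \<oplus>\<^bsub>D\<^esub> g \<in> LM"
    using f g D_add_closed [OF f g] by (simp_all add: D_simps(1))
  have sum: "(\<lambda>X. LF f X \<oplus>\<^bsub>\<C>\<^esub> LF g X) \<in> additive_maps TT \<C>"
    using additiveD [OF LF_additive [OF LM(1)]] additiveD [OF LF_additive [OF LM(2)]]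
    by (intro additiveI) (simp_all add: M.a_ac)
  show ?thesis
    unfolding act_def
    by (rule CC.additive_ext [OF abelian_C LF_additive [OF LM(3)] sum _ \<Delta>_simps(1) [OF c]])
      (simp add: LF_pure LM, simp add: D_simps(5) ract_add_ring LM LM_simps(1))
qed

lemma ring_D: "ring D"
proof (intro ringI abelian_groupI monoidI)
  note closed = D_mult_closed D_add_closed D_zero_closed restrict_D [OF \<epsilon>_LM, folded D_simps(3)]
  show "\<zero>\<^bsub>D\<^esub> \<in> carrier D" "\<one>\<^bsub>D\<^esub> \<in> carrier D" by (fact closed)+
  fix f assume f: "f \<in> carrier D"
  then have fLM: "f \<in> LM" and f_ext: "f \<in> extensional (carrier \<C>)" by (simp_all add: D_simps(1))
  show "\<zero>\<^bsub>D\<^esub> \<oplus>\<^bsub>D\<^esub> f = f"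
    by (rule D_eqI) (use f fLM in \<open>simp_all add: closed, simp add: D_simps LM_simps\<close>)
  show "\<one>\<^bsub>D\<^esub> \<otimes>\<^bsub>D\<^esub> f = f"
  proof (rule D_eqI)
    fix c assume c: "c \<in> carrier \<C>"
    have "c \<bullet> \<epsilon> = c \<bullet> \<one>\<^bsub>D\<^esub>" by (rule act_cong [OF \<epsilon>_LM _ c]) (simp add: D_simps(3))
    then show "(\<one>\<^bsub>D\<^esub> \<otimes>\<^bsub>D\<^esub> f) c = f c" using c by (simp add: D_mult_apply act_\<epsilon>)
  qed (use f closed in simp_all)
  show "f \<otimes>\<^bsub>D\<^esub> \<one>\<^bsub>D\<^esub> = f"
    by (rule D_eqI) (use f fLM in \<open>simp_all add: closed, simp add: D_simps(2,3) \<epsilon>_act\<close>)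
  show "\<exists>g\<in>carrier D. g \<oplus>\<^bsub>D\<^esub> f = \<zero>\<^bsub>D\<^esub>"
    by (rule bexI [OF _ D_uminus_closed [OF f]])
      (simp add: D_simps(4,5) LM_simps [OF fLM] R.l_neg cong: restrict_cong)
  fix g assume g: "g \<in> carrier D"
  then have gLM: "g \<in> LM" by (simp add: D_simps(1))
  show "f \<oplus>\<^bsub>D\<^esub> g \<in> carrier D" "f \<otimes>\<^bsub>D\<^esub> g \<in> carrier D" using f g closed by simp_all
  show "f \<oplus>\<^bsub>D\<^esub> g = g \<oplus>\<^bsub>D\<^esub> f"
    by (simp add: D_simps(5) LM_simps [OF fLM] LM_simps [OF gLM] R.a_comm cong: restrict_cong)
  fix h assume h: "h \<in> carrier D"
  then have hLM: "h \<in> LM" by (simp add: D_simps(1))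
  show "f \<oplus>\<^bsub>D\<^esub> g \<oplus>\<^bsub>D\<^esub> h = f \<oplus>\<^bsub>D\<^esub> (g \<oplus>\<^bsub>D\<^esub> h)"
    by (simp add: D_simps(5) LM_simps [OF fLM] LM_simps [OF gLM] LM_simps [OF hLM] R.a_assoc cong: restrict_cong)
  show "f \<otimes>\<^bsub>D\<^esub> g \<otimes>\<^bsub>D\<^esub> h = f \<otimes>\<^bsub>D\<^esub> (g \<otimes>\<^bsub>D\<^esub> h)"
  proof (rule D_eqI)
    fix c assume c: "c \<in> carrier \<C>"
    then show "(f \<otimes>\<^bsub>D\<^esub> g \<otimes>\<^bsub>D\<^esub> h) c = (f \<otimes>\<^bsub>D\<^esub> (g \<otimes>\<^bsub>D\<^esub> h)) c"
      using act_D_mult [OF f g c] fLM by (simp add: D_mult_apply)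
  qed (use f g h closed in simp_all)
  show "(f \<oplus>\<^bsub>D\<^esub> g) \<otimes>\<^bsub>D\<^esub> h = f \<otimes>\<^bsub>D\<^esub> h \<oplus>\<^bsub>D\<^esub> g \<otimes>\<^bsub>D\<^esub> h"
  proof (rule D_eqI)
    fix c assume c: "c \<in> carrier \<C>"
    then show "((f \<oplus>\<^bsub>D\<^esub> g) \<otimes>\<^bsub>D\<^esub> h) c = (f \<otimes>\<^bsub>D\<^esub> h \<oplus>\<^bsub>D\<^esub> g \<otimes>\<^bsub>D\<^esub> h) c"
      using act_D_add [OF f g c] fLM gLM
      by (simp add: D_mult_apply D_simps(5) [of "f \<otimes>\<^bsub>D\<^esub> h"] LM_simps [OF hLM])
  qed (use f g h closed in simp_all)
  show "h \<otimes>\<^bsub>D\<^esub> (f \<oplus>\<^bsub>D\<^esub> g) = h \<otimes>\<^bsub>D\<^esub> f \<oplus>\<^bsub>D\<^esub> h \<otimes>\<^bsub>D\<^esub> g"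
    by (rule D_eqI) (use f g h hLM in \<open>simp_all add: closed, simp add: D_simps(2,5)\<close>)
qed

text \<open>The canonical ring map from \<open>A\<close> to the left dual. By
  \<open>\<epsilon>_act\<close>, right multiplication by \<open>j a\<close> multiplies values by
  \<open>a\<close>, see \<open>D_mult_j\<close>.\<close>

definition j :: "'a \<Rightarrow> 'c \<Rightarrow> 'a" where
  "j a = (\<lambda>c\<in>carrier \<C>. \<epsilon> c \<otimes>\<^bsub>A\<^esub> a)"

lemma LM_mult_right: "f \<in> LM \<Longrightarrow> a \<in> carrier A \<Longrightarrow> (\<lambda>c. f c \<otimes>\<^bsub>A\<^esub> a) \<in> LM"
  by (rule LMI) (simp_all add: LM_simps R.l_distr R.m_assoc)

lemma j_D: "a \<in> carrier A \<Longrightarrow> j a \<in> carrier D"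
  unfolding j_def by (rule restrict_D [OF LM_mult_right [OF \<epsilon>_LM]])

lemma D_mult_j:
  assumes f: "f \<in> carrier D" and a: "a \<in> carrier A"
  shows "f \<otimes>\<^bsub>D\<^esub> j a = (\<lambda>c\<in>carrier \<C>. f c \<otimes>\<^bsub>A\<^esub> a)"
  using f a by (simp add: D_simps(1,2) j_def \<epsilon>_act cong: restrict_cong)

lemma j_ring_hom: "j \<in> ring_hom A D"
proof (rule ring_hom_memI)
  fix a b assume a: "a \<in> carrier A" and b: "b \<in> carrier A"
  show "j a \<in> carrier D" by (rule j_D [OF a])
  show "j (a \<otimes>\<^bsub>A\<^esub> b) = j a \<otimes>\<^bsub>D\<^esub> j b"
    unfolding D_mult_j [OF j_D [OF a] b]
    using a b by (simp add: j_def \<epsilon>_simps(1) R.m_assoc cong: restrict_cong)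
  show "j (a \<oplus>\<^bsub>A\<^esub> b) = j a \<oplus>\<^bsub>D\<^esub> j b"
    using a b by (simp add: j_def D_simps(5) \<epsilon>_simps(1) R.r_distr cong: restrict_cong)
next
  show "j \<one>\<^bsub>A\<^esub> = \<one>\<^bsub>D\<^esub>"
    by (simp add: j_def D_simps(3) \<epsilon>_simps(1) cong: restrict_cong)
qed

end

section \<open>Frobenius corings with a grouplike element of trace one\<close>

locale frobenius_coring = coring A \<C> \<Delta> \<epsilon>
  for A :: "('a, 'm) ring_scheme" and \<C> :: "('a, 'c) bimodule"
    and \<Delta> :: "'c \<Rightarrow> ('c, 'c) tensor" and \<epsilon> :: "'c \<Rightarrow> 'a" +
  fixes x z :: 'c and \<theta> :: "('c, 'c) tensor \<Rightarrow> 'a" and a\<^sub>0 :: 'a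
  assumes grouplike: "grouplike A \<C> \<Delta> \<epsilon> x"
    and frobenius: "frobenius_system A \<C> \<Delta> \<epsilon> \<theta> z"
    and a\<^sub>0: "a\<^sub>0 \<in> carrier A" and trace_one: "\<theta> (pure_tensor A \<C> \<C> (x \<triangleleft>\<^bsub>\<C>\<^esub> a\<^sub>0) x) = \<one>\<^bsub>A\<^esub>"
begin

section \<open>The Frobenius form and the trace\<close>

definition \<theta>' :: "'c \<Rightarrow> 'c \<Rightarrow> 'a" where "\<theta>' c d = \<theta> (pt c d)"

lemma x: "x \<in> carrier \<C>" "\<Delta> x = pt x x" "\<epsilon> x = \<one>\<^bsub>A\<^esub>"
  using grouplike by (simp_all add: grouplike_def)

lemma z: "z \<in> carrier \<C>"
  "c \<in> carrier \<C> \<Longrightarrow> \<theta>' z c = \<epsilon> c" "c \<in> carrier \<C> \<Longrightarrow> \<theta>' c z = \<epsilon> c"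
  using frobenius by (simp_all add: frobenius_system_def \<theta>'_def)

lemma \<theta>_map: "\<theta> \<in> bimodule_maps A TB (regular_bimodule A)"
  using frobenius by (simp add: frobenius_system_def)

lemma \<theta>_simps:
  "X \<in> carrier TT \<Longrightarrow> \<theta> X \<in> carrier A"
  "\<lbrakk>X \<in> carrier TT; Y \<in> carrier TT\<rbrakk> \<Longrightarrow> \<theta> (X \<oplus>\<^bsub>TT\<^esub> Y) = \<theta> X \<oplus>\<^bsub>A\<^esub> \<theta> Y"
  "\<lbrakk>X \<in> carrier TT; a \<in> carrier A\<rbrakk> \<Longrightarrow> \<theta> (a \<triangleright>\<^bsub>TB\<^esub> X) = a \<otimes>\<^bsub>A\<^esub> \<theta> X"
  "\<lbrakk>X \<in> carrier TT; a \<in> carrier A\<rbrakk> \<Longrightarrow> \<theta> (X \<triangleleft>\<^bsub>TB\<^esub> a) = \<theta> X \<otimes>\<^bsub>A\<^esub> a"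
  using \<theta>_map
  by (auto simp: bimodule_maps_def left_linear_maps_def regular_bimodule_def CC.tensor_bimodule_simps(1,2))

lemma \<theta>'_simps:
  "\<lbrakk>c \<in> carrier \<C>; d \<in> carrier \<C>\<rbrakk> \<Longrightarrow> \<theta>' c d \<in> carrier A"
  "\<lbrakk>c \<in> carrier \<C>; c' \<in> carrier \<C>; d \<in> carrier \<C>\<rbrakk> \<Longrightarrow> \<theta>' (c \<oplus>\<^bsub>\<C>\<^esub> c') d = \<theta>' c d \<oplus>\<^bsub>A\<^esub> \<theta>' c' d"
  "\<lbrakk>c \<in> carrier \<C>; d \<in> carrier \<C>; d' \<in> carrier \<C>\<rbrakk> \<Longrightarrow> \<theta>' c (d \<oplus>\<^bsub>\<C>\<^esub> d') = \<theta>' c d \<oplus>\<^bsub>A\<^esub> \<theta>' c d'"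
  "\<lbrakk>c \<in> carrier \<C>; d \<in> carrier \<C>; a \<in> carrier A\<rbrakk> \<Longrightarrow> \<theta>' (c \<triangleleft>\<^bsub>\<C>\<^esub> a) d = \<theta>' c (a \<triangleright>\<^bsub>\<C>\<^esub> d)"
  "\<lbrakk>c \<in> carrier \<C>; d \<in> carrier \<C>; a \<in> carrier A\<rbrakk> \<Longrightarrow> \<theta>' (a \<triangleright>\<^bsub>\<C>\<^esub> c) d = a \<otimes>\<^bsub>A\<^esub> \<theta>' c d"
  "\<lbrakk>c \<in> carrier \<C>; d \<in> carrier \<C>; a \<in> carrier A\<rbrakk> \<Longrightarrow> \<theta>' c (d \<triangleleft>\<^bsub>\<C>\<^esub> a) = \<theta>' c d \<otimes>\<^bsub>A\<^esub> a"
  by (simp_all add: \<theta>'_def pt_balanced \<theta>_simps flip: TB_lact_pure TB_ract_pure)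

lemma \<theta>'_LM: "d \<in> carrier \<C> \<Longrightarrow> (\<lambda>c. \<theta>' c d) \<in> LM"
  by (rule LMI) (simp_all add: \<theta>'_simps)

lemma \<theta>'_balanced: "c \<in> carrier \<C> \<Longrightarrow> CC.balanced \<C> (\<lambda>u v. \<theta>' c u \<triangleright>\<^bsub>\<C>\<^esub> v)"
  by (rule CC.balancedI) (simp_all add: \<theta>'_simps lact_add lact_add_ring lact_mult)

lemma frobenius_act:
  "\<lbrakk>c \<in> carrier \<C>; d \<in> carrier \<C>\<rbrakk> \<Longrightarrow>
    c \<bullet> (\<lambda>v. \<theta>' v d) = tensor_lift \<C> (\<lambda>u v. \<theta>' c u \<triangleright>\<^bsub>\<C>\<^esub> v) (\<Delta> d)"
  using frobenius by (simp add: frobenius_system_def \<theta>'_def act_def LF_def)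

text \<open>At \<open>c = z\<close> the right side of the Frobenius identity is \<open>\<theta>(z
  \<otimes> d\<^sub>1) d\<^sub>2 = \<epsilon>(d\<^sub>1) d\<^sub>2\<close>, which is
  \<open>d\<close> by the counit law.\<close>

lemma z_act: "d \<in> carrier \<C> \<Longrightarrow> z \<bullet> (\<lambda>v. \<theta>' v d) = d"
proof -
  assume d: "d \<in> carrier \<C>"
  have "z \<bullet> (\<lambda>v. \<theta>' v d) = tensor_lift \<C> (\<lambda>u v. \<theta>' z u \<triangleright>\<^bsub>\<C>\<^esub> v) (\<Delta> d)"
    by (rule frobenius_act [OF z(1) d])
  also have "\<dots> = tensor_lift \<C> (\<lambda>u v. \<epsilon> u \<triangleright>\<^bsub>\<C>\<^esub> v) (\<Delta> d)"
    by (rule CC.tensor_lift_cong [OF abelian_C \<theta>'_balanced [OF z(1)] _ \<Delta>_simps(1) [OF d]]) (simp add: z)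
  also have "\<dots> = d" by (rule left_counital [OF d])
  finally show ?thesis .
qed

text \<open>Applying \<open>f\<close> to \<open>\<theta>(c \<otimes> d\<^sub>1) d\<^sub>2\<close>
  gives \<open>\<theta>(c \<otimes> d\<^sub>1 f(d\<^sub>2))\<close>. This is an adjointness: the
  form \<open>f\<close> becomes an action on the second argument of \<open>\<theta>\<close>.\<close>

lemma LM_frobenius_act:
  assumes f: "f \<in> LM" and c: "c \<in> carrier \<C>" and d: "d \<in> carrier \<C>"
  shows "f (c \<bullet> (\<lambda>v. \<theta>' v d)) = \<theta>' c (d \<bullet> f)"
proof -
  note \<Delta>d = \<Delta>_simps(1) [OF d]
  have \<theta>_add: "(\<lambda>u. \<theta>' c u) \<in> additive_maps \<C> A"
    by (rule additiveI) (simp_all add: \<theta>'_simps c)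
  have "f (c \<bullet> (\<lambda>v. \<theta>' v d)) = tensor_lift A (\<lambda>u v. f (\<theta>' c u \<triangleright>\<^bsub>\<C>\<^esub> v)) (\<Delta> d)"
    unfolding frobenius_act [OF c d]
    by (rule CC.additive_tensor_lift [OF abelian_C abelian_A \<theta>'_balanced [OF c] LM_additive [OF f] \<Delta>d])
  also have "\<dots> = tensor_lift A (\<lambda>u v. \<theta>' c (u \<triangleleft>\<^bsub>\<C>\<^esub> f v)) (\<Delta> d)"
    by (rule CC.tensor_lift_cong [OF abelian_A
          CC.balanced_comp [OF \<theta>'_balanced [OF c] LM_additive [OF f]] _ \<Delta>d])
      (simp add: \<theta>'_simps LM_simps f c)
  also have "\<dots> = \<theta>' c (d \<bullet> f)"
    unfolding act_def LF_def
    by (rule CC.additive_tensor_lift [OF abelian_C abelian_A LF_balanced [OF f] \<theta>_add \<Delta>d, symmetric])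
  finally show ?thesis .
qed

text \<open>The adjointness at \<open>d = z\<close>, where \<open>\<theta>(- \<otimes> z)\<close> is
  \<open>\<epsilon>\<close>. So d \<mapsto> \<open>\<theta>(- \<otimes> d)\<close> reaches every
  form, with f \<mapsto> \<open>z \<bullet> f\<close> as a section.\<close>

lemma LM_eq_\<theta>':
  assumes f: "f \<in> LM" and c: "c \<in> carrier \<C>"
  shows "f c = \<theta>' c (z \<bullet> f)"
proof -
  have "c \<bullet> (\<lambda>v. \<theta>' v z) = c \<bullet> \<epsilon>"
    by (rule act_cong [OF \<theta>'_LM [OF z(1)] _ c]) (simp add: z)
  then show ?thesis
    using LM_frobenius_act [OF f c z(1)] act_\<epsilon> [OF c] by simp
qed

text \<open>Grouplikeness gives \<open>\<Delta>(x y) = x \<otimes> x y\<close>, so the action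
  preserves \<open>x A\<close>, a copy of \<open>A\<close> because
  \<open>\<epsilon>(x y) = y\<close>.\<close>

lemma x_act:
  assumes f: "f \<in> LM" and y: "y \<in> carrier A"
  shows "(x \<triangleleft>\<^bsub>\<C>\<^esub> y) \<bullet> f = x \<triangleleft>\<^bsub>\<C>\<^esub> f (x \<triangleleft>\<^bsub>\<C>\<^esub> y)"
  unfolding act_def using f y x by (simp add: \<Delta>_simps TB_ract_pure LF_pure)

lemma act_\<theta>'_x:
  assumes c: "c \<in> carrier \<C>"
  shows "c \<bullet> (\<lambda>v. \<theta>' v x) = \<theta>' c x \<triangleright>\<^bsub>\<C>\<^esub> x"
  unfolding frobenius_act [OF c x(1)] x(2)
  by (rule CC.tensor_lift_pure [OF abelian_C \<theta>'_balanced [OF c] x(1) x(1)])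

abbreviation "B \<equiv> {a \<in> carrier A. a \<triangleright>\<^bsub>\<C>\<^esub> x = x \<triangleleft>\<^bsub>\<C>\<^esub> a}"

definition tr :: "'a \<Rightarrow> 'a" where "tr y = \<theta>' (x \<triangleleft>\<^bsub>\<C>\<^esub> y) x"

lemma uminus_acts:
  assumes a: "a \<in> carrier A" and c: "c \<in> carrier \<C>"
  shows "(\<ominus>\<^bsub>A\<^esub> a) \<triangleright>\<^bsub>\<C>\<^esub> c = \<ominus>\<^bsub>\<C>\<^esub> (a \<triangleright>\<^bsub>\<C>\<^esub> c)" "c \<triangleleft>\<^bsub>\<C>\<^esub> (\<ominus>\<^bsub>A\<^esub> a) = \<ominus>\<^bsub>\<C>\<^esub> (c \<triangleleft>\<^bsub>\<C>\<^esub> a)"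
    "c \<triangleleft>\<^bsub>\<C>\<^esub> \<zero>\<^bsub>A\<^esub> = \<zero>\<^bsub>\<C>\<^esub>"
proof -
  have "\<zero>\<^bsub>A\<^esub> \<triangleright>\<^bsub>\<C>\<^esub> c \<oplus>\<^bsub>\<C>\<^esub> \<zero>\<^bsub>A\<^esub> \<triangleright>\<^bsub>\<C>\<^esub> c = \<zero>\<^bsub>A\<^esub> \<triangleright>\<^bsub>\<C>\<^esub> c"
    using c by (simp flip: lact_add_ring)
  then have l0: "\<zero>\<^bsub>A\<^esub> \<triangleright>\<^bsub>\<C>\<^esub> c = \<zero>\<^bsub>\<C>\<^esub>" using c by simp
  have "c \<triangleleft>\<^bsub>\<C>\<^esub> \<zero>\<^bsub>A\<^esub> \<oplus>\<^bsub>\<C>\<^esub> c \<triangleleft>\<^bsub>\<C>\<^esub> \<zero>\<^bsub>A\<^esub> = c \<triangleleft>\<^bsub>\<C>\<^esub> \<zero>\<^bsub>A\<^esub>"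
    using c by (simp flip: ract_add_ring)
  then show r0: "c \<triangleleft>\<^bsub>\<C>\<^esub> \<zero>\<^bsub>A\<^esub> = \<zero>\<^bsub>\<C>\<^esub>" using c by simp
  have "(\<ominus>\<^bsub>A\<^esub> a) \<triangleright>\<^bsub>\<C>\<^esub> c \<oplus>\<^bsub>\<C>\<^esub> a \<triangleright>\<^bsub>\<C>\<^esub> c = \<zero>\<^bsub>\<C>\<^esub>"
    using a c l0 by (simp add: R.l_neg flip: lact_add_ring)
  from M.minus_equality [OF this] show "(\<ominus>\<^bsub>A\<^esub> a) \<triangleright>\<^bsub>\<C>\<^esub> c = \<ominus>\<^bsub>\<C>\<^esub> (a \<triangleright>\<^bsub>\<C>\<^esub> c)" using a c by simp
  have "c \<triangleleft>\<^bsub>\<C>\<^esub> (\<ominus>\<^bsub>A\<^esub> a) \<oplus>\<^bsub>\<C>\<^esub> c \<triangleleft>\<^bsub>\<C>\<^esub> a = \<zero>\<^bsub>\<C>\<^esub>"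
    using a c r0 by (simp add: R.l_neg flip: ract_add_ring)
  from M.minus_equality [OF this] show "c \<triangleleft>\<^bsub>\<C>\<^esub> (\<ominus>\<^bsub>A\<^esub> a) = \<ominus>\<^bsub>\<C>\<^esub> (c \<triangleleft>\<^bsub>\<C>\<^esub> a)" using a c by simp
qed

lemma subring_B: "subring B A"
proof (rule R.subringI)
  show "h1 \<otimes>\<^bsub>A\<^esub> h2 \<in> B" if "h1 \<in> B" "h2 \<in> B" for h1 h2
  proof -
    have h: "h1 \<in> carrier A" "h2 \<in> carrier A"
      and hx: "h1 \<triangleright>\<^bsub>\<C>\<^esub> x = x \<triangleleft>\<^bsub>\<C>\<^esub> h1" "h2 \<triangleright>\<^bsub>\<C>\<^esub> x = x \<triangleleft>\<^bsub>\<C>\<^esub> h2"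
      using that by simp_all
    have "(h1 \<otimes>\<^bsub>A\<^esub> h2) \<triangleright>\<^bsub>\<C>\<^esub> x = (h1 \<triangleright>\<^bsub>\<C>\<^esub> x) \<triangleleft>\<^bsub>\<C>\<^esub> h2"
      using h x by (simp add: lact_mult hx(2) lact_ract)
    also have "\<dots> = x \<triangleleft>\<^bsub>\<C>\<^esub> (h1 \<otimes>\<^bsub>A\<^esub> h2)"
      unfolding hx(1) using h x by (simp add: ract_mult)
    finally show ?thesis using h by simp
  qed
qed (use x in \<open>auto simp: uminus_acts lact_add_ring ract_add_ring\<close>)

sublocale trace_subring A B tr a\<^sub>0
proof (intro trace_subring.intro trace_subring_axioms.intro ring_A)
  show "subring B A" by (rule subring_B)
  show "a\<^sub>0 \<in> carrier A" by (rule a\<^sub>0)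
  show "tr a\<^sub>0 = \<one>\<^bsub>A\<^esub>" using trace_one by (simp add: tr_def \<theta>'_def)
  fix y assume y: "y \<in> carrier A"
  \<comment> \<open>The element \<open>(x y) \<bullet> \<theta>(- \<otimes> x)\<close> is computed
    twice: grouplikeness gives \<open>x (tr y)\<close>, the Frobenius identity gives
    \<open>(tr y) x\<close>. Equality is coinvariance of \<open>tr y\<close>.\<close>
  have "x \<triangleleft>\<^bsub>\<C>\<^esub> tr y = (x \<triangleleft>\<^bsub>\<C>\<^esub> y) \<bullet> (\<lambda>v. \<theta>' v x)"
    using x_act [OF \<theta>'_LM [OF x(1)] y] by (simp add: tr_def)
  also have "\<dots> = tr y \<triangleright>\<^bsub>\<C>\<^esub> x" using act_\<theta>'_x [of "x \<triangleleft>\<^bsub>\<C>\<^esub> y"] x y by (simp add: tr_def)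
  finally show "tr y \<in> B" using x y by (simp add: tr_def \<theta>'_simps)
  show "tr (y \<oplus>\<^bsub>A\<^esub> y') = tr y \<oplus>\<^bsub>A\<^esub> tr y'" if "y' \<in> carrier A" for y'
    using that y x by (simp add: tr_def ract_add_ring \<theta>'_simps)
  fix b assume b: "b \<in> B"
  then have bc: "b \<in> carrier A" and bx: "b \<triangleright>\<^bsub>\<C>\<^esub> x = x \<triangleleft>\<^bsub>\<C>\<^esub> b" by simp_all
  have "tr (y \<otimes>\<^bsub>A\<^esub> b) = \<theta>' (x \<triangleleft>\<^bsub>\<C>\<^esub> y) (x \<triangleleft>\<^bsub>\<C>\<^esub> b)"
    using y bc x by (simp add: tr_def ract_mult \<theta>'_simps(4) flip: bx)
  then show "tr (y \<otimes>\<^bsub>A\<^esub> b) = tr y \<otimes>\<^bsub>A\<^esub> b"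
    using y bc x by (simp add: tr_def \<theta>'_simps(6))
  have "x \<triangleleft>\<^bsub>\<C>\<^esub> (b \<otimes>\<^bsub>A\<^esub> y) = b \<triangleright>\<^bsub>\<C>\<^esub> (x \<triangleleft>\<^bsub>\<C>\<^esub> y)"
    using y bc x by (simp add: ract_mult lact_ract flip: bx)
  then show "tr (b \<otimes>\<^bsub>A\<^esub> y) = b \<otimes>\<^bsub>A\<^esub> tr y"
    using y bc x by (simp add: tr_def \<theta>'_simps)
qed

section \<open>Chain conditions for the coring, its left dual and \<open>A\<close>\<close>

lemma right_module_C: "right_module A \<C> (\<lambda>c a. c \<triangleleft>\<^bsub>\<C>\<^esub> a)"
  by unfold_locales (simp_all add: ract_add ract_add_ring ract_mult)

text \<open>With \<open>\<Delta> z\<close> represented by \<open>\<Sum> k\<^sub>i (u\<^sub>i \<otimes> v\<^sub>i)\<close>, the identity \<open>z\<^sub>1 \<theta>(z\<^sub>2 \<otimes> d) = d\<close> shows that the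
  \<open>u\<^sub>i\<close> generate \<open>\<C>\<close> as a right module.\<close>

lemma has_acc_C:
  assumes noeth: "right_noetherian A"
  shows "has_acc (rsubmodule A \<C> (\<lambda>c a. c \<triangleleft>\<^bsub>\<C>\<^esub> a))"
proof -
  interpret CA: right_module A \<C> "\<lambda>c a. c \<triangleleft>\<^bsub>\<C>\<^esub> a" by (rule right_module_C)
  obtain p where p: "Poly_Mapping.keys p \<subseteq> carrier \<C> \<times> carrier \<C>"
    and rep: "\<And>\<beta>. CC.balanced \<C> \<beta> \<Longrightarrow> tensor_lift \<C> \<beta> (\<Delta> z) = lift_rep \<C> (case_prod \<beta>) p"
    using CC.tensor_lift_representative [OF abelian_C \<Delta>_simps(1) [OF z(1)]] by blast
  show ?thesis
  proof (rule CA.has_acc_finitely_generated [OF noeth])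
    show "finite (fst ` Poly_Mapping.keys p)" by simp
    show "fst ` Poly_Mapping.keys p \<subseteq> carrier \<C>" using p by auto
    fix N assume N: "CA.sub N" and E: "fst ` Poly_Mapping.keys p \<subseteq> N"
    show "carrier \<C> \<subseteq> N"
    proof
      fix d assume d: "d \<in> carrier \<C>"
      have "d = lift_rep \<C> (case_prod (\<lambda>u v. u \<triangleleft>\<^bsub>\<C>\<^esub> \<theta>' v d)) p"
        using z_act [OF d] rep [OF LF_balanced [OF \<theta>'_LM [OF d]]] by (simp add: act_def LF_def)
      also have "\<dots> \<in> N"
      proof (rule CA.sub_lift_rep [OF N])
        fix q assume q: "q \<in> Poly_Mapping.keys p"
        then obtain u v where uv: "q = (u, v)" "u \<in> carrier \<C>" "v \<in> carrier \<C>" using p by blast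
        moreover have "u \<in> N" using E q uv by force
        ultimately show "case_prod (\<lambda>u v. u \<triangleleft>\<^bsub>\<C>\<^esub> \<theta>' v d) q \<in> N"
          using rsubmoduleD(4) [OF N] d by (simp add: \<theta>'_simps)
      qed
      finally show "d \<in> N" .
    qed
  qed
qed

text \<open>\<open>\<phi>\<close> is right \<open>A\<close>-linear from \<open>\<C>\<close> onto the
  left dual, and preimages under a surjection separate submodules. Surjectivity is the identity
  \<open>\<phi> (z \<bullet> f) = f\<close>.\<close>

lemma has_acc_D:
  assumes noeth: "right_noetherian A"
  shows "has_acc (rsubmodule A D (\<lambda>f a. f \<otimes>\<^bsub>D\<^esub> j a))"
proof (rule has_acc_transfer [OF has_acc_C [OF noeth]])
  interpret D: ring D by (rule ring_D)
  define \<phi> where "\<phi> d = (\<lambda>c\<in>carrier \<C>. \<theta>' c d)" for d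
  define \<Phi> where "\<Phi> X = {d \<in> carrier \<C>. \<phi> d \<in> X}" for X
  have \<phi>_closed: "\<phi> d \<in> carrier D" if "d \<in> carrier \<C>" for d
    unfolding \<phi>_def using that by (intro restrict_D \<theta>'_LM)
  have \<phi>_add: "\<phi> (d \<oplus>\<^bsub>\<C>\<^esub> d') = \<phi> d \<oplus>\<^bsub>D\<^esub> \<phi> d'" if "d \<in> carrier \<C>" "d' \<in> carrier \<C>" for d d'
    using that by (simp add: \<phi>_def D_simps(5) \<theta>'_simps cong: restrict_cong)
  have \<phi>_zero: "\<phi> \<zero>\<^bsub>\<C>\<^esub> = \<zero>\<^bsub>D\<^esub>"
    using \<phi>_add [of "\<zero>\<^bsub>\<C>\<^esub>" "\<zero>\<^bsub>\<C>\<^esub>"] \<phi>_closed [of "\<zero>\<^bsub>\<C>\<^esub>"] by (metis D.add.l_cancel_one' M.l_zero M.zero_closed)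
  have \<phi>_act: "\<phi> (d \<triangleleft>\<^bsub>\<C>\<^esub> a) = \<phi> d \<otimes>\<^bsub>D\<^esub> j a" if "d \<in> carrier \<C>" "a \<in> carrier A" for d a
    unfolding D_mult_j [OF \<phi>_closed [OF that(1)] that(2)]
    using that by (simp add: \<phi>_def \<theta>'_simps cong: restrict_cong)
  show "rsubmodule A \<C> (\<lambda>c a. c \<triangleleft>\<^bsub>\<C>\<^esub> a) (\<Phi> X)" if "rsubmodule A D (\<lambda>f a. f \<otimes>\<^bsub>D\<^esub> j a) X" for X
    unfolding \<Phi>_def
    by (rule rsubmodule_vimage [OF abelian_C that, where j = id])
      (simp_all add: \<phi>_closed \<phi>_zero \<phi>_add \<phi>_act)
  show "\<Phi> X \<subseteq> \<Phi> Y" if "X \<subseteq> Y" for X Y using that by (auto simp: \<Phi>_def)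
  have le: "X \<subseteq> Y"
    if X: "rsubmodule A D (\<lambda>f a. f \<otimes>\<^bsub>D\<^esub> j a) X" and eq: "\<Phi> X = \<Phi> Y" for X Y
  proof
    fix f assume f: "f \<in> X"
    then have fD: "f \<in> carrier D" using rsubmoduleD(1) [OF X] by blast
    then have fLM: "f \<in> LM" by (simp add: D_simps(1))
    have zf: "z \<bullet> f \<in> carrier \<C>" using fLM z(1) by simp
    have f_eq: "\<phi> (z \<bullet> f) = f"
      by (rule D_eqI [symmetric, OF fD \<phi>_closed [OF zf]]) (simp add: \<phi>_def LM_eq_\<theta>' [OF fLM])
    have "z \<bullet> f \<in> \<Phi> X" using f zf by (simp add: \<Phi>_def f_eq)
    then show "f \<in> Y" unfolding eq by (simp add: \<Phi>_def f_eq)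
  qed
  show "X = Y"
    if "rsubmodule A D (\<lambda>f a. f \<otimes>\<^bsub>D\<^esub> j a) X" "rsubmodule A D (\<lambda>f a. f \<otimes>\<^bsub>D\<^esub> j a) Y" "\<Phi> X = \<Phi> Y" for X Y
    using le [OF that(1,3)] le [OF that(2) that(3) [symmetric]] by (rule equalityI)
qed

text \<open>A \<open>B\<close>-submodule \<open>X\<close> of \<open>A\<close> is recovered from \<open>{c. \<theta>(cA \<otimes> x) \<subseteq> X}\<close> by means of
  \<open>\<theta>(y x a \<otimes> x) = y tr(a)\<close>.\<close>

lemma has_acc_A_over_B:
  assumes noeth: "right_noetherian A"
  shows "has_acc (rsubmodule BR A (\<otimes>\<^bsub>A\<^esub>))"
proof (rule has_acc_transfer [OF has_acc_C [OF noeth]])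
  \<comment> \<open>Testing all \<open>a\<close> makes \<open>\<Phi> X\<close> stable under
    \<open>A\<close> although \<open>X\<close> is only assumed stable under
    \<open>B\<close>.\<close>
  define \<Phi> where "\<Phi> X = {c \<in> carrier \<C>. \<forall>a\<in>carrier A. \<theta>' (c \<triangleleft>\<^bsub>\<C>\<^esub> a) x \<in> X}" for X
  have zero: "\<theta>' (\<zero>\<^bsub>\<C>\<^esub> \<triangleleft>\<^bsub>\<C>\<^esub> a) x = \<zero>\<^bsub>A\<^esub>" if a: "a \<in> carrier A" for a
  proof -
    have "\<theta>' (\<zero>\<^bsub>\<C>\<^esub> \<triangleleft>\<^bsub>\<C>\<^esub> a) x \<oplus>\<^bsub>A\<^esub> \<theta>' (\<zero>\<^bsub>\<C>\<^esub> \<triangleleft>\<^bsub>\<C>\<^esub> a) x = \<theta>' (\<zero>\<^bsub>\<C>\<^esub> \<triangleleft>\<^bsub>\<C>\<^esub> a) x"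
      using a x by (simp flip: \<theta>'_simps(2) ract_add)
    then show ?thesis using a x by (simp add: \<theta>'_simps(1))
  qed
  show "rsubmodule A \<C> (\<lambda>c a. c \<triangleleft>\<^bsub>\<C>\<^esub> a) (\<Phi> X)" if X: "rsubmodule BR A (\<otimes>\<^bsub>A\<^esub>) X" for X
  proof (rule rsubmoduleI)
    show "\<Phi> X \<subseteq> carrier \<C>" by (auto simp: \<Phi>_def)
    show "\<zero>\<^bsub>\<C>\<^esub> \<in> \<Phi> X" using rsubmoduleD(2) [OF X] by (simp add: \<Phi>_def zero)
    fix c assume c: "c \<in> \<Phi> X"
    show "c \<oplus>\<^bsub>\<C>\<^esub> d \<in> \<Phi> X" if "d \<in> \<Phi> X" for d
      using c that rsubmoduleD(3) [OF X] x by (simp add: \<Phi>_def ract_add \<theta>'_simps(1,2))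
    show "c \<triangleleft>\<^bsub>\<C>\<^esub> s \<in> \<Phi> X" if "s \<in> carrier A" for s
      using c that by (simp add: \<Phi>_def flip: ract_mult)
  qed
  show "\<Phi> X \<subseteq> \<Phi> Y" if "X \<subseteq> Y" for X Y using that by (auto simp: \<Phi>_def)
  have tr_eq: "\<theta>' ((y \<triangleright>\<^bsub>\<C>\<^esub> x) \<triangleleft>\<^bsub>\<C>\<^esub> a) x = y \<otimes>\<^bsub>A\<^esub> tr a" if "y \<in> carrier A" "a \<in> carrier A" for y a
    using that x by (simp add: lact_ract \<theta>'_simps tr_def)
  have mem: "y \<in> X \<longleftrightarrow> y \<triangleright>\<^bsub>\<C>\<^esub> x \<in> \<Phi> X" if X: "rsubmodule BR A (\<otimes>\<^bsub>A\<^esub>) X" and y: "y \<in> carrier A" for X y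
  proof
    assume yX: "y \<in> X"
    have "y \<otimes>\<^bsub>A\<^esub> tr a \<in> X" if "a \<in> carrier A" for a
      using rsubmoduleD(4) [OF X yX, of "tr a"] tr_closed [OF that] by simp
    then show "y \<triangleright>\<^bsub>\<C>\<^esub> x \<in> \<Phi> X" using y x by (simp add: \<Phi>_def tr_eq)
  next
    assume "y \<triangleright>\<^bsub>\<C>\<^esub> x \<in> \<Phi> X"
    then have "y \<otimes>\<^bsub>A\<^esub> tr a\<^sub>0 \<in> X" using a\<^sub>0 tr_eq [OF y a\<^sub>0] by (auto simp: \<Phi>_def)
    then show "y \<in> X" using y tr_one by simp
  qed
  show "X = Y"
    if X: "rsubmodule BR A (\<otimes>\<^bsub>A\<^esub>) X" and Y: "rsubmodule BR A (\<otimes>\<^bsub>A\<^esub>) Y" and eq: "\<Phi> X = \<Phi> Y" for X Y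
  proof -
    have "y \<in> X \<longleftrightarrow> y \<in> Y" for y
      using mem [OF X, of y] mem [OF Y, of y] rsubmoduleD(1) [OF X] rsubmoduleD(1) [OF Y] eq by blast
    then show ?thesis by blast
  qed
qed

text \<open>The action on \<open>\<C>\<close> is transported along y \<mapsto> \<open>x y\<close>:
  by \<open>x_act\<close>, acting with \<open>f\<close> on \<open>x y\<close> gives
  \<open>x f(x y)\<close>, and this is the module law.\<close>

lemma right_module_D: "right_module D A (\<lambda>y f. f (x \<triangleleft>\<^bsub>\<C>\<^esub> y))"
proof -
  interpret D: ring D by (rule ring_D)
  show ?thesis
  proof
    fix y f assume y: "y \<in> carrier A" and f: "f \<in> carrier D"
    then have fLM: "f \<in> LM" by (simp add: D_simps(1))
    show "f (x \<triangleleft>\<^bsub>\<C>\<^esub> y) \<in> carrier A" using y x by (simp add: LM_simps fLM)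
    show "f (x \<triangleleft>\<^bsub>\<C>\<^esub> (y \<oplus>\<^bsub>A\<^esub> y')) = f (x \<triangleleft>\<^bsub>\<C>\<^esub> y) \<oplus>\<^bsub>A\<^esub> f (x \<triangleleft>\<^bsub>\<C>\<^esub> y')" if "y' \<in> carrier A" for y'
      using y that x by (simp add: ract_add_ring LM_simps fLM)
    fix g assume g: "g \<in> carrier D"
    show "(f \<oplus>\<^bsub>D\<^esub> g) (x \<triangleleft>\<^bsub>\<C>\<^esub> y) = f (x \<triangleleft>\<^bsub>\<C>\<^esub> y) \<oplus>\<^bsub>A\<^esub> g (x \<triangleleft>\<^bsub>\<C>\<^esub> y)"
      using y x by (simp add: D_simps(5))
    show "(f \<otimes>\<^bsub>D\<^esub> g) (x \<triangleleft>\<^bsub>\<C>\<^esub> y) = g (x \<triangleleft>\<^bsub>\<C>\<^esub> f (x \<triangleleft>\<^bsub>\<C>\<^esub> y))"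
      using y x by (simp add: D_simps(2) x_act fLM)
  next
    fix y assume "y \<in> carrier A"
    then show "\<one>\<^bsub>D\<^esub> (x \<triangleleft>\<^bsub>\<C>\<^esub> y) = y" using x by (simp add: D_simps(3) \<epsilon>_simps)
  qed
qed

text \<open>Through \<open>j\<close> the action restricts to right multiplication on
  \<open>A\<close>, so every \<open>D\<close>-submodule is a right ideal.\<close>

lemma has_acc_A_over_D:
  assumes noeth: "right_noetherian A"
  shows "has_acc (rsubmodule D A (\<lambda>y f. f (x \<triangleleft>\<^bsub>\<C>\<^esub> y)))"
proof (rule has_acc_transfer [where \<Phi> = id])
  show "has_acc (rsubmodule A A (\<otimes>\<^bsub>A\<^esub>))" using noeth by (simp add: R.right_noetherian_iff)
  fix X assume X: "rsubmodule D A (\<lambda>y f. f (x \<triangleleft>\<^bsub>\<C>\<^esub> y)) X"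
  have "y \<otimes>\<^bsub>A\<^esub> a \<in> X" if y: "y \<in> X" and a: "a \<in> carrier A" for y a
  proof -
    have "y \<in> carrier A" using y rsubmoduleD(1) [OF X] by blast
    then have "j a (x \<triangleleft>\<^bsub>\<C>\<^esub> y) = y \<otimes>\<^bsub>A\<^esub> a" using x by (simp add: j_def \<epsilon>_simps)
    then show ?thesis using rsubmoduleD(4) [OF X y j_D [OF a]] by simp
  qed
  then show "rsubmodule A A (\<otimes>\<^bsub>A\<^esub>) (id X)"
    using rsubmoduleD(1-3) [OF X] by (intro rsubmoduleI) simp_all
qed simp_all

lemma right_FBN_D_imp_B:
  assumes fbn: "right_FBN D" and noeth: "right_noetherian A"
  shows "right_FBN BR"
proof (rule right_FBN_BR [OF right_module_D has_acc_A_over_D [OF noeth] fbn noeth])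
  fix f a assume f: "f \<in> carrier D" and a: "a \<in> carrier A"
  define g where "g = (\<lambda>c. f c \<otimes>\<^bsub>A\<^esub> a)"
  have g: "g \<in> LM" unfolding g_def using f a by (intro LM_mult_right) (simp_all add: D_simps(1))
  \<comment> \<open>\<open>w\<close> represents \<open>g\<close> as
    \<open>\<theta>(- \<otimes> w)\<close>. Adjointness turns
    \<open>\<theta>((x y) \<bullet> g \<otimes> x)\<close> into
    \<open>\<theta>(x y \<otimes> w \<bullet> \<theta>(- \<otimes> x))\<close>, whose last entry is
    \<open>\<theta>(w \<otimes> x) x\<close>; hence the witness
    \<open>\<theta>' w x\<close>.\<close>
  define w where "w = z \<bullet> g"
  have w: "w \<in> carrier \<C>" using g z(1) by (simp add: w_def)
  have "tr (f (x \<triangleleft>\<^bsub>\<C>\<^esub> y) \<otimes>\<^bsub>A\<^esub> a) = tr (y \<otimes>\<^bsub>A\<^esub> \<theta>' w x)" if y: "y \<in> carrier A" for y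
  proof -
    have xy: "x \<triangleleft>\<^bsub>\<C>\<^esub> y \<in> carrier \<C>" using x y by simp
    have "tr (f (x \<triangleleft>\<^bsub>\<C>\<^esub> y) \<otimes>\<^bsub>A\<^esub> a) = \<theta>' ((x \<triangleleft>\<^bsub>\<C>\<^esub> y) \<bullet> g) x"
      using x_act [OF g y] by (simp add: tr_def g_def)
    also have "(x \<triangleleft>\<^bsub>\<C>\<^esub> y) \<bullet> g = (x \<triangleleft>\<^bsub>\<C>\<^esub> y) \<bullet> (\<lambda>v. \<theta>' v w)"
      unfolding w_def by (rule act_cong [OF g LM_eq_\<theta>' [OF g] xy])
    also have "\<theta>' \<dots> x = \<theta>' (x \<triangleleft>\<^bsub>\<C>\<^esub> y) (w \<bullet> (\<lambda>v. \<theta>' v x))"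
      by (rule LM_frobenius_act [OF \<theta>'_LM [OF x(1)] xy w])
    also have "\<dots> = tr (y \<otimes>\<^bsub>A\<^esub> \<theta>' w x)"
      unfolding act_\<theta>'_x [OF w] tr_def using x y w by (simp add: ract_mult \<theta>'_simps)
    finally show ?thesis .
  qed
  then show "\<exists>a'\<in>carrier A. \<forall>y\<in>carrier A. tr (f (x \<triangleleft>\<^bsub>\<C>\<^esub> y) \<otimes>\<^bsub>A\<^esub> a) = tr (y \<otimes>\<^bsub>A\<^esub> a')"
    using \<theta>'_simps(1) [OF w x(1)] by blast
next
  fix b assume b: "b \<in> B"
  \<comment> \<open>With the idempotent \<open>e = \<theta>(- a\<^sub>0 \<otimes> x)\<close> of
    \<open>D\<close> this is \<open>e b\<close>, the element of the corner \<open>e D e\<close> that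
    corresponds to \<open>b\<close>.\<close>
  define f where "f = (\<lambda>c\<in>carrier \<C>. \<theta>' (c \<triangleleft>\<^bsub>\<C>\<^esub> a\<^sub>0) x \<otimes>\<^bsub>A\<^esub> b)"
  have "f \<in> carrier D"
    unfolding f_def using b a\<^sub>0 by (intro restrict_D LM_mult_right LM_ract [OF \<theta>'_LM [OF x(1)]]) simp_all
  moreover have "f (x \<triangleleft>\<^bsub>\<C>\<^esub> y) = tr (y \<otimes>\<^bsub>A\<^esub> a\<^sub>0) \<otimes>\<^bsub>A\<^esub> b" if "y \<in> carrier A" for y
    using that x a\<^sub>0 by (simp add: f_def tr_def ract_mult)
  ultimately show "\<exists>f\<in>carrier D. \<forall>y\<in>carrier A. f (x \<triangleleft>\<^bsub>\<C>\<^esub> y) = tr (y \<otimes>\<^bsub>A\<^esub> a\<^sub>0) \<otimes>\<^bsub>A\<^esub> b" by blast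
qed

lemma right_FBN_A_imp_D: "right_FBN A \<Longrightarrow> right_FBN D"
  by (rule ring.right_FBN_finite_extension [OF ring_D ring_A _ j_ring_hom has_acc_D])
    (simp_all add: right_FBN_def)

lemma right_FBN_B_imp_A:
  assumes "right_FBN BR" "right_noetherian A"
  shows "right_FBN A"
proof (rule R.right_FBN_finite_extension [OF ring_BR assms(1), where j = id])
  show "id \<in> ring_hom BR A" by (rule ring_hom_memI) simp_all
  show "has_acc (rsubmodule BR A (\<lambda>r s. r \<otimes>\<^bsub>A\<^esub> id s))"
    using has_acc_A_over_B [OF assms(2)] by simp
qed

end

theorem corollary7p1:
  fixes A :: "('a, 'm) ring_scheme" and \<C> :: "('a, 'c) bimodule"
    and \<Delta> :: "'c \<Rightarrow> ('c, 'c) tensor" and \<epsilon> :: "'c \<Rightarrow> 'a" and x z :: 'c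
    and \<theta> :: "('c, 'c) tensor \<Rightarrow> 'a"
  assumes "coring A \<C> \<Delta> \<epsilon>"
    and "grouplike A \<C> \<Delta> \<epsilon> x"
    and "frobenius_system A \<C> \<Delta> \<epsilon> \<theta> z"
    and "\<exists>a\<in>carrier A. \<theta> (pure_tensor A \<C> \<C> (x \<triangleleft>\<^bsub>\<C>\<^esub> a) x) = \<one>\<^bsub>A\<^esub>"
  shows "(right_FBN A \<longleftrightarrow> right_FBN (left_dual A \<C> \<Delta> \<epsilon>) \<and> right_noetherian A) \<and>
         (right_FBN A \<longleftrightarrow> right_FBN (coinvariants A \<C> x) \<and> right_noetherian A)"
proof -
  obtain a\<^sub>0 where "a\<^sub>0 \<in> carrier A" "\<theta> (pure_tensor A \<C> \<C> (x \<triangleleft>\<^bsub>\<C>\<^esub> a\<^sub>0) x) = \<one>\<^bsub>A\<^esub>"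
    using assms(4) by (rule bexE)
  then interpret frobenius_coring A \<C> \<Delta> \<epsilon> x z \<theta> a\<^sub>0
    using assms by (intro frobenius_coring.intro frobenius_coring_axioms.intro)
  have "right_FBN A \<Longrightarrow> right_noetherian A" by (simp add: right_FBN_def)
  moreover have "coinvariants A \<C> x = BR" by (simp add: coinvariants_def)
  ultimately show ?thesis
    using right_FBN_A_imp_D right_FBN_D_imp_B right_FBN_B_imp_A by auto
qed

end
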